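(* Let $k$ be a field of characteristic $0$. There is an algorithm which, given positive integers $n,d$, produces a finite set of pairs $\{(I_i,V_i)\}$, where each $I_i$ is a left ideal of $A_n(k)[\bar a][s]$ (given by finitely many explicit generators) and each $V_i$ is a locally closed subset of $\mathbb{P}(n,d;k)$, such that the $V_i$ together cover $\mathbb{P}(n,d;k)$ and, for every nonzero polynomial $f\in R_n(k)$ of degree at most $d$ corresponding to a point $P\in V_i$, the ideal $\mathrm{Ann}(f^s)\subset A_n(k)[s]$ equals $\sigma_P(I_i)$, the specialization of $I_i$ at $P$.
   Context: $R_n(k)=k[x_1,\dots,x_n]$ and $A_n(k)=k\langle x_1,\dots,x_n,\partial_1,\dots,\partial_n\rangle$ is the $n$-th Weyl algebra. For nonzero $f\in R_n(k)$, $\mathrm{Ann}(f^s)$ is the left ideal of all elements of $A_n(k)[s]$ annihilating the formal power $f^s$. Let $N$ be the number of monomials in $n$ variables of degree at most $d$, let $\bar a=\{a_\alpha : |\alpha|\le d\}$ be $N$ indeterminates, and let $\mathbb{P}(n,d;k)\cong\mathbb{P}^{N-1}_k$ be the projective space with homogeneous coordinate ring $k[\bar a]$. A nonzero polynomial $f=\sum_{|\alpha|\le d}c_\alpha x^\alpha\in R_n(k)$ corresponds to the $k$-rational point $P$ with homogeneous coordinates $(c_\alpha)_\alpha$. In $A_n(k)[\bar a][s]$ the variables $a_\alpha$ and $s$ are central. The specialization $\sigma_P(I)$ of a left ideal $I\subset A_n(k)[\bar a][s]$ is the left ideal of $A_n(k)[s]$ obtained from $I$ by substituting for each $a_\alpha$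 the corresponding coefficient $c_\alpha$ of $f$. *)

theory Defs
  imports
    "HOL-Library.Poly_Mapping"
    "HOL-Library.Nat_Bijection"
    "HOL-Computational_Algebra.Polynomial"
    "HOL-Computational_Algebra.Fraction_Field"
    "HOL-Algebra.Ideal"
begin

abbreviation "keys \<equiv> Poly_Mapping.keys"
abbreviation "lookup \<equiv> Poly_Mapping.lookup"

section \<open>Partial recursive functions\<close>

text \<open>An algorithm is a Kleene (mu-recursive) function; \<open>computes F xs y\<close> says that \<open>F\<close> halts on
  the argument list \<open>xs\<close> with value \<open>y\<close>.\<close>

datatype recfun =
    RZero
  | RSucc
  | RProj nat
  | RComp recfun "recfun list"
  | RPrec recfun recfun
  | RMu recfun

inductive computes :: "recfun \<Rightarrow> nat list \<Rightarrow> nat \<Rightarrow> bool" where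
  Zero: "computes RZero xs 0"
| Succ: "computes RSucc [x] (Suc x)"
| Proj: "i < length xs \<Longrightarrow> computes (RProj i) xs (xs ! i)"
| Comp: "list_all2 (\<lambda>g y. computes g xs y) gs ys \<Longrightarrow> computes f ys z \<Longrightarrow>
    computes (RComp f gs) xs z"
| Prec_0: "computes f xs z \<Longrightarrow> computes (RPrec f g) (0 # xs) z"
| Prec_Suc: "computes (RPrec f g) (m # xs) y \<Longrightarrow> computes g (m # y # xs) z \<Longrightarrow>
    computes (RPrec f g) (Suc m # xs) z"
| Mu: "computes f (m # xs) 0 \<Longrightarrow> (\<forall>i<m. \<exists>y>0. computes f (i # xs) y) \<Longrightarrow>
    computes (RMu f) xs m"

inductive_cases computes_elims:
  "computes RZero xs y" "computes RSucc xs y" "computes (RProj i) xs y"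
  "computes (RComp f gs) xs y" "computes (RPrec f g) (0 # xs) y"
  "computes (RPrec f g) (Suc m # xs) y" "computes (RMu f) xs y"

lemma computes_deterministic: "computes F xs y \<Longrightarrow> computes F xs z \<Longrightarrow> y = z"
proof (induction arbitrary: z rule: computes.induct)
  case (Comp xs gs ys f y)
  from Comp.prems obtain ys' where ys': "list_all2 (\<lambda>g y. computes g xs y) gs ys'"
    and f: "computes f ys' z"
    by (rule computes_elims)
  have "ys = ys'"
    using Comp.IH(1) ys' by (auto simp: list_all2_conv_all_nth intro!: nth_equalityI)
  with f Comp.IH(2) show ?case by blast
next
  case (Prec_Suc f g m xs y u)
  from Prec_Suc.prems obtain y' where "computes (RPrec f g) (m # xs) y'" "computes g (m # y' # xs) z"
    by (rule computes_elims)
  with Prec_Suc.IH show ?case by blast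
next
  case (Mu f m xs)
  from Mu.prems have z: "computes f (z # xs) 0" "\<forall>i<z. \<exists>y>0. computes f (i # xs) y"
    by (auto elim: computes_elims(7))
  show ?case
    using z Mu.IH by (metis less_numeral_extra(3) linorder_neqE_nat)
qed (blast elim: computes_elims)+


section \<open>Linear extension along finitely supported functions\<close>

definition lin_ext :: "('a \<Rightarrow> 'b \<Rightarrow> 'm) \<Rightarrow> ('a \<Rightarrow>\<^sub>0 'b::zero) \<Rightarrow> 'm::comm_monoid_add" where
  "lin_ext \<phi> p = (\<Sum>m\<in>keys p. \<phi> m (lookup p m))"

lemma lin_ext_superset:
  assumes "finite A" "keys p \<subseteq> A" "\<And>m. \<phi> m 0 = 0"
  shows "lin_ext \<phi> p = (\<Sum>m\<in>A. \<phi> m (lookup p m))"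
  unfolding lin_ext_def using assms
  by (intro sum.mono_neutral_left) (auto simp: in_keys_iff)

lemma lin_ext_0 [simp]: "lin_ext \<phi> 0 = 0"
  by (simp add: lin_ext_def)

lemma lin_ext_single [simp]: "\<phi> m 0 = 0 \<Longrightarrow> lin_ext \<phi> (Poly_Mapping.single m a) = \<phi> m a"
  by (simp add: lin_ext_def)

lemma lin_ext_add:
  fixes p q :: "'a \<Rightarrow>\<^sub>0 'b::monoid_add"
  assumes "\<And>m. \<phi> m 0 = 0" "\<And>m a b. \<phi> m (a + b) = \<phi> m a + \<phi> m b"
  shows "lin_ext \<phi> (p + q) = lin_ext \<phi> p + lin_ext \<phi> q"
proof -
  let ?A = "keys p \<union> keys q"
  have "keys (p + q) \<subseteq> ?A" by (rule Poly_Mapping.keys_add)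
  then show ?thesis
    using assms by (simp add: lin_ext_superset[of ?A] lookup_add sum.distrib)
qed

lemma poly_mapping_add_induct [case_names zero single add]:
  fixes p :: "'a \<Rightarrow>\<^sub>0 'b::comm_monoid_add"
  assumes "P 0" "\<And>m a. P (Poly_Mapping.single m a)" "\<And>p q. P p \<Longrightarrow> P q \<Longrightarrow> P (p + q)"
  shows "P p"
proof -
  have "p = (\<Sum>m\<in>keys p. Poly_Mapping.single m (lookup p m))"
    by (rule poly_mapping_eqI)
      (auto simp: lookup_sum lookup_single when_def in_keys_iff)
  moreover have "P (\<Sum>m\<in>A. Poly_Mapping.single m (lookup p m))" for A
    by (induction A rule: infinite_finite_induct) (auto simp: assms)
  ultimately show ?thesis by metis
qed

lemma lin_ext_mult:
  fixes p q :: "'a::monoid_add \<Rightarrow>\<^sub>0 'b::semiring_0" and \<phi> :: "'a \<Rightarrow> 'b \<Rightarrow> 'c::semiring_0"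
  assumes "\<And>m. \<phi> m 0 = 0" "\<And>m a b. \<phi> m (a + b) = \<phi> m a + \<phi> m b"
    and "\<And>m n a b. \<phi> (m + n) (a * b) = \<phi> m a * \<phi> n b"
  shows "lin_ext \<phi> (p * q) = lin_ext \<phi> p * lin_ext \<phi> q"
proof (induction p rule: poly_mapping_add_induct)
  case (single m a)
  show ?case
  proof (induction q rule: poly_mapping_add_induct)
    case (single n b)
    show ?case using assms by (simp add: mult_single)
  qed (simp_all add: distrib_left lin_ext_add assms(1,2))
qed (simp_all add: distrib_right lin_ext_add assms(1,2))


section \<open>Multivariate polynomials\<close>

text \<open>\<open>('v, 'c) mpoly\<close> is the polynomial ring over \<open>'c\<close> with one variable for every element of
  \<open>'v\<close>; \<open>mpoly_over A\<close> is the subring of the polynomials in the variables from \<open>A\<close>.\<close>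

type_synonym ('v, 'c) mpoly = "('v \<Rightarrow>\<^sub>0 nat) \<Rightarrow>\<^sub>0 'c"

definition mpoly_over :: "'v set \<Rightarrow> ('v, 'c::zero) mpoly set" where
  "mpoly_over A = {p. \<forall>m\<in>keys p. keys m \<subseteq> A}"

abbreviation Const :: "'c::zero \<Rightarrow> ('v, 'c) mpoly" where
  "Const \<equiv> Poly_Mapping.single 0"

definition Var :: "'v \<Rightarrow> ('v, 'c::comm_semiring_1) mpoly" where
  "Var v = Poly_Mapping.single (Poly_Mapping.single v 1) 1"

definition mdeg :: "('v \<Rightarrow>\<^sub>0 nat) \<Rightarrow> nat" where
  "mdeg m = (\<Sum>v\<in>keys m. lookup m v)"

definition monom_eval :: "('v \<Rightarrow> 'c) \<Rightarrow> ('v \<Rightarrow>\<^sub>0 nat) \<Rightarrow> 'c::comm_semiring_1" where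
  "monom_eval c m = (\<Prod>v\<in>keys m. c v ^ lookup m v)"

definition mpoly_eval :: "('v \<Rightarrow> 'c) \<Rightarrow> ('v, 'c) mpoly \<Rightarrow> 'c::comm_semiring_1" where
  "mpoly_eval c = lin_ext (\<lambda>m a. a * monom_eval c m)"

lemma monom_eval_superset:
  "finite A \<Longrightarrow> keys m \<subseteq> A \<Longrightarrow> monom_eval c m = (\<Prod>v\<in>A. c v ^ lookup m v)"
  unfolding monom_eval_def by (intro prod.mono_neutral_left) (auto simp: in_keys_iff)

lemma monom_eval_add: "monom_eval c (m + n) = monom_eval c m * monom_eval c n"
proof -
  let ?A = "keys m \<union> keys n"
  have "keys (m + n) \<subseteq> ?A" by (rule Poly_Mapping.keys_add)
  then show ?thesis
    by (simp add: monom_eval_superset[of ?A] lookup_add power_add prod.distrib)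
qed

lemma mpoly_eval_0 [simp]: "mpoly_eval c 0 = 0"
  by (simp add: mpoly_eval_def)

lemma mpoly_eval_1 [simp]: "mpoly_eval c 1 = 1"
  by (simp add: mpoly_eval_def monom_eval_def flip: single_one)

lemma mpoly_eval_add: "mpoly_eval c (p + q) = mpoly_eval c p + mpoly_eval c q"
  unfolding mpoly_eval_def by (rule lin_ext_add) (simp_all only: distrib_right mult_zero_left)

lemma mpoly_eval_mult: "mpoly_eval c (p * q) = mpoly_eval c p * mpoly_eval c q"
  unfolding mpoly_eval_def
  by (rule lin_ext_mult) (simp_all add: algebra_simps monom_eval_add)

definition mpoly_deriv :: "'v \<Rightarrow> ('v, 'c) mpoly \<Rightarrow> ('v, 'c::comm_semiring_1) mpoly" where
  "mpoly_deriv i = lin_ext (\<lambda>m a.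
     Poly_Mapping.single (m - Poly_Mapping.single i 1) (of_nat (lookup m i) * a))"

lemma mpoly_deriv_0 [simp]: "mpoly_deriv i 0 = 0"
  by (simp add: mpoly_deriv_def)

lemma mpoly_deriv_single:
  "mpoly_deriv i (Poly_Mapping.single m a) =
     Poly_Mapping.single (m - Poly_Mapping.single i 1) (of_nat (lookup m i) * a)"
  by (simp add: mpoly_deriv_def)

lemma mpoly_deriv_add: "mpoly_deriv i (p + q) = mpoly_deriv i p + mpoly_deriv i q"
  unfolding mpoly_deriv_def by (rule lin_ext_add) (simp_all add: distrib_left single_add)

lemma mpoly_deriv_sum: "mpoly_deriv i (sum g A) = (\<Sum>x\<in>A. mpoly_deriv i (g x))"
  by (induction A rule: infinite_finite_induct) (simp_all add: mpoly_deriv_add)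

lemma mpoly_deriv_Const [simp]: "mpoly_deriv i (Const a) = 0"
  by (simp add: mpoly_deriv_single)

lemma mpoly_deriv_1 [simp]: "mpoly_deriv i 1 = 0"
  by (simp add: mpoly_deriv_single flip: single_one)

lemma mpoly_deriv_Var: "mpoly_deriv i (Var j) = (if i = j then 1 else 0)"
  by (auto simp: Var_def mpoly_deriv_single lookup_single simp flip: single_one)

lemma monom_minus_add:
  fixes m n :: "'v \<Rightarrow>\<^sub>0 nat"
  assumes "lookup m i \<noteq> 0"
  shows "m + n - Poly_Mapping.single i 1 = (m - Poly_Mapping.single i 1) + n"
  using assms by (intro poly_mapping_eqI) (auto simp: lookup_add lookup_minus lookup_single when_def)

lemma mpoly_deriv_mult:
  "mpoly_deriv i (p * q) = mpoly_deriv i p * q + p * mpoly_deriv i q"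
proof (induction p rule: poly_mapping_add_induct)
  case (single m a)
  show ?case
  proof (induction q rule: poly_mapping_add_induct)
    case (single n b)
    show ?case
      using monom_minus_add[of m i n] monom_minus_add[of n i m]
      by (cases "lookup m i = 0"; cases "lookup n i = 0")
        (simp_all add: mult_single mpoly_deriv_single lookup_add algebra_simps flip: single_add)
  qed (simp_all add: mpoly_deriv_add algebra_simps)
qed (simp_all add: mpoly_deriv_add algebra_simps)

lemma mpoly_deriv_commute: "mpoly_deriv i (mpoly_deriv j p) = mpoly_deriv j (mpoly_deriv i p)"
proof (induction p rule: poly_mapping_add_induct)
  case (single m a)
  have "m - Poly_Mapping.single j 1 - Poly_Mapping.single i 1 =
      m - Poly_Mapping.single i 1 - Poly_Mapping.single j (1::nat)"
    by (rule poly_mapping_eqI) (simp add: lookup_minus)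
  then show ?case
    by (cases "i = j") (simp_all add: mpoly_deriv_single lookup_minus lookup_single mult_ac)
qed (simp_all add: mpoly_deriv_add)


section \<open>The Weyl algebra\<close>

text \<open>The free algebra \<open>C\<langle>x_0, x_1, \<dots>, \<partial>_0, \<partial>_1, \<dots>\<rangle>\<close> is the monoid algebra of the free monoid.\<close>

datatype 'a free_monoid = Word (letters: "'a list")

instantiation free_monoid :: (type) monoid_add
begin
definition zero_free_monoid :: "'a free_monoid" where "0 = Word []"
definition plus_free_monoid :: "'a free_monoid \<Rightarrow> 'a free_monoid \<Rightarrow> 'a free_monoid" where
  "u + v = Word (letters u @ letters v)"
instance by standard (simp_all add: zero_free_monoid_def plus_free_monoid_def)
end

datatype weyl_letter = LX nat | LD nat

type_synonym 'c free_weyl = "weyl_letter free_monoid \<Rightarrow>\<^sub>0 'c"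

abbreviation fgen :: "weyl_letter \<Rightarrow> 'c::comm_ring_1 free_weyl" where
  "fgen l \<equiv> Poly_Mapping.single (Word [l]) 1"

inductive_set weyl_relations :: "'c::comm_ring_1 free_weyl set" where
  zero: "0 \<in> weyl_relations"
| XX: "fgen (LX i) * fgen (LX j) - fgen (LX j) * fgen (LX i) \<in> weyl_relations"
| DD: "fgen (LD i) * fgen (LD j) - fgen (LD j) * fgen (LD i) \<in> weyl_relations"
| DX: "fgen (LD i) * fgen (LX j) - fgen (LX j) * fgen (LD i) - (if i = j then 1 else 0)
    \<in> weyl_relations"
| add: "p \<in> weyl_relations \<Longrightarrow> q \<in> weyl_relations \<Longrightarrow> p + q \<in> weyl_relations"
| left: "p \<in> weyl_relations \<Longrightarrow> r * p \<in> weyl_relations"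
| right: "p \<in> weyl_relations \<Longrightarrow> p * r \<in> weyl_relations"

lemma weyl_relations_uminus: "p \<in> weyl_relations \<Longrightarrow> - p \<in> weyl_relations"
  using weyl_relations.left[of p "- 1"] by simp

definition weyl_eq :: "'c::comm_ring_1 free_weyl \<Rightarrow> 'c free_weyl \<Rightarrow> bool" where
  "weyl_eq p q \<longleftrightarrow> p - q \<in> weyl_relations"

lemma equivp_weyl_eq: "equivp weyl_eq"
proof (rule equivpI)
  show "reflp weyl_eq"
    by (simp add: reflp_def weyl_eq_def weyl_relations.zero)
  show "symp weyl_eq"
    unfolding symp_def weyl_eq_def by (metis weyl_relations_uminus minus_diff_eq)
  show "transp weyl_eq"
    unfolding transp_def weyl_eq_def using weyl_relations.add by fastforce
qed

text \<open>A representation of the Weyl algebra on an abelian group with scalars.\<close>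

definition free_act :: "('c \<Rightarrow> 'm \<Rightarrow> 'm) \<Rightarrow> (weyl_letter \<Rightarrow> 'm \<Rightarrow> 'm) \<Rightarrow>
    'c::comm_ring_1 free_weyl \<Rightarrow> 'm \<Rightarrow> 'm::ab_group_add" where
  "free_act scale act p h = lin_ext (\<lambda>w a. scale a (foldr act (letters w) h)) p"

locale weyl_representation = module scale
  for scale :: "'c::comm_ring_1 \<Rightarrow> 'm::ab_group_add \<Rightarrow> 'm" +
  fixes act :: "weyl_letter \<Rightarrow> 'm \<Rightarrow> 'm"
  assumes act_add: "act l (g + h) = act l g + act l h"
    and act_scale: "act l (scale a h) = scale a (act l h)"
    and act_XX: "act (LX i) (act (LX j) h) = act (LX j) (act (LX i) h)"
    and act_DD: "act (LD i) (act (LD j) h) = act (LD j) (act (LD i) h)"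
    and act_DX: "act (LD i) (act (LX j) h) = act (LX j) (act (LD i) h) + (if i = j then h else 0)"
begin

abbreviation "rho \<equiv> free_act scale act"

lemma rho_0 [simp]: "rho 0 h = 0"
  by (simp add: free_act_def)

lemma rho_single: "rho (Poly_Mapping.single w a) h = scale a (foldr act (letters w) h)"
  by (simp add: free_act_def)

lemma rho_add: "rho (p + q) h = rho p h + rho q h"
  unfolding free_act_def by (rule lin_ext_add) (simp_all add: scale_left_distrib)

lemma word_add: "foldr act w (g + h) = foldr act w g + foldr act w h"
  by (induction w) (simp_all add: act_add)

lemma word_scale: "foldr act w (scale a h) = scale a (foldr act w h)"
  by (induction w) (simp_all add: act_scale)

lemma rho_add_right: "rho p (g + h) = rho p g + rho p h"
  by (induction p rule: poly_mapping_add_induct)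
    (simp_all add: rho_single rho_add word_add scale_right_distrib)

lemma rho_0_right [simp]: "rho p 0 = 0"
  using rho_add_right[of p 0 0] by simp

lemma rho_mult: "rho (p * q) h = rho p (rho q h)"
proof (induction p rule: poly_mapping_add_induct)
  case (single m a)
  show ?case
  proof (induction q rule: poly_mapping_add_induct)
    case (single n b)
    show ?case
      by (simp add: mult_single rho_single plus_free_monoid_def word_scale)
  qed (simp_all add: distrib_left rho_add rho_add_right)
qed (simp_all add: distrib_right rho_add)

lemma rho_diff: "rho (p - q) h = rho p h - rho q h"
  using rho_add[of "p - q" q h] by (simp add: algebra_simps)

lemma rho_1 [simp]: "rho 1 h = h"
  using rho_single[of 0 1 h] by (simp only: single_one) (simp add: zero_free_monoid_def)

lemma rho_fgen: "rho (fgen l) h = act l h"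
  by (simp add: rho_single)

lemma rho_relations: "p \<in> weyl_relations \<Longrightarrow> rho p h = 0"
proof (induction arbitrary: h rule: weyl_relations.induct)
  case (XX i j)
  show ?case by (simp only: rho_diff rho_mult rho_fgen act_XX[of i j] diff_self)
next
  case (DD i j)
  show ?case by (simp only: rho_diff rho_mult rho_fgen act_DD[of i j] diff_self)
next
  case (DX i j)
  show ?case by (simp only: rho_diff rho_mult rho_fgen act_DX[of i j]) simp
qed (simp_all add: rho_add rho_mult)

lemma rho_weyl_eq: "weyl_eq p q \<Longrightarrow> rho p h = rho q h"
  using rho_relations[of "p - q" h] by (simp add: weyl_eq_def rho_diff)

end

lemma one_notin_weyl_relations: "(1 :: 'c::comm_ring_1 free_weyl) \<notin> weyl_relations"
proof
  define act :: "weyl_letter \<Rightarrow> (nat, 'c) mpoly \<Rightarrow> (nat, 'c) mpoly" where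
    "act l = (case l of LX i \<Rightarrow> (*) (Var i) | LD i \<Rightarrow> mpoly_deriv i)" for l
  interpret weyl_representation "\<lambda>a. (*) (Const a)" act
    by standard
      (auto simp: act_def algebra_simps single_add mpoly_deriv_add mpoly_deriv_mult mpoly_deriv_Var
        mult_single mpoly_deriv_commute split: weyl_letter.splits)
  assume "(1 :: 'c free_weyl) \<in> weyl_relations"
  from rho_relations[OF this, of 1] show False by simp
qed

text \<open>The Weyl algebra in countably many variables over a commutative ring \<open>'c\<close>.\<close>

quotient_type (overloaded) 'c weyl = "'c::comm_ring_1 free_weyl" / weyl_eq
  by (rule equivp_weyl_eq)

instantiation weyl :: (comm_ring_1) ring_1
begin

lift_definition zero_weyl :: "'a weyl" is 0 .
lift_definition one_weyl :: "'a weyl" is 1 .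

lift_definition plus_weyl :: "'a weyl \<Rightarrow> 'a weyl \<Rightarrow> 'a weyl" is "(+)"
  unfolding weyl_eq_def by (metis weyl_relations.add add_diff_add)

lift_definition uminus_weyl :: "'a weyl \<Rightarrow> 'a weyl" is uminus
  unfolding weyl_eq_def by (metis weyl_relations_uminus minus_diff_minus)

lift_definition minus_weyl :: "'a weyl \<Rightarrow> 'a weyl \<Rightarrow> 'a weyl" is "(-)"
proof -
  fix p p' q q' :: "'a free_weyl"
  assume "weyl_eq p p'" "weyl_eq q q'"
  then have "(p - p') + - (q - q') \<in> weyl_relations"
    unfolding weyl_eq_def by (intro weyl_relations.add weyl_relations_uminus)
  then show "weyl_eq (p - q) (p' - q')"
    by (simp add: weyl_eq_def algebra_simps)
qed

lift_definition times_weyl :: "'a weyl \<Rightarrow> 'a weyl \<Rightarrow> 'a weyl" is "(*)"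
proof -
  fix p p' q q' :: "'a free_weyl"
  assume "weyl_eq p p'" "weyl_eq q q'"
  then have "(p - p') * q + p' * (q - q') \<in> weyl_relations"
    unfolding weyl_eq_def by (intro weyl_relations.intros)
  then show "weyl_eq (p * q) (p' * q')"
    by (simp add: weyl_eq_def algebra_simps)
qed

instance
proof
  fix a b c :: "'a weyl"
  show "a + b + c = a + (b + c)"
    by transfer (simp add: weyl_eq_def algebra_simps weyl_relations.zero)
  show "a + b = b + a"
    by transfer (simp add: weyl_eq_def algebra_simps weyl_relations.zero)
  show "0 + a = a"
    by transfer (simp add: weyl_eq_def algebra_simps weyl_relations.zero)
  show "- a + a = 0"
    by transfer (simp add: weyl_eq_def algebra_simps weyl_relations.zero)
  show "a - b = a + - b"
    by transfer (simp add: weyl_eq_def algebra_simps weyl_relations.zero)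
  show "a * b * c = a * (b * c)"
    by transfer (simp add: weyl_eq_def algebra_simps weyl_relations.zero)
  show "1 * a = a"
    by transfer (simp add: weyl_eq_def algebra_simps weyl_relations.zero)
  show "a * 1 = a"
    by transfer (simp add: weyl_eq_def algebra_simps weyl_relations.zero)
  show "(a + b) * c = a * c + b * c"
    by transfer (simp add: weyl_eq_def algebra_simps weyl_relations.zero)
  show "a * (b + c) = a * b + a * c"
    by transfer (simp add: weyl_eq_def algebra_simps weyl_relations.zero)
  show "(0::'a weyl) \<noteq> 1"
    by transfer (use one_notin_weyl_relations weyl_relations_uminus[of "- 1"] in
      \<open>auto simp: weyl_eq_def\<close>)
qed

end

definition weyl_const :: "'c::comm_ring_1 \<Rightarrow> 'c weyl" where
  "weyl_const c = abs_weyl (Poly_Mapping.single 0 c)"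

definition weyl_letter :: "weyl_letter \<Rightarrow> 'c::comm_ring_1 weyl" where
  "weyl_letter l = abs_weyl (fgen l)"

lemma weyl_DX:
  "weyl_letter (LD i) * weyl_letter (LX j) =
     weyl_letter (LX j) * weyl_letter (LD i) + (if i = j then 1 else 0)"
  using weyl_relations.DX[of i j]
  by (cases "i = j") (simp_all add: weyl_letter_def times_weyl.abs_eq plus_weyl.abs_eq one_weyl.abs_eq weyl.abs_eq_iff
      weyl_eq_def algebra_simps)

text \<open>\<open>weyl_over n K\<close> is \<open>A_n(K) = K\<langle>x_0, \<dots>, x_{n-1}, \<partial>_0, \<dots>, \<partial>_{n-1}\<rangle>\<close> for a subring \<open>K\<close> of the
  coefficient ring. The central variables are put into the coefficients: \<open>A_n(k)[s]\<close> is
  \<open>A_n(k[s])\<close> and \<open>A_n(k)[a][s]\<close> is \<open>A_n(k[a][s])\<close>.\<close>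

inductive_set weyl_over :: "nat \<Rightarrow> 'c::comm_ring_1 set \<Rightarrow> 'c weyl set" for n K where
  const: "c \<in> K \<Longrightarrow> weyl_const c \<in> weyl_over n K"
| X: "i < n \<Longrightarrow> weyl_letter (LX i) \<in> weyl_over n K"
| D: "i < n \<Longrightarrow> weyl_letter (LD i) \<in> weyl_over n K"
| add: "P \<in> weyl_over n K \<Longrightarrow> Q \<in> weyl_over n K \<Longrightarrow> P + Q \<in> weyl_over n K"
| mult: "P \<in> weyl_over n K \<Longrightarrow> Q \<in> weyl_over n K \<Longrightarrow> P * Q \<in> weyl_over n K"

inductive_set left_ideal :: "'r::ring_1 set \<Rightarrow> 'r set \<Rightarrow> 'r set" for W G where
  zero: "0 \<in> left_ideal W G"
| step: "P \<in> left_ideal W G \<Longrightarrow> r \<in> W \<Longrightarrow> g \<in> G \<Longrightarrow> r * g + P \<in> left_ideal W G"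

text \<open>Change of coefficients along a ring homomorphism.\<close>

definition free_weyl_map :: "('c \<Rightarrow> 'd) \<Rightarrow> 'c::comm_ring_1 free_weyl \<Rightarrow> 'd::comm_ring_1 free_weyl" where
  "free_weyl_map h = lin_ext (\<lambda>w a. Poly_Mapping.single w (h a))"

locale coeff_hom =
  fixes h :: "'c::comm_ring_1 \<Rightarrow> 'd::comm_ring_1"
  assumes h_0 [simp]: "h 0 = 0" and h_1 [simp]: "h 1 = 1"
    and h_add: "h (a + b) = h a + h b" and h_mult: "h (a * b) = h a * h b"
begin

lemma map_add: "free_weyl_map h (p + q) = free_weyl_map h p + free_weyl_map h q"
  unfolding free_weyl_map_def by (rule lin_ext_add) (simp_all add: h_add single_add)

lemma map_mult: "free_weyl_map h (p * q) = free_weyl_map h p * free_weyl_map h q"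
  unfolding free_weyl_map_def
  by (rule lin_ext_mult) (simp_all add: h_add h_mult single_add mult_single)

lemma map_0 [simp]: "free_weyl_map h 0 = 0"
  by (simp add: free_weyl_map_def)

lemma map_single: "free_weyl_map h (Poly_Mapping.single w a) = Poly_Mapping.single w (h a)"
  by (simp add: free_weyl_map_def)

lemma map_1 [simp]: "free_weyl_map h 1 = 1"
  using map_single[of 0 1] by simp

lemma map_diff: "free_weyl_map h (p - q) = free_weyl_map h p - free_weyl_map h q"
  using map_add[of "p - q" q] by (simp add: algebra_simps)

lemma map_relations: "p \<in> weyl_relations \<Longrightarrow> free_weyl_map h p \<in> weyl_relations"
proof (induction rule: weyl_relations.induct)
  case (XX i j)
  show ?case by (simp only: map_diff map_mult map_single h_1) (rule weyl_relations.XX)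
next
  case (DD i j)
  show ?case by (simp only: map_diff map_mult map_single h_1) (rule weyl_relations.DD)
next
  case (DX i j)
  have "free_weyl_map h (if i = j then 1 else 0) = (if i = j then 1 else 0)" by simp
  then show ?case by (simp only: map_diff map_mult map_single h_1) (rule weyl_relations.DX)
qed (simp_all add: map_add map_mult weyl_relations.intros)

end

lemma map_poly_hom_aux:
  fixes h :: "'c::comm_ring_1 \<Rightarrow> 'd::comm_ring_1"
  assumes "coeff_hom h"
  shows "coeff_hom (map_poly h)"
proof -
  interpret coeff_hom h by (rule assms)
  have h_sum: "h (sum g A) = (\<Sum>x\<in>A. h (g x))" for g :: "nat \<Rightarrow> 'c" and A
    by (induction A rule: infinite_finite_induct) (simp_all add: h_add)
  show ?thesis
    by standard
      (auto intro!: poly_eqI simp: coeff_map_poly h_add coeff_mult h_sum h_mult map_poly_1)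
qed

lemma coeff_hom_mpoly_eval: "coeff_hom (mpoly_eval c)" for c :: "'v \<Rightarrow> 'k::comm_ring_1"
  by standard (simp_all add: mpoly_eval_add mpoly_eval_mult)

lemma coeff_hom_Const: "coeff_hom (Const :: 'k::comm_ring_1 \<Rightarrow> ('v, 'k) mpoly)"
  by standard (simp_all add: single_add mult_single)

text \<open>Substitution of \<open>c v\<close> for every variable \<open>v\<close> in the coefficients.\<close>

lift_definition specialize ::
    "('v \<Rightarrow> 'k) \<Rightarrow> ('v, 'k) mpoly poly weyl \<Rightarrow> 'k::comm_ring_1 poly weyl"
  is "\<lambda>c. free_weyl_map (map_poly (mpoly_eval c))"
proof -
  fix c :: "'v \<Rightarrow> 'k" and p q :: "('v, 'k) mpoly poly free_weyl"
  interpret coeff_hom "map_poly (mpoly_eval c)"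
    by (intro map_poly_hom_aux coeff_hom_mpoly_eval)
  assume "weyl_eq p q"
  then show "weyl_eq (free_weyl_map (map_poly (mpoly_eval c)) p)
      (free_weyl_map (map_poly (mpoly_eval c)) q)"
    using map_relations[of "p - q"] by (simp add: weyl_eq_def map_diff)
qed


section \<open>The annihilator of \<open>f^s\<close>\<close>

text \<open>\<open>R_n(k)[s] = k[x_0, \<dots>, x_{n-1}][s]\<close> is rendered by \<open>(nat, 'k) mpoly poly\<close>. The module
  \<open>R_n(k)[1/f, s] f^s\<close> is a submodule of the rank one module \<open>Frac(R_n(k)[s]) f^s\<close>; below an element \<open>h\<close> of
  the fraction field stands for \<open>h f^s\<close>, so \<open>\<partial>_i\<close> acts by
  \<open>h \<mapsto> \<partial>_i h + s (\<partial>_i f / f) h\<close>.\<close>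

abbreviation coeff_deriv :: "nat \<Rightarrow> (nat, 'k) mpoly poly \<Rightarrow> (nat, 'k::idom) mpoly poly" where
  "coeff_deriv i \<equiv> map_poly (mpoly_deriv i)"

lemma coeff_deriv_add: "coeff_deriv i (p + q) = coeff_deriv i p + coeff_deriv i q"
  by (rule poly_eqI) (simp add: coeff_map_poly mpoly_deriv_add)

lemma coeff_deriv_mult: "coeff_deriv i (p * q) = coeff_deriv i p * q + p * coeff_deriv i q"
  by (rule poly_eqI)
    (simp add: coeff_map_poly coeff_mult mpoly_deriv_sum mpoly_deriv_mult sum.distrib)

lemma coeff_deriv_commute: "coeff_deriv i (coeff_deriv j p) = coeff_deriv j (coeff_deriv i p)"
  by (rule poly_eqI) (simp add: coeff_map_poly mpoly_deriv_commute[of i j])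

lemma fract_deriv_aux:
  fixes p q p' q' a b a' b' :: "'r::comm_ring_1"
  assumes e: "p * q' = p' * q" and d: "a * q' + p * b' = a' * q + p' * b"
  shows "(a * q - p * b) * (q' * q') = (a' * q' - p' * b') * (q * q)"
proof -
  have "(a * q - p * b) * (q' * q') - (a' * q' - p' * b') * (q * q) =
      (a * q' + p * b' - (a' * q + p' * b)) * (q * q') - (b * q' + b' * q) * (p * q' - p' * q)"
    by (simp add: algebra_simps)
  then show ?thesis using e d by simp
qed

lift_definition fract_deriv :: "nat \<Rightarrow> (nat, 'k::idom) mpoly poly fract \<Rightarrow> (nat, 'k) mpoly poly fract"
  is "\<lambda>i (p, q). (coeff_deriv i p * q - p * coeff_deriv i q, q * q)"
proof (clarsimp, goal_cases)
  case (1 i p q p' q')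
  have "coeff_deriv i (p * q') = coeff_deriv i (p' * q)" using 1 by simp
  then have d: "coeff_deriv i p * q' + p * coeff_deriv i q' =
      coeff_deriv i p' * q + p' * coeff_deriv i q"
    by (simp add: coeff_deriv_mult)
  from fract_deriv_aux[OF 1(3) d] show ?case .
qed

lemma fract_deriv_Fract:
  "q \<noteq> 0 \<Longrightarrow> fract_deriv i (Fract p q) =
     Fract (coeff_deriv i p * q - p * coeff_deriv i q) (q * q)"
  by transfer simp

lemma fract_deriv_add: "fract_deriv i (g + h) = fract_deriv i g + fract_deriv i h"
  by (cases g; cases h)
    (simp add: fract_deriv_Fract eq_fract coeff_deriv_add coeff_deriv_mult algebra_simps)

lemma fract_deriv_mult: "fract_deriv i (g * h) = fract_deriv i g * h + g * fract_deriv i h"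
  by (cases g; cases h)
    (simp add: fract_deriv_Fract eq_fract coeff_deriv_add coeff_deriv_mult algebra_simps)


lemma coeff_deriv_1: "coeff_deriv i (1 :: (nat, 'k::idom) mpoly poly) = 0"
  by (rule poly_eqI) (simp add: coeff_map_poly flip: single_one)

lemma fract_deriv_commute: "fract_deriv i (fract_deriv j h) = fract_deriv j (fract_deriv i h)"
proof (cases h)
  case (Fract p q)
  have diff: "coeff_deriv i (p - q) = coeff_deriv i p - coeff_deriv i q" for i p q
    using coeff_deriv_add[of i "p - q" q] by simp
  from Fract show ?thesis
    by (simp add: fract_deriv_Fract eq_fract diff coeff_deriv_add coeff_deriv_mult
        coeff_deriv_commute[of j i] algebra_simps)
qed

abbreviation to_fract :: "'a::idom \<Rightarrow> 'a fract" where
  "to_fract a \<equiv> Fract a 1"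

lemma to_fract_add: "to_fract (a + b) = to_fract a + to_fract b"
  by simp

lemma to_fract_mult: "to_fract (a * b) = to_fract a * to_fract b"
  by simp

definition fs_scale :: "'k::idom poly \<Rightarrow> (nat, 'k) mpoly poly fract \<Rightarrow> (nat, 'k) mpoly poly fract" where
  "fs_scale c h = to_fract (map_poly Const c) * h"

definition fs_letter :: "(nat, 'k::idom) mpoly \<Rightarrow> weyl_letter \<Rightarrow>
    (nat, 'k) mpoly poly fract \<Rightarrow> (nat, 'k) mpoly poly fract" where
  "fs_letter f l h = (case l of
       LX i \<Rightarrow> to_fract [:Var i:] * h
     | LD i \<Rightarrow> fract_deriv i h + to_fract [:0, 1:] * Fract [:mpoly_deriv i f:] [:f:] * h)"

lemma weyl_representation_fs: "weyl_representation fs_scale (fs_letter f)"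
proof -
  interpret coeff_hom "map_poly (Const :: 'a \<Rightarrow> (nat, 'a) mpoly)"
    by (intro map_poly_hom_aux coeff_hom_Const)
  have deriv_const: "fract_deriv i (to_fract (map_poly Const c)) = 0" for i and c :: "'a poly"
  proof -
    have "coeff_deriv i (map_poly Const c) = 0"
      by (rule poly_eqI) (simp add: coeff_map_poly)
    then show ?thesis by (simp add: fract_deriv_Fract coeff_deriv_1 Zero_fract_def)
  qed
  have deriv_s: "fract_deriv i (to_fract [:0, 1 :: (nat, 'a) mpoly:]) = 0" for i
  proof -
    have "coeff_deriv i [:0, 1 :: (nat, 'a) mpoly:] = 0"
      by (rule poly_eqI) (simp add: coeff_map_poly coeff_pCons split: nat.split flip: single_one)
    then show ?thesis by (simp add: fract_deriv_Fract coeff_deriv_1 Zero_fract_def)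
  qed
  have deriv_Var: "fract_deriv i (to_fract [:Var j :: (nat, 'a) mpoly:]) = (if i = j then 1 else 0)" for i j
    by (auto simp: fract_deriv_Fract coeff_deriv_1 Zero_fract_def One_fract_def map_poly_pCons
        mpoly_deriv_Var one_pCons)
  have deriv_log: "fract_deriv i (Fract [:mpoly_deriv j f:] [:f:]) =
      fract_deriv j (Fract [:mpoly_deriv i f:] [:f:])" for i j
    by (cases "f = 0")
      (simp_all add: fract_deriv_Fract eq_fract map_poly_pCons mpoly_deriv_commute[of i j] algebra_simps)
  show ?thesis
  proof
    fix g h :: "(nat, 'a) mpoly poly fract" and a b :: "'a poly" and i j :: nat and l :: weyl_letter
    show "fs_scale a (g + h) = fs_scale a g + fs_scale a h"
      by (simp add: fs_scale_def distrib_left)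
    show "fs_scale (a + b) h = fs_scale a h + fs_scale b h"
      by (simp only: fs_scale_def h_add to_fract_add distrib_right)
    show "fs_scale a (fs_scale b h) = fs_scale (a * b) h"
      by (simp add: fs_scale_def h_mult to_fract_mult mult_ac del: mult_fract add_fract)
    show "fs_scale 1 h = h"
      using h_1 by (simp add: fs_scale_def flip: One_fract_def)
    show "fs_letter f l (g + h) = fs_letter f l g + fs_letter f l h"
      by (simp add: fs_letter_def fract_deriv_add algebra_simps del: mult_fract add_fract split: weyl_letter.split)
    show "fs_letter f l (fs_scale a h) = fs_scale a (fs_letter f l h)"
      by (simp add: fs_letter_def fs_scale_def fract_deriv_mult deriv_const algebra_simps del: mult_fract add_fract
          split: weyl_letter.split)
    show "fs_letter f (LX i) (fs_letter f (LX j) h) = fs_letter f (LX j) (fs_letter f (LX i) h)"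
      by (simp add: fs_letter_def mult_ac del: mult_fract add_fract)
    show "fs_letter f (LD i) (fs_letter f (LX j) h) =
        fs_letter f (LX j) (fs_letter f (LD i) h) + (if i = j then h else 0)"
      using deriv_Var[of i j]
      by (simp add: fs_letter_def fract_deriv_mult algebra_simps del: mult_fract add_fract)
    show "fs_letter f (LD i) (fs_letter f (LD j) h) = fs_letter f (LD j) (fs_letter f (LD i) h)"
      using deriv_log[of i j] fract_deriv_commute[of i j h]
      by (simp add: fs_letter_def fract_deriv_add fract_deriv_mult deriv_s algebra_simps del: mult_fract add_fract)
  qed
qed

text \<open>By \<open>fs_act_abs\<close> the choice of the representative does not matter.\<close>

definition fs_act :: "(nat, 'k::idom) mpoly \<Rightarrow> 'k poly weyl \<Rightarrow>
    (nat, 'k) mpoly poly fract \<Rightarrow> (nat, 'k) mpoly poly fract" where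
  "fs_act f P = free_act fs_scale (fs_letter f) (rep_weyl P)"

lemma fs_act_abs: "fs_act f (abs_weyl p) h = free_act fs_scale (fs_letter f) p h"
  unfolding fs_act_def
  by (rule weyl_representation.rho_weyl_eq[OF weyl_representation_fs])
    (rule Quotient3_rep_abs[OF Quotient3_weyl], simp add: equivp_reflp[OF equivp_weyl_eq])

lemma fs_act_0: "fs_act f 0 h = 0"
  unfolding zero_weyl.abs_eq fs_act_abs
  by (rule weyl_representation.rho_0[OF weyl_representation_fs])

lemma fs_act_1: "fs_act f 1 h = h"
  unfolding one_weyl.abs_eq fs_act_abs
  by (rule weyl_representation.rho_1[OF weyl_representation_fs])

lemma fs_act_add: "fs_act f (P + Q) h = fs_act f P h + fs_act f Q h"
  by (induction P rule: weyl.abs_induct; induction Q rule: weyl.abs_induct)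
    (simp only: plus_weyl.abs_eq fs_act_abs
      weyl_representation.rho_add[OF weyl_representation_fs])

lemma fs_act_mult: "fs_act f (P * Q) h = fs_act f P (fs_act f Q h)"
  by (induction P rule: weyl.abs_induct; induction Q rule: weyl.abs_induct)
    (simp only: times_weyl.abs_eq fs_act_abs
      weyl_representation.rho_mult[OF weyl_representation_fs])

lemma fs_act_letter: "fs_act f (weyl_letter l) h = fs_letter f l h"
  unfolding weyl_letter_def fs_act_abs
  by (rule weyl_representation.rho_fgen[OF weyl_representation_fs])

lemma fs_act_const: "fs_act f (weyl_const c) h = fs_scale c h"
  unfolding weyl_const_def fs_act_abs
  by (simp add: weyl_representation.rho_single[OF weyl_representation_fs] zero_free_monoid_def)

definition Ann_fs :: "nat \<Rightarrow> (nat, 'k::idom) mpoly \<Rightarrow> 'k poly weyl set" where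
  "Ann_fs n f = {P \<in> weyl_over n UNIV. fs_act f P 1 = 0}"


section \<open>The projective space of polynomials of bounded degree\<close>

text \<open>The indeterminates \<open>a_\<alpha>\<close> are the elements of \<open>exponents n d\<close>.\<close>

definition exponents :: "nat \<Rightarrow> nat \<Rightarrow> (nat \<Rightarrow>\<^sub>0 nat) set" where
  "exponents n d = {\<alpha>. keys \<alpha> \<subseteq> {..<n} \<and> mdeg \<alpha> \<le> d}"

definition mpoly_ring :: "'v set \<Rightarrow> ('v, 'k::comm_ring_1) mpoly ring" where
  "mpoly_ring A = \<lparr>carrier = mpoly_over A, mult = (*), one = 1, zero = 0, add = (+)\<rparr>"

lemma cring_mpoly_ring: "cring (mpoly_ring A)"
proof (rule cringI)
  have keys: "keys (m + n) \<subseteq> A" if "keys m \<subseteq> A" "keys n \<subseteq> A" for m n :: "'a \<Rightarrow>\<^sub>0 nat"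
    using that Poly_Mapping.keys_add[of m n] by blast
  have add: "p + q \<in> mpoly_over A" if "p \<in> mpoly_over A" "q \<in> mpoly_over A" for p q :: "('a, 'b) mpoly"
    using that Poly_Mapping.keys_add[of p q] unfolding mpoly_over_def by blast
  have mult: "p * q \<in> mpoly_over A" if "p \<in> mpoly_over A" "q \<in> mpoly_over A" for p q :: "('a, 'b) mpoly"
    unfolding mpoly_over_def
  proof (intro CollectI ballI)
    fix m assume "m \<in> keys (p * q)"
    then obtain a b where "m = a + b" "a \<in> keys p" "b \<in> keys q"
      using keys_mult[of p q] by blast
    then show "keys m \<subseteq> A"
      using that keys[of a b] by (simp add: mpoly_over_def)
  qed
  have neg: "- p \<in> mpoly_over A" if "p \<in> mpoly_over A" for p :: "('a, 'b) mpoly"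
    using that by (simp add: mpoly_over_def)
  have one: "1 \<in> mpoly_over A" by (simp add: mpoly_over_def flip: single_one)
  have zero: "0 \<in> mpoly_over A" by (simp add: mpoly_over_def)
  show "abelian_group (mpoly_ring A :: ('a, 'b) mpoly ring)"
    by (intro abelian_groupI)
      (auto simp: mpoly_ring_def add zero add_ac intro!: bexI[of _ "- x" for x] neg)
  show "comm_monoid (mpoly_ring A :: ('a, 'b) mpoly ring)"
    by (intro comm_monoidI) (auto simp: mpoly_ring_def mult one mult_ac)
qed (simp add: mpoly_ring_def ring_distribs)

definition homogeneous :: "('v, 'k::zero) mpoly \<Rightarrow> bool" where
  "homogeneous p \<longleftrightarrow> (\<exists>e. \<forall>m\<in>keys p. mdeg m = e)"

definition hom_component :: "nat \<Rightarrow> ('v, 'k::comm_monoid_add) mpoly \<Rightarrow> ('v, 'k) mpoly" where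
  "hom_component e = lin_ext (\<lambda>m a. if mdeg m = e then Poly_Mapping.single m a else 0)"

text \<open>\<open>Proj k[a]\<close>: the homogeneous prime ideals that do not contain the irrelevant ideal.\<close>

definition Proj_space :: "nat \<Rightarrow> nat \<Rightarrow> (nat \<Rightarrow>\<^sub>0 nat, 'k::comm_ring_1) mpoly set set" where
  "Proj_space n d = {\<pp>. primeideal \<pp> (mpoly_ring (exponents n d)) \<and>
     (\<forall>p\<in>\<pp>. \<forall>e. hom_component e p \<in> \<pp>) \<and> \<not> Var ` exponents n d \<subseteq> \<pp>}"

definition Proj_closed :: "nat \<Rightarrow> nat \<Rightarrow> (nat \<Rightarrow>\<^sub>0 nat, 'k::comm_ring_1) mpoly set \<Rightarrow>
    (nat \<Rightarrow>\<^sub>0 nat, 'k) mpoly set set" where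
  "Proj_closed n d E = {\<pp> \<in> Proj_space n d. E \<subseteq> \<pp>}"

text \<open>The rational point with homogeneous coordinates \<open>c\<close> is the ideal generated by the homogeneous
  polynomials vanishing at \<open>c\<close>.\<close>

definition rational_point :: "nat \<Rightarrow> nat \<Rightarrow> ((nat \<Rightarrow>\<^sub>0 nat) \<Rightarrow> 'k) \<Rightarrow>
    (nat \<Rightarrow>\<^sub>0 nat, 'k::comm_ring_1) mpoly set" where
  "rational_point n d c = {p \<in> mpoly_over (exponents n d). \<forall>e. mpoly_eval c (hom_component e p) = 0}"

lemma mdeg_add: "mdeg (m + n) = mdeg m + mdeg n"
proof -
  let ?A = "keys m \<union> keys n"
  have sup: "mdeg l = (\<Sum>v\<in>?A. lookup l v)" if "keys l \<subseteq> ?A" for l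
    unfolding mdeg_def using that by (intro sum.mono_neutral_left) (auto simp: in_keys_iff)
  show ?thesis
    using Poly_Mapping.keys_add[of m n] by (simp add: sup lookup_add sum.distrib)
qed

text \<open>The substitution of \<open>c v * t\<close> for \<open>v\<close> is a ring homomorphism to \<open>k[t]\<close> with kernel the point \<open>c\<close>.\<close>

definition line_eval :: "('v \<Rightarrow> 'k) \<Rightarrow> ('v, 'k::comm_ring_1) mpoly \<Rightarrow> 'k poly" where
  "line_eval c = lin_ext (\<lambda>m a. monom (a * monom_eval c m) (mdeg m))"

lemma line_eval_add: "line_eval c (p + q) = line_eval c p + line_eval c q"
  unfolding line_eval_def
  by (rule lin_ext_add) (simp_all add: distrib_right add_monom)

lemma line_eval_mult: "line_eval c (p * q) = line_eval c p * line_eval c q"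
  unfolding line_eval_def
  by (rule lin_ext_mult) (simp_all add: algebra_simps add_monom mult_monom mdeg_add monom_eval_add)

lemma line_eval_0 [simp]: "line_eval c 0 = 0"
  by (simp add: line_eval_def)

lemma hom_component_0 [simp]: "hom_component e 0 = 0"
  by (simp add: hom_component_def)

lemma hom_component_single:
  "hom_component e (Poly_Mapping.single m a) = (if mdeg m = e then Poly_Mapping.single m a else 0)"
  by (simp add: hom_component_def)

lemma hom_component_add: "hom_component e (p + q) = hom_component e p + hom_component e q"
  unfolding hom_component_def by (rule lin_ext_add) (simp_all add: single_add)

lemma coeff_line_eval: "coeff (line_eval c p) e = mpoly_eval c (hom_component e p)"
proof (induction p rule: poly_mapping_add_induct)
  case (single m a)
  then show ?case by (simp add: line_eval_def hom_component_single mpoly_eval_def)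
qed (simp_all add: line_eval_add hom_component_add mpoly_eval_add)

lemma line_eval_eq_0_iff: "line_eval c p = 0 \<longleftrightarrow> (\<forall>e. mpoly_eval c (hom_component e p) = 0)"
  by (simp add: poly_eq_iff coeff_line_eval)

lemma line_eval_1: "line_eval c 1 = 1"
proof -
  have "line_eval c (Poly_Mapping.single 0 1) = 1"
    unfolding line_eval_def by (simp add: mdeg_def monom_eval_def del: single_one)
  then show ?thesis by simp
qed

lemma hom_component_idem: "hom_component e (hom_component e' p) = (if e = e' then hom_component e p else 0)"
  by (induction p rule: poly_mapping_add_induct) (auto simp: hom_component_single hom_component_add)

lemma lookup_hom_component: "lookup (hom_component e p) m = (if mdeg m = e then lookup p m else 0)"
  by (induction p rule: poly_mapping_add_induct)
    (auto simp: hom_component_single hom_component_add lookup_add lookup_single when_def)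

lemma rational_point_in_Proj_space:
  fixes c :: "(nat \<Rightarrow>\<^sub>0 nat) \<Rightarrow> 'k::idom"
  assumes "\<alpha> \<in> exponents n d" "c \<alpha> \<noteq> 0"
  shows "rational_point n d c \<in> Proj_space n d"
proof -
  let ?A = "exponents n d"
  let ?R = "mpoly_ring ?A :: (nat \<Rightarrow>\<^sub>0 nat, 'k) mpoly ring"
  interpret R: cring ?R by (rule cring_mpoly_ring)
  have pt: "rational_point n d c = {p \<in> carrier ?R. line_eval c p = 0}"
    by (simp add: rational_point_def line_eval_eq_0_iff mpoly_ring_def)
  have neg: "line_eval c (\<ominus>\<^bsub>?R\<^esub> p) = - line_eval c p" if "p \<in> carrier ?R" for p
  proof -
    have "line_eval c (p + \<ominus>\<^bsub>?R\<^esub> p) = 0"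
      using R.r_neg[OF that] by (simp add: mpoly_ring_def)
    then show ?thesis by (simp add: line_eval_add add_eq_0_iff)
  qed
  have ops: "x \<otimes>\<^bsub>?R\<^esub> y = x * y" "x \<oplus>\<^bsub>?R\<^esub> y = x + y" "\<one>\<^bsub>?R\<^esub> = 1" "\<zero>\<^bsub>?R\<^esub> = 0" for x y
    by (simp_all add: mpoly_ring_def)
  have "ideal (rational_point n d c) ?R"
  proof (rule idealI)
    show "subgroup (rational_point n d c) (add_monoid ?R)"
    proof (rule R.add.subgroupI)
      show "rational_point n d c \<noteq> {}"
        using R.zero_closed by (auto simp: pt ops)
    qed (use R.add.m_closed in \<open>auto simp: pt neg line_eval_add ops\<close>)
  qed (use R.m_closed in \<open>auto simp: pt line_eval_mult ops R.ring_axioms\<close>)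
  then have "primeideal (rational_point n d c) ?R"
  proof (rule primeidealI[OF _ R.cring_axioms])
    show "carrier ?R \<noteq> rational_point n d c"
    proof
      assume "carrier ?R = rational_point n d c"
      then have "1 \<in> rational_point n d c"
        using R.one_closed by (simp add: ops)
      then show False by (simp add: pt line_eval_1)
    qed
  qed (auto simp: pt line_eval_mult ops)
  moreover have "hom_component e p \<in> rational_point n d c" if "p \<in> rational_point n d c" for e p
  proof -
    have "keys (hom_component e p) \<subseteq> keys p"
      by (auto simp: in_keys_iff lookup_hom_component split: if_splits)
    with that show ?thesis
      by (auto simp: rational_point_def mpoly_over_def hom_component_idem)
  qed
  moreover have "Var \<alpha> \<notin> rational_point n d c"
  proof -
    have "mpoly_eval c (hom_component 1 (Var \<alpha>)) = c \<alpha>"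
      by (simp add: Var_def hom_component_single mdeg_def mpoly_eval_def monom_eval_def)
    with assms(2) have "\<exists>e. mpoly_eval c (hom_component e (Var \<alpha>)) \<noteq> 0" by metis
    then show ?thesis by (simp add: rational_point_def)
  qed
  ultimately show ?thesis using assms(1) by (auto simp: Proj_space_def)
qed

definition param_ring :: "nat \<Rightarrow> nat \<Rightarrow> (nat \<Rightarrow>\<^sub>0 nat, 'k::comm_ring_1) mpoly poly set" where
  "param_ring n d = {q. \<forall>j. coeff q j \<in> mpoly_over (exponents n d)}"

definition forms :: "nat \<Rightarrow> nat \<Rightarrow> (nat \<Rightarrow>\<^sub>0 nat, 'k::comm_ring_1) mpoly set" where
  "forms n d = {p \<in> mpoly_over (exponents n d). homogeneous p}"


section \<open>Reading the output of an algorithm\<close>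

text \<open>The output, a natural number, is read through the standard pairing and list bijections. An
  algorithm whose input is just \<open>n\<close> and \<open>d\<close> can only produce constants from the prime field of
  \<open>'k\<close>, so the coefficients are rational numbers. An operator is a list of pairs (coefficient,
  word in the \<open>x_i\<close> and \<open>\<partial>_i\<close>), a polynomial in the \<open>a_\<alpha>\<close> a list of pairs (coefficient, list of
  variables).\<close>

definition dec_list :: "(nat \<Rightarrow> 'a) \<Rightarrow> nat \<Rightarrow> 'a list" where
  "dec_list g c = map g (list_decode c)"

definition dec_pair :: "(nat \<Rightarrow> 'a) \<Rightarrow> (nat \<Rightarrow> 'b) \<Rightarrow> nat \<Rightarrow> 'a \<times> 'b" where
  "dec_pair g h c = map_prod g h (prod_decode c)"

definition dec_rat :: "nat \<Rightarrow> 'k::field_char_0" where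
  "dec_rat c = (case prod_decode c of (a, b) \<Rightarrow> of_int (int_decode a) / of_nat (Suc b))"

definition dec_exponent :: "nat \<Rightarrow> (nat \<Rightarrow>\<^sub>0 nat)" where
  "dec_exponent c = Poly_Mapping.nth (list_decode c)"

definition dec_mpoly :: "nat \<Rightarrow> (nat \<Rightarrow>\<^sub>0 nat, 'k::field_char_0) mpoly" where
  "dec_mpoly c = (\<Sum>(q, \<alpha>s) \<leftarrow> dec_list (dec_pair dec_rat (dec_list dec_exponent)) c.
     Const q * prod_list (map Var \<alpha>s))"

definition dec_coeff :: "nat \<Rightarrow> (nat \<Rightarrow>\<^sub>0 nat, 'k::field_char_0) mpoly poly" where
  "dec_coeff c = Poly (dec_list dec_mpoly c)"

definition dec_letter :: "nat \<Rightarrow> weyl_letter" where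
  "dec_letter c = (case sum_decode c of Inl i \<Rightarrow> LX i | Inr i \<Rightarrow> LD i)"

definition dec_weyl :: "nat \<Rightarrow> (nat \<Rightarrow>\<^sub>0 nat, 'k::field_char_0) mpoly poly weyl" where
  "dec_weyl c = (\<Sum>(q, w) \<leftarrow> dec_list (dec_pair dec_coeff (dec_list dec_letter)) c.
     weyl_const q * prod_list (map weyl_letter w))"

text \<open>A triple \<open>(G, E, H)\<close> presents the left ideal \<open>I\<close> of \<open>A_n(k)[a][s]\<close> generated by \<open>G\<close> and the
  locally closed set \<open>V = V_+(E) - V_+(H)\<close>.\<close>

type_synonym 'k presentation =
  "(nat \<Rightarrow>\<^sub>0 nat, 'k) mpoly poly weyl list \<times>
   (nat \<Rightarrow>\<^sub>0 nat, 'k) mpoly list \<times> (nat \<Rightarrow>\<^sub>0 nat, 'k) mpoly list"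

definition dec_output :: "nat \<Rightarrow> 'k::field_char_0 presentation list" where
  "dec_output =
     dec_list (dec_pair (dec_list dec_weyl) (dec_pair (dec_list dec_mpoly) (dec_list dec_mpoly)))"

definition presentation :: "nat \<Rightarrow> nat \<Rightarrow> 'k::field_char_0 presentation \<Rightarrow> bool" where
  "presentation n d = (\<lambda>(G, E, H).
     set G \<subseteq> weyl_over n (param_ring n d) \<and> set E \<subseteq> forms n d \<and> set H \<subseteq> forms n d)"

definition presented_ideal :: "nat \<Rightarrow> nat \<Rightarrow> 'k::field_char_0 presentation \<Rightarrow>
    (nat \<Rightarrow>\<^sub>0 nat, 'k) mpoly poly weyl set" where
  "presented_ideal n d = (\<lambda>(G, E, H). left_ideal (weyl_over n (param_ring n d)) (set G))"

definition presented_set :: "nat \<Rightarrow> nat \<Rightarrow> 'k::field_char_0 presentation \<Rightarrow>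
    (nat \<Rightarrow>\<^sub>0 nat, 'k) mpoly set set" where
  "presented_set n d = (\<lambda>(G, E, H). Proj_closed n d (set E) - Proj_closed n d (set H))"

end

theory Submission
  imports Defs "HOL-Library.List_Lexorder"
begin

text \<open>The algorithm is an elimination by Buchberger's method, carried out with indeterminate
  coefficients.

  Let \<open>t\<close> be the operator that sends \<open>g(s) f^s\<close> to \<open>- s g(s-1) f^(s-1)\<close>. It satisfies
  \<open>s t = t (s + 1)\<close>, and in the algebra \<open>A_n\<langle>s, t\<rangle>\<close> the elements \<open>s + f t\<close> and \<open>\<partial>_i + (\<partial>_i f) t\<close> annihilate \<open>f^s\<close>. They
  generate the whole annihilator: modulo their left ideal every operator is congruent to one of the
  form \<open>\<Sum> g_j t^j\<close> with \<open>g_j \<in> R_n\<close> (\<open>reduce_to_tmon\<close>), and \<open>t^j f^s\<close> is \<open>f^s / f^j\<close> times a polynomial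
  of degree \<open>j\<close> in \<open>s\<close>, so that no such operator but \<open>0\<close> kills \<open>f^s\<close> (\<open>phi_eq_0\<close>). Hence
  \<open>Ann(f^s)\<close> consists of the elements of this left ideal that are free of \<open>t\<close>
  (\<open>ann_span_iff_kernel\<close>, \<open>Ann_fs_wev\<close>). In a lexicographic order in which \<open>t\<close> comes first, a leading
  monomial without \<open>t\<close> forces the whole operator to be free of \<open>t\<close>. So the members without \<open>t\<close> of a
  Groebner basis generate \<open>Ann(f^s)\<close> (\<open>elimination\<close>).

  The generators depend linearly on the coefficients \<open>a_\<alpha>\<close> of \<open>f\<close>. The algorithm computes with
  polynomials in the \<open>a_\<alpha>\<close> as coefficients and never decides whether such a polynomial vanishes. When
  an operator does not reduce any more, the computation splits: on one branch its leading coefficient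
  is assumed to be zero and the leading terms are dropped, on the other it is assumed to be nonzero and
  the operator joins the basis (\<open>step\<close>). At a point that satisfies the assumptions of a branch the
  steps are those of Buchberger's algorithm with ordinary coefficients (\<open>correct_step\<close>). The
  computation stops by Dickson's lemma, even on branches with contradictory assumptions, because only
  the monomials matter for that (\<open>halts_state\<close>). The assumptions along a branch define a locally
  closed set, and since points of projective space are prime ideals, each of them follows some branch
  to its end (\<open>run_satisfies\<close>, \<open>presented_set_satisfies\<close>).

  The assumptions have to be homogeneous in the \<open>a_\<alpha>\<close>. They are, because with \<open>t\<close> of degree
  \<open>- 1\<close> and the \<open>a_\<alpha>\<close> of degree \<open>1\<close> the generators are homogeneous and all steps preserve
  this (\<open>graded\<close>).

  Computability is proved for functions between types of coded data; the rules follow the structure of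
  terms. The main loop is the only unbounded search (\<open>algorithm_computable\<close>).\<close>

section \<open>Computable functions on coded data\<close>

definition total_rec :: "nat \<Rightarrow> (nat list \<Rightarrow> nat) \<Rightarrow> bool" where
  "total_rec k f \<longleftrightarrow> (\<exists>F. \<forall>xs. length xs = k \<longrightarrow> computes F xs (f xs))"

abbreviation "rf1 g \<equiv> total_rec 1 (\<lambda>xs. g (xs ! 0))"
abbreviation "rf2 g \<equiv> total_rec 2 (\<lambda>xs. g (xs ! 0) (xs ! 1))"
abbreviation "rf3 g \<equiv> total_rec 3 (\<lambda>xs. g (xs ! 0) (xs ! 1) (xs ! 2))"

lemma rf1I: "(\<And>x. computes F [x] (g x)) \<Longrightarrow> rf1 g"
  unfolding total_rec_def by (rule exI[of _ F]) (auto simp: length_Suc_conv)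

lemma rf1E: assumes "rf1 g" obtains F where "\<And>x. computes F [x] (g x)"
  using assms unfolding total_rec_def by (metis One_nat_def length_Cons list.size(3) nth_Cons_0)

lemma rf2E: assumes "rf2 g" obtains F where "\<And>x y. computes F [x, y] (g x y)"
proof -
  obtain F where F: "\<forall>xs. length xs = 2 \<longrightarrow> computes F xs (g (xs ! 0) (xs ! 1))"
    using assms unfolding total_rec_def by blast
  show thesis by (rule that[of F]) (use F[rule_format, of "[_, _]"] in simp)
qed

lemma rf3E: assumes "rf3 g" obtains F where "\<And>x y z. computes F [x, y, z] (g x y z)"
proof -
  obtain F where F: "\<forall>xs. length xs = 3 \<longrightarrow> computes F xs (g (xs ! 0) (xs ! 1) (xs ! 2))"
    using assms unfolding total_rec_def by blast
  show thesis by (rule that[of F]) (use F[rule_format, of "[_, _, _]"] in simp)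
qed

lemma total_rec_proj: "i < k \<Longrightarrow> total_rec k (\<lambda>xs. xs ! i)"
  unfolding total_rec_def by (rule exI[of _ "RProj i"]) (auto intro: computes.Proj)

lemma total_rec_comp1:
  assumes "rf1 g" "total_rec k f"
  shows "total_rec k (\<lambda>xs. g (f xs))"
proof -
  obtain G where G: "\<And>x. computes G [x] (g x)" using rf1E[OF assms(1)] by blast
  obtain F where "\<forall>xs. length xs = k \<longrightarrow> computes F xs (f xs)" using assms(2) total_rec_def by auto
  then show ?thesis
    unfolding total_rec_def using G
    by (intro exI[of _ "RComp G [F]"]) (auto intro!: computes.Comp[where ys = "[_]"])
qed

lemma total_rec_comp2:
  assumes "rf2 g" "total_rec k f" "total_rec k f'"
  shows "total_rec k (\<lambda>xs. g (f xs) (f' xs))"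
proof -
  obtain G where G: "\<And>x y. computes G [x, y] (g x y)" using rf2E[OF assms(1)] by blast
  obtain F F' where "\<forall>xs. length xs = k \<longrightarrow> computes F xs (f xs)" "\<forall>xs. length xs = k \<longrightarrow> computes F' xs (f' xs)"
    using assms(2,3) total_rec_def by auto
  then show ?thesis
    unfolding total_rec_def using G
    by (intro exI[of _ "RComp G [F, F']"]) (auto intro!: computes.Comp[where ys = "[_, _]"])
qed

lemma rf1_Suc: "rf1 Suc"
  by (rule rf1I) (rule computes.Succ)

lemma total_rec_Suc: "total_rec k f \<Longrightarrow> total_rec k (\<lambda>xs. Suc (f xs))"
  using total_rec_comp1[OF rf1_Suc] .

lemma total_rec_const: "total_rec k (\<lambda>xs. c)"
proof (induction c)
  case 0
  show ?case unfolding total_rec_def by (rule exI[of _ RZero]) (auto intro: computes.Zero)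
next
  case (Suc c)
  then show ?case by (rule total_rec_Suc)
qed

lemma rf2_prec:
  assumes "rf1 f" "rf3 g"
  shows "rf2 (\<lambda>m x. rec_nat (f x) (\<lambda>m y. g m y x) m)"
proof -
  obtain F where F: "\<And>x. computes F [x] (f x)" using rf1E[OF assms(1)] by blast
  obtain G where G: "\<And>x y z. computes G [x, y, z] (g x y z)" using rf3E[OF assms(2)] by blast
  have "computes (RPrec F G) [m, x] (rec_nat (f x) (\<lambda>m y. g m y x) m)" for m x
    by (induction m) (auto intro: computes.intros F G)
  then show ?thesis
    unfolding total_rec_def by (intro exI[of _ "RPrec F G"]) (auto simp: numeral_2_eq_2 length_Suc_conv)
qed

lemma total_rec_prec:
  assumes "rf1 f" "rf3 g" "total_rec k a" "total_rec k b"
  shows "total_rec k (\<lambda>xs. rec_nat (f (b xs)) (\<lambda>m y. g m y (b xs)) (a xs))"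
  using total_rec_comp2[OF rf2_prec[OF assms(1,2)] assms(3,4)] .

lemma total_rec_pred: "total_rec k a \<Longrightarrow> total_rec k (\<lambda>xs. a xs - 1)"
proof -
  assume a: "total_rec k a"
  have "rec_nat 0 (\<lambda>m y. m) n = n - 1" for n by (cases n) auto
  then show ?thesis
    \<comment> \<open>the recursion counter is the predecessor\<close>
    using total_rec_prec[of "\<lambda>_. 0" "\<lambda>m y x. m", OF total_rec_const total_rec_proj a a] by simp
qed

lemma total_rec_add: "total_rec k a \<Longrightarrow> total_rec k b \<Longrightarrow> total_rec k (\<lambda>xs. a xs + b xs)"
proof -
  assume a: "total_rec k a" "total_rec k b"
  have "rec_nat y (\<lambda>m y. Suc y) n = n + y" for n y by (induction n) auto
  then show ?thesis
    using total_rec_prec[of "\<lambda>x. x" "\<lambda>m y x. Suc y", OF total_rec_proj total_rec_Suc[OF total_rec_proj] a]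
    by simp
qed

lemma total_rec_minus: "total_rec k a \<Longrightarrow> total_rec k b \<Longrightarrow> total_rec k (\<lambda>xs. a xs - b xs)"
proof -
  assume a: "total_rec k a" "total_rec k b"
  have "rec_nat y (\<lambda>m y. y - 1) n = y - n" for n y by (induction n) auto
  then show ?thesis
    using total_rec_prec[of "\<lambda>x. x" "\<lambda>m y x. y - 1", OF total_rec_proj total_rec_pred[OF total_rec_proj] a(2,1)]
    by simp
qed

lemma total_rec_if0:
  assumes "total_rec k a" "total_rec k b" "total_rec k c"
  shows "total_rec k (\<lambda>xs. if a xs = 0 then b xs else c xs)"
proof -
  have "rf2 (\<lambda>n c. rec_nat 0 (\<lambda>m y. c) n)"
    by (rule rf2_prec[of "\<lambda>_. 0" "\<lambda>m y x. x"]) (auto intro: total_rec_proj total_rec_const)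
  note * = total_rec_comp2[OF this assms(1,3)]
  have "rf2 (\<lambda>n b. rec_nat b (\<lambda>m y. 0) n)"
    by (rule rf2_prec[of "\<lambda>x. x" "\<lambda>m y x. 0"]) (auto intro: total_rec_proj total_rec_const)
  note ** = total_rec_add[OF total_rec_comp2[OF this assms(1,2)] *]
  have "rec_nat b (\<lambda>m y. 0) n + rec_nat 0 (\<lambda>m y. c) n = (if n = 0 then b else c)" for b c n :: nat
    by (cases n) auto
  with ** show ?thesis by simp
qed

lemma total_rec_triangle: "total_rec k a \<Longrightarrow> total_rec k (\<lambda>xs. triangle (a xs))"
proof -
  assume a: "total_rec k a"
  have "rec_nat 0 (\<lambda>m y. y + Suc m) n = triangle n" for n by (induction n) auto
  then show ?thesis
    using total_rec_prec[of "\<lambda>x. 0" "\<lambda>m y x. y + Suc m", OF total_rec_const _ a a]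
      total_rec_add[OF total_rec_proj total_rec_Suc[OF total_rec_proj], of 1 3 0] by simp
qed

text \<open>The pairing function counts along antidiagonals. The antidiagonal of a code is found by counting up to
  the code, which makes unpairing primitive recursive.\<close>

definition triangle_root :: "nat \<Rightarrow> nat" where
  "triangle_root z = rec_nat 0 (\<lambda>m y. if triangle (Suc y) - Suc m = 0 then Suc y else y) z"

lemma triangle_root: "triangle (triangle_root z) \<le> z \<and> z < triangle (Suc (triangle_root z))"
  unfolding triangle_root_def by (induction z) auto

lemma triangle_mono: "m \<le> n \<Longrightarrow> triangle m \<le> triangle n"
  unfolding triangle_def by (intro div_le_mono mult_le_mono) auto

lemma triangle_root_prod_encode: "triangle_root (prod_encode (m, n)) = m + n"
proof -
  let ?r = "triangle_root (prod_encode (m, n))"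
  have *: "triangle ?r \<le> triangle (m + n) + m" "triangle (m + n) + m < triangle (Suc ?r)"
    using triangle_root[of "prod_encode (m, n)"] by (simp_all add: prod_encode_def)
  have "triangle (m + n) + m < triangle (Suc (m + n))" by simp
  with * triangle_mono[of "Suc (m + n)" ?r] triangle_mono[of "Suc ?r" "m + n"] show ?thesis
    by (metis add.commute leD le_add2 le_less_trans less_le_not_le nat_neq_iff not_less_eq_eq order.strict_trans1 trans_less_add1 Suc_leI)
qed

lemma total_rec_triangle_root: "total_rec k a \<Longrightarrow> total_rec k (\<lambda>xs. triangle_root (a xs))"
proof -
  assume a: "total_rec k a"
  show ?thesis
    unfolding triangle_root_def
    by (rule total_rec_prec[of "\<lambda>x. 0" "\<lambda>m y x. if triangle (Suc y) - Suc m = 0 then Suc y else y", OF _ _ a a])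
      (intro total_rec_const total_rec_if0 total_rec_minus total_rec_triangle total_rec_Suc total_rec_proj; simp)+
qed

lemma total_rec_prod_encode: "total_rec k a \<Longrightarrow> total_rec k b \<Longrightarrow> total_rec k (\<lambda>xs. prod_encode (a xs, b xs))"
  unfolding prod_encode_def by (simp add: total_rec_add total_rec_triangle)

lemma prod_decode_triangle:
  "fst (prod_decode z) = z - triangle (triangle_root z)"
  "snd (prod_decode z) = triangle_root z - fst (prod_decode z)"
proof -
  obtain m n where z: "z = prod_encode (m, n)" by (metis prod_decode_inverse surj_pair)
  show "fst (prod_decode z) = z - triangle (triangle_root z)"
    using triangle_root_prod_encode[of m n] unfolding z prod_encode_inverse
    by (simp add: prod_encode_def)
  show "snd (prod_decode z) = triangle_root z - fst (prod_decode z)"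
    using triangle_root_prod_encode[of m n] z by simp
qed

lemma total_rec_fst: "total_rec k a \<Longrightarrow> total_rec k (\<lambda>xs. fst (prod_decode (a xs)))"
  unfolding prod_decode_triangle by (intro total_rec_minus total_rec_triangle total_rec_triangle_root)

lemma total_rec_snd: "total_rec k a \<Longrightarrow> total_rec k (\<lambda>xs. snd (prod_decode (a xs)))"
  unfolding prod_decode_triangle(2) by (intro total_rec_minus total_rec_fst total_rec_triangle_root)

text \<open>The instances agree with the pairing and list bijections through which an output is read.\<close>

class coded =
  fixes enc :: "'a \<Rightarrow> nat"
  assumes enc_inj: "enc x = enc y \<Longrightarrow> x = y"

instantiation nat :: coded
begin
definition enc_nat :: "nat \<Rightarrow> nat" where [simp]: "enc_nat n = n"
instance by standard simp
end

text \<open>Truth is coded by \<open>0\<close> because the minimization of a recursive function looks for a zero.\<close>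

instantiation bool :: coded
begin
definition enc_bool :: "bool \<Rightarrow> nat" where [simp]: "enc_bool b = (if b then 0 else 1)"
instance by standard (simp split: if_splits)
end

instantiation prod :: (coded, coded) coded
begin
definition enc_prod :: "'a \<times> 'b \<Rightarrow> nat" where
  [simp]: "enc_prod p = prod_encode (enc (fst p), enc (snd p))"
instance by standard (auto simp: prod_eq_iff dest: enc_inj)
end

instantiation list :: (coded) coded
begin
definition enc_list :: "'a list \<Rightarrow> nat" where
  [simp]: "enc_list xs = list_encode (map enc xs)"
instance
proof
  have "inj (enc :: 'a \<Rightarrow> nat)" by (rule injI) (rule enc_inj)
  then show "enc x = enc y \<Longrightarrow> x = y" for x y :: "'a list"
    by (simp add: list_encode_eq)
qed
end

definition computable :: "('a::coded \<Rightarrow> 'b::coded) \<Rightarrow> bool" where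
  "computable f \<longleftrightarrow> (\<exists>F. \<forall>x. computes F [enc x] (enc (f x)))"

lemma computableI:
  assumes "rf1 g" "\<And>x. enc (f x) = g (enc x)"
  shows "computable f"
proof -
  obtain G where "\<And>x. computes G [x] (g x)" using rf1E[OF assms(1)] by blast
  then show ?thesis unfolding computable_def assms(2) by blast
qed

lemma computable_comp:
  assumes "computable g" "computable f"
  shows "computable (\<lambda>x. g (f x))"
proof -
  obtain F G where "\<And>x. computes F [enc x] (enc (f x))" "\<And>x. computes G [enc x] (enc (g x))"
    using assms unfolding computable_def by metis
  then show ?thesis
    unfolding computable_def
    by (intro exI[of _ "RComp G [F]"]) (auto intro!: computes.Comp[where ys = "[_]"])
qed

text \<open>The closure rules speak of compositions such as \<open>\<lambda>x. h (f x)\<close>, with a binder in the list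
  operations turned into a pair; introducing them repeatedly then follows the structure of a term.\<close>

named_theorems computable_intros

lemma computable_id [computable_intros]: "computable (\<lambda>x. x)"
  by (rule computableI[of "\<lambda>x. x"]) (auto intro: total_rec_proj)

lemma computable_const [computable_intros]: "computable (\<lambda>x. c)"
  by (rule computableI[of "\<lambda>x. enc c"]) (auto intro: total_rec_const)

lemma computable_fst [computable_intros]: "computable f \<Longrightarrow> computable (\<lambda>x. fst (f x))"
  by (rule computable_comp[of fst]) (auto intro!: computableI[of "\<lambda>x. fst (prod_decode x)"] total_rec_fst total_rec_proj)

lemma computable_snd [computable_intros]: "computable f \<Longrightarrow> computable (\<lambda>x. snd (f x))"
  by (rule computable_comp[of snd]) (auto intro!: computableI[of "\<lambda>x. snd (prod_decode x)"] total_rec_snd total_rec_proj)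

lemma computable_Suc [computable_intros]: "computable f \<Longrightarrow> computable (\<lambda>x. Suc (f x))"
  by (rule computable_comp[of Suc]) (auto intro!: computableI[of Suc] rf1_Suc)

lemma computable_Pair [computable_intros]:
  assumes "computable f" "computable g"
  shows "computable (\<lambda>x. (f x, g x))"
proof -
  have "rf2 (\<lambda>x y. prod_encode (x, y))" by (intro total_rec_prod_encode total_rec_proj) auto
  then obtain P where P: "\<And>x y. computes P [x, y] (prod_encode (x, y))"
    using rf2E[of "\<lambda>x y. prod_encode (x, y)"] by blast
  obtain F G where "\<And>x. computes F [enc x] (enc (f x))" "\<And>x. computes G [enc x] (enc (g x))"
    using assms unfolding computable_def by metis
  with P show ?thesis
    unfolding computable_def
    by (intro exI[of _ "RComp P [F, G]"]) (auto intro!: computes.Comp[where ys = "[_, _]"])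
qed

lemma computable_comp2: "computable (\<lambda>p. h (fst p) (snd p)) \<Longrightarrow> computable f \<Longrightarrow> computable g \<Longrightarrow> computable (\<lambda>x. h (f x) (g x))"
  using computable_comp[of "\<lambda>p. h (fst p) (snd p)" "\<lambda>x. (f x, g x)"] computable_Pair[of f g] by simp

lemma computable_comp3:
  "computable (\<lambda>p. h (fst p) (fst (snd p)) (snd (snd p))) \<Longrightarrow> computable f \<Longrightarrow> computable g \<Longrightarrow> computable k \<Longrightarrow>
    computable (\<lambda>x. h (f x) (g x) (k x))"
  using computable_comp[of "\<lambda>p. h (fst p) (fst (snd p)) (snd (snd p))" "\<lambda>x. (f x, g x, k x)"]
    computable_Pair[of f "\<lambda>x. (g x, k x)"] computable_Pair[of g k] by simp

lemma computable_nat2: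
  assumes "total_rec 2 (\<lambda>xs. h (xs ! 0) (xs ! 1))" "computable f" "computable g"
  shows "computable (\<lambda>x. h (f x) (g x) :: nat)"
proof (rule computable_comp2[OF _ assms(2,3)], rule computableI)
  show "rf1 (\<lambda>x. h (fst (prod_decode x)) (snd (prod_decode x)))"
    by (rule total_rec_comp2[OF assms(1)]) (intro total_rec_fst total_rec_snd total_rec_proj; simp)+
qed simp

lemma computable_add [computable_intros]: "computable f \<Longrightarrow> computable g \<Longrightarrow> computable (\<lambda>x. f x + g x :: nat)"
  by (rule computable_nat2[of "(+)"]) (intro total_rec_add total_rec_proj; simp)

lemma computable_minus [computable_intros]: "computable f \<Longrightarrow> computable g \<Longrightarrow> computable (\<lambda>x. f x - g x :: nat)"
  by (rule computable_nat2[of "(-)"]) (intro total_rec_minus total_rec_proj; simp)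

lemma computable_rec_nat:
  fixes g :: "'a::coded \<Rightarrow> nat \<Rightarrow> 'b::coded \<Rightarrow> 'b"
  assumes "computable f" "computable (\<lambda>p. g (fst p) (fst (snd p)) (snd (snd p)))" "computable k"
  shows "computable (\<lambda>x. rec_nat (f x) (g x) (k x))"
proof -
  obtain F where F: "\<And>x. computes F [enc x] (enc (f x))" using assms(1) unfolding computable_def by metis
  obtain G where G: "\<And>x m y. computes G [enc (x, m, y)] (enc (g x m y))"
    using assms(2) unfolding computable_def by fastforce
  obtain K where K: "\<And>x. computes K [enc x] (k x)" using assms(3) unfolding computable_def by auto
  have "rf3 (\<lambda>m y x. prod_encode (x, prod_encode (m, y)))"
    by (intro total_rec_prod_encode total_rec_proj) auto
  then obtain T where T: "\<And>m y x. computes T [m, y, x] (prod_encode (x, prod_encode (m, y)))"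
    using rf3E[of "\<lambda>m y x. prod_encode (x, prod_encode (m, y))"] by blast
  have G': "computes (RComp G [T]) [m, enc y, enc x] (enc (g x m y))" for m y x
    using T G by (auto intro!: computes.Comp[where ys = "[_]"])
  have "computes (RPrec F (RComp G [T])) [m, enc x] (enc (rec_nat (f x) (g x) m))" for m x
    by (induction m) (auto intro: F G' Prec_0 Prec_Suc)
  then have "computes (RComp (RPrec F (RComp G [T])) [K, RProj 0]) [enc x] (enc (rec_nat (f x) (g x) (k x)))" for x
    using K computes.Proj[of 0 "[enc x]"] by (auto intro!: computes.Comp[where ys = "[_, _]"])
  then show ?thesis unfolding computable_def by blast
qed

lemma computable_enc: "computable f \<Longrightarrow> computable (\<lambda>x. enc (f x))"
  unfolding computable_def by simp

lemma computable_if [computable_intros]: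
  assumes "computable b" "computable f" "computable g"
  shows "computable (\<lambda>x. if b x then f x else g x)"
proof -
  have "(\<lambda>x. if b x then f x else g x) = (\<lambda>x. rec_nat (f x) (\<lambda>_ _. g x) (enc (b x)))" by auto
  moreover have "computable \<dots>"
    by (rule computable_rec_nat) (intro assms computable_enc computable_comp[OF assms(3)] computable_fst computable_id)+
  ultimately show ?thesis by simp
qed

lemma computable_conj [computable_intros]: "computable b \<Longrightarrow> computable c \<Longrightarrow> computable (\<lambda>x. b x \<and> c x)"
proof -
  assume *: "computable b" "computable c"
  have "computable (\<lambda>x. if b x then c x else False)" by (intro computable_intros *)
  then show ?thesis by (simp add: if_bool_eq_conj conj_commute cong: conj_cong)
qed

lemma computable_not [computable_intros]: "computable b \<Longrightarrow> computable (\<lambda>x. \<not> b x)"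
proof -
  assume *: "computable b"
  have "computable (\<lambda>x. if b x then False else True)" by (intro computable_intros *)
  moreover have "(\<lambda>x. if b x then False else True) = (\<lambda>x. \<not> b x)" by auto
  ultimately show ?thesis by simp
qed

lemma computable_less [computable_intros]: "computable f \<Longrightarrow> computable g \<Longrightarrow> computable (\<lambda>x. (f x :: nat) < g x)"
proof -
  assume "computable f" "computable g"
  then have *: "computable (\<lambda>x. Suc (f x) - g x)" by (intro computable_intros)
  have "computable (\<lambda>n::nat. n = 0)"
    by (rule computableI[of "\<lambda>n. if n = 0 then 0 else 1"]) (auto intro: total_rec_if0 total_rec_proj total_rec_const)
  from computable_comp[OF this *] show ?thesis by (simp add: Suc_le_eq)
qed

lemma computable_eq [computable_intros]: "computable f \<Longrightarrow> computable g \<Longrightarrow> computable (\<lambda>x. f x = g x)"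
proof -
  assume "computable f" "computable g"
  then have "computable (\<lambda>x. \<not> enc (f x) < enc (g x) \<and> \<not> enc (g x) < enc (f x))"
    by (intro computable_intros computable_enc)
  moreover have "(\<not> enc (f x) < enc (g x) \<and> \<not> enc (g x) < enc (f x)) = (f x = g x)" for x
    using enc_inj[of "f x" "g x"] by auto
  ultimately show ?thesis by simp
qed

lemma computable_Cons [computable_intros]:
  assumes "computable f" "computable g"
  shows "computable (\<lambda>x. f x # g x)"
proof (rule computable_comp2[OF _ assms])
  show "computable (\<lambda>p::'b \<times> 'b list. fst p # snd p)"
    by (rule computableI[OF rf1_Suc]) simp
qed

lemma enc_tl: "enc (tl xs) = snd (prod_decode (enc xs - 1))"
proof (cases xs)
  case Nil
  have "prod_decode 0 = (0, 0)" by (simp add: prod_decode_def prod_decode_aux.simps)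
  with Nil show ?thesis by simp
qed simp

lemma computable_tl [computable_intros]: "computable f \<Longrightarrow> computable (\<lambda>x. tl (f x))"
  by (rule computable_comp[of tl], rule computableI[of "\<lambda>z. snd (prod_decode (z - 1))", OF _ enc_tl])
    (intro total_rec_snd total_rec_pred total_rec_proj; simp)

text \<open>The value of \<open>hd []\<close> is unspecified but fixed, hence a constant function.\<close>

lemma enc_hd: "enc (hd xs) = (if enc xs = 0 then enc (hd ([] :: 'a list)) else fst (prod_decode (enc xs - 1)))"
  for xs :: "'a::coded list"
  by (cases xs) simp_all

lemma computable_hd [computable_intros]: "computable f \<Longrightarrow> computable (\<lambda>x. hd (f x :: 'b::coded list))"
  by (rule computable_comp[of hd], rule computableI[of "\<lambda>z. if z = 0 then enc (hd ([] :: 'b list)) else fst (prod_decode (z - 1))", OF _ enc_hd])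
    (intro total_rec_if0 total_rec_const total_rec_fst total_rec_pred total_rec_proj; simp)

lemma length_le_enc: "length xs \<le> enc xs"
proof (induction xs)
  case (Cons x xs)
  have "enc xs \<le> prod_encode (enc x, enc xs)" by (rule le_prod_encode_2)
  with Cons show ?case by simp
qed simp

lemma computable_foldl:
  fixes g :: "'a::coded \<Rightarrow> 'b::coded \<Rightarrow> 'e::coded \<Rightarrow> 'b"
  assumes "computable (\<lambda>p. g (fst p) (fst (snd p)) (snd (snd p)))" "computable f" "computable l"
  shows "computable (\<lambda>x. foldl (g x) (f x) (l x))"
proof -
  define step where "step x p = (if fst p = [] then p else (tl (fst p), g x (snd p) (hd (fst p))))" for x p
  have step: "step x ([], b) = ([], b)" "step x (e # xs, b) = (xs, g x b e)" for x b e xs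
    by (simp_all add: step_def)
  have run: "length xs \<le> t \<Longrightarrow> rec_nat (xs, b) (\<lambda>_. step x) t = ([], foldl (g x) b xs)" for xs b x t
  proof -
    have "(step x ^^ t) (xs, b) = ([], foldl (g x) b xs)" if "length xs \<le> t"
      using that
    proof (induction t arbitrary: xs b)
      case (Suc t)
      have iter: "(step x ^^ Suc t) (xs, b) = (step x ^^ t) (step x (xs, b))"
        by (simp only: funpow_Suc_right comp_apply)
      with Suc show ?case
        unfolding iter by (cases xs) (auto simp: step simp del: funpow.simps)
    qed simp
    moreover have "rec_nat p (\<lambda>_. step x) t = (step x ^^ t) p" for p by (induction t) auto
    ultimately show "length xs \<le> t \<Longrightarrow> ?thesis" by simp
  qed
  \<comment> \<open>the code of a list is at least its length, and further steps change nothing\<close>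
  have "computable (\<lambda>x. snd (rec_nat (l x, f x) (\<lambda>_. step x) (enc (l x))))"
    unfolding step_def
    by (intro computable_intros computable_rec_nat assms computable_enc computable_comp3[OF assms(1)])
  then show ?thesis by (simp only: run[OF length_le_enc] snd_conv)
qed

lemma computable_rev [computable_intros]: "computable l \<Longrightarrow> computable (\<lambda>x. rev (l x))"
proof -
  assume l: "computable l"
  have "rev xs = foldl (\<lambda>b e. e # b) [] xs" for xs :: "'b list"
    by (induction xs rule: rev_induct) auto
  moreover have "computable (\<lambda>x. foldl (\<lambda>b e. e # b) [] (l x))"
    by (intro computable_foldl[where g = "\<lambda>x b e. e # b"] computable_intros l)
  ultimately show ?thesis by simp
qed

lemma computable_foldr:
  fixes g :: "'a::coded \<Rightarrow> 'e::coded \<Rightarrow> 'b::coded \<Rightarrow> 'b"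
  assumes "computable (\<lambda>p. g (fst p) (fst (snd p)) (snd (snd p)))" "computable f" "computable l"
  shows "computable (\<lambda>x. foldr (g x) (l x) (f x))"
proof -
  have "computable (\<lambda>x. foldl (\<lambda>b e. g x e b) (f x) (rev (l x)))"
    by (intro computable_foldl computable_intros assms computable_comp3[OF assms(1)])
  then show ?thesis by (simp add: foldr_conv_foldl)
qed

lemma computable_map [computable_intros]:
  assumes "computable (\<lambda>p. g (fst p) (snd p))" "computable l"
  shows "computable (\<lambda>x. map (g x) (l x))"
proof -
  have "map h xs = foldr (\<lambda>e b. h e # b) xs []" for h :: "'b \<Rightarrow> 'c" and xs by (induction xs) auto
  moreover have "computable (\<lambda>x. foldr (\<lambda>e b. g x e # b) (l x) [])"
    by (intro computable_foldr computable_intros assms computable_comp2[OF assms(1)])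
  ultimately show ?thesis by simp
qed

lemma computable_filter [computable_intros]:
  assumes "computable (\<lambda>p. g (fst p) (snd p))" "computable l"
  shows "computable (\<lambda>x. filter (g x) (l x))"
proof -
  have "filter h xs = foldr (\<lambda>e b. if h e then e # b else b) xs []" for h :: "'b \<Rightarrow> bool" and xs by (induction xs) auto
  moreover have "computable (\<lambda>x. foldr (\<lambda>e b. if g x e then e # b else b) (l x) [])"
    by (intro computable_foldr computable_intros assms computable_comp2[OF assms(1)])
  ultimately show ?thesis by simp
qed

lemma computable_append [computable_intros]: "computable f \<Longrightarrow> computable g \<Longrightarrow> computable (\<lambda>x. f x @ g x)"
proof -
  assume *: "computable f" "computable g"
  have "xs @ ys = foldr (#) xs ys" for xs ys :: "'b list" by (induction xs) auto
  moreover have "computable (\<lambda>x. foldr (#) (f x) (g x))"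
    by (intro computable_foldr[where g = "\<lambda>x. (#)"] computable_intros *)
  ultimately show ?thesis by simp
qed

lemma computable_concat [computable_intros]: "computable l \<Longrightarrow> computable (\<lambda>x. concat (l x))"
proof -
  assume *: "computable l"
  have "computable (\<lambda>x. foldr (@) (l x) [])"
    by (intro computable_foldr[where g = "\<lambda>x. (@)"] computable_intros *)
  then show ?thesis by (simp add: concat_conv_foldr)
qed

lemma computable_list_all [computable_intros]:
  assumes "computable (\<lambda>p. g (fst p) (snd p))" "computable l"
  shows "computable (\<lambda>x. list_all (g x) (l x))"
proof -
  have "list_all h xs = (filter (\<lambda>e. \<not> h e) xs = [])" for h :: "'b \<Rightarrow> bool" and xs by (induction xs) auto
  moreover have "computable (\<lambda>x. filter (\<lambda>e. \<not> g x e) (l x) = [])"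
    by (intro computable_intros assms)
  ultimately show ?thesis by simp
qed

lemma computable_length [computable_intros]: "computable l \<Longrightarrow> computable (\<lambda>x. length (l x))"
proof -
  assume *: "computable l"
  have "length xs = foldr (\<lambda>_. Suc) xs 0" for xs :: "'b list" by (induction xs) auto
  moreover have "computable (\<lambda>x. foldr (\<lambda>_. Suc) (l x) 0)"
    by (intro computable_foldr[where g = "\<lambda>x _. Suc"] computable_intros *)
  ultimately show ?thesis by simp
qed

lemma computable_sum_list [computable_intros]: "computable l \<Longrightarrow> computable (\<lambda>x. sum_list (l x) :: nat)"
proof -
  assume *: "computable l"
  have "sum_list xs = foldr (+) xs 0" for xs :: "nat list" by (induction xs) auto
  moreover have "computable (\<lambda>x. foldr (+) (l x) 0)"
    by (intro computable_foldr[where g = "\<lambda>x. (+)"] computable_intros *)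
  ultimately show ?thesis by simp
qed

lemma computable_upt [computable_intros]: "computable k \<Longrightarrow> computable (\<lambda>x. [0..<k x])"
proof -
  assume *: "computable k"
  have "[0..<n] = rec_nat [] (\<lambda>m y. y @ [m]) n" for n by (induction n) auto
  moreover have "computable (\<lambda>x. rec_nat [] (\<lambda>m y. y @ [m]) (k x))"
    by (intro computable_rec_nat computable_intros *)
  ultimately show ?thesis by simp
qed

lemma computable_replicate [computable_intros]: "computable k \<Longrightarrow> computable a \<Longrightarrow> computable (\<lambda>x. replicate (k x) (a x))"
proof -
  assume *: "computable k" "computable a"
  have "replicate n b = rec_nat [] (\<lambda>m y. b # y) n" for n and b :: 'b by (induction n) auto
  moreover have "computable (\<lambda>x. rec_nat [] (\<lambda>m y. a x # y) (k x))"
    by (intro computable_rec_nat computable_intros computable_comp[OF *(2)] *)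
  ultimately show ?thesis by simp
qed

text \<open>Outside of the list \<open>(!)\<close> is unspecified and could be any function of the index; a function that is
  to be computable on all codes needs a definite value there.\<close>

definition entry :: "nat list \<Rightarrow> nat \<Rightarrow> nat" where
  "entry m i = (if i < length m then m ! i else 0)"

lemma entry_nth [simp]: "i < length m \<Longrightarrow> entry m i = m ! i"
  by (simp add: entry_def)

lemma computable_entry [computable_intros]: "computable f \<Longrightarrow> computable k \<Longrightarrow> computable (\<lambda>x. entry (f x) (k x))"
proof -
  assume *: "computable f" "computable k"
  have "rec_nat m (\<lambda>_. tl) i = drop i m" for m :: "nat list" and i
    by (induction i) (auto simp: drop_Suc tl_drop)
  then have "entry m i = (if i < length m then hd (rec_nat m (\<lambda>_. tl) i) else 0)" for m i
    by (simp add: entry_def hd_drop_conv_nth)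
  moreover have "computable (\<lambda>x. if k x < length (f x) then hd (rec_nat (f x) (\<lambda>_. tl) (k x)) else 0)"
    by (intro computable_intros computable_rec_nat *)
  ultimately show ?thesis by simp
qed

text \<open>The only use of minimization. Termination is required for the values of \<open>s\<close> only: the main loop of
  the algorithm need not end on arbitrary codes.\<close>

lemma computable_iterate:
  fixes h :: "'a::coded \<Rightarrow> 'a" and s :: "'b::coded \<Rightarrow> 'a"
  assumes "computable h" "computable P" "computable s" and total: "\<And>x. \<exists>t. P ((h ^^ t) (s x))"
  shows "computable (\<lambda>x. (h ^^ (LEAST t. P ((h ^^ t) (s x)))) (s x))"
proof -
  have run: "rec_nat x (\<lambda>_. h) t = (h ^^ t) x" for x :: 'a and t by (induction t) auto
  have "computable (\<lambda>p. rec_nat (s (snd p)) (\<lambda>_. h) (fst p))"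
    by (intro computable_rec_nat computable_intros computable_comp[OF assms(1)] computable_comp[OF assms(3)])
  then have it: "computable (\<lambda>p. (h ^^ fst p) (s (snd p)))" by (simp add: run)
  obtain Q where Q: "\<And>t x. computes Q [enc (t, x)] (enc (P ((h ^^ t) (s x))))"
    using computable_comp[OF assms(2) it] unfolding computable_def by fastforce
  have "rf2 (\<lambda>x y. prod_encode (x, y))" by (intro total_rec_prod_encode total_rec_proj) auto
  then obtain T where T: "\<And>x y. computes T [x, y] (prod_encode (x, y))"
    using rf2E[of "\<lambda>x y. prod_encode (x, y)"] by blast
  have Q': "computes (RComp Q [T]) [t, enc x] (enc (P ((h ^^ t) (s x))))" for t x
    using T Q[of t x] by (auto intro!: computes.Comp[where ys = "[_]"])
  have "computes (RMu (RComp Q [T])) [enc x] (LEAST t. P ((h ^^ t) (s x)))" for x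
  proof (rule computes.Mu)
    let ?m = "LEAST t. P ((h ^^ t) (s x))"
    have "P ((h ^^ ?m) (s x))" using total by (rule LeastI_ex)
    then show "computes (RComp Q [T]) [?m, enc x] 0" using Q'[of ?m x] by simp
    show "\<forall>i<?m. \<exists>y>0. computes (RComp Q [T]) [i, enc x] y"
      using Q'[of _ x] not_less_Least by (metis enc_bool_def less_numeral_extra(1))
  qed
  then have "computable (\<lambda>x. LEAST t. P ((h ^^ t) (s x)))" unfolding computable_def by auto
  from computable_comp2[of "\<lambda>t x. (h ^^ t) (s x)", OF it this computable_id] show ?thesis .
qed

section \<open>Monomials\<close>

text \<open>A monomial \<open>t^l s^j x^v \<partial>^w\<close> in \<open>n\<close> variables is the list \<open>l # j # v @ w\<close> of its exponents. The
  linear order is the lexicographic one on lists, in which \<open>t\<close> counts most.\<close>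

abbreviation below :: "nat list \<Rightarrow> nat list \<Rightarrow> bool" where
  "below \<equiv> list_all2 (\<le>)"

lemma nat_seq_mono_subseq:
  fixes a :: "nat \<Rightarrow> nat"
  shows "\<exists>\<psi> :: nat \<Rightarrow> nat. strict_mono \<psi> \<and> (\<forall>i j. i < j \<longrightarrow> a (\<psi> i) \<le> a (\<psi> j))"
proof -
  define S where "S = {m. \<forall>k\<ge>m. a m \<le> a k}"
  have "\<exists>m>n. m \<in> S" for n
  proof -
    obtain m where m: "m > n" "\<And>k. k > n \<Longrightarrow> a m \<le> a k"
      using ex_has_least_nat[of "\<lambda>k. k > n" "Suc n" a] by auto
    then show ?thesis by (auto simp: S_def)
  qed
  then have inf: "infinite S" by (auto simp: infinite_nat_iff_unbounded)
  then have "enumerate S i \<in> S" "strict_mono (enumerate S)" for i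
    by (auto simp: enumerate_in_set strict_mono_enumerate)
  then have "a (enumerate S i) \<le> a (enumerate S j)" if "i < j" for i j
    using that unfolding strict_mono_def S_def by (blast intro: less_imp_le)
  with \<open>strict_mono (enumerate S)\<close> show ?thesis by blast
qed

text \<open>Dickson's lemma. A single pair \<open>i < j\<close> would be enough below, but the induction on the length needs
  a subsequence.\<close>

lemma dickson:
  fixes f :: "nat \<Rightarrow> nat list"
  assumes "\<And>i. length (f i) = N"
  shows "\<exists>\<phi> :: nat \<Rightarrow> nat. strict_mono \<phi> \<and> (\<forall>i j. i < j \<longrightarrow> below (f (\<phi> i)) (f (\<phi> j)))"
  using assms
proof (induction N arbitrary: f)
  case 0
  then show ?case by (intro exI[of _ id]) (auto simp: strict_mono_def)
next
  case (Suc N)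
  have f: "below (f a) (f b) \<longleftrightarrow> hd (f a) \<le> hd (f b) \<and> below (tl (f a)) (tl (f b))" for a b
    using Suc.prems[of a] Suc.prems[of b] by (cases "f a"; cases "f b") auto
  have "length (tl (f i)) = N" for i using Suc.prems[of i] by simp
  then obtain \<phi> :: "nat \<Rightarrow> nat" where \<phi>: "strict_mono \<phi>"
    "\<forall>i j. i < j \<longrightarrow> below (tl (f (\<phi> i))) (tl (f (\<phi> j)))"
    using Suc.IH[of "\<lambda>i. tl (f i)"] by blast
  obtain \<psi> :: "nat \<Rightarrow> nat" where \<psi>: "strict_mono \<psi>"
    "\<forall>i j. i < j \<longrightarrow> hd (f (\<phi> (\<psi> i))) \<le> hd (f (\<phi> (\<psi> j)))"
    using nat_seq_mono_subseq[of "\<lambda>i. hd (f (\<phi> i))"] by blast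
  have "strict_mono (\<phi> \<circ> \<psi>)" using \<phi>(1) \<psi>(1) by (rule strict_mono_o)
  moreover have "below (f ((\<phi> \<circ> \<psi>) i)) (f ((\<phi> \<circ> \<psi>) j))" if "i < j" for i j
    using \<psi>(2)[rule_format, OF that] \<phi>(2)[rule_format, OF strict_monoD[OF \<psi>(1) that]]
    by (simp only: f simp_thms o_apply)
  ultimately show ?case by blast
qed

text \<open>A leading monomial joins the basis only if no earlier one divides it. This can happen only finitely often,
  whatever the coefficients are.\<close>

lemma wf_dickson: "wf {(m # ms, ms) | m ms. length m = N \<and> (\<forall>x\<in>set ms. \<not> below x m)}"
proof (subst wf_iff_no_infinite_down_chain, rule notI, elim exE)
  fix F assume F: "\<forall>i. (F (Suc i), F i) \<in> {(m # ms, ms) | m ms. length m = N \<and> (\<forall>x\<in>set ms. \<not> below x m)}"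
  define f where "f i = hd (F (Suc i))" for i
  have f: "F (Suc i) = f i # F i" "length (f i) = N" "\<forall>x\<in>set (F i). \<not> below x (f i)" for i
    using F[rule_format, of i] by (auto simp: f_def)
  have mem: "i < j \<Longrightarrow> f i \<in> set (F j)" for i j
    by (induction j) (auto simp: f(1) less_Suc_eq)
  obtain \<phi> :: "nat \<Rightarrow> nat" where \<phi>: "strict_mono \<phi>" "\<forall>i j. i < j \<longrightarrow> below (f (\<phi> i)) (f (\<phi> j))"
    using dickson[of f, OF f(2)] by blast
  have "\<phi> 0 < \<phi> 1" using \<phi>(1) by (simp add: strict_mono_def)
  from mem[OF this] f(3) \<phi>(2)[rule_format, of 0 1] show False by auto
qed

lemma wf_monomial: "wf {(x, y). x < y \<and> length x = length (y :: nat list)}"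
proof -
  have *: "{(u, v :: nat). u < v} = less_than" by auto
  have "(x, y) \<in> lex less_than \<longleftrightarrow> x < y \<and> length x = length y" for x y :: "nat list"
    by (simp only: lexord_lex list_less_def *)
  then have "{(x, y). x < y \<and> length x = length (y :: nat list)} = lex less_than" by auto
  then show ?thesis by (simp add: wf_lex)
qed

text \<open>Letters are numbered by their position in the exponent list. A word of letters, applied to a monomial,
  counts as the commutative product; \<open>incs\<close> is multiplication by it.\<close>

definition inc :: "nat \<Rightarrow> nat list \<Rightarrow> nat list" where
  "inc i m = m[i := Suc (m ! i)]"

definition incs :: "nat list \<Rightarrow> nat list \<Rightarrow> nat list" where
  "incs w m = foldr inc w m"

lemma length_inc [simp]: "length (inc i m) = length m"
  by (simp add: inc_def)

lemma length_incs [simp]: "length (incs w m) = length m"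
  unfolding incs_def by (induction w) auto

lemma incs_Nil [simp]: "incs [] m = m" and incs_Cons [simp]: "incs (i # w) m = inc i (incs w m)"
  by (simp_all add: incs_def)

lemma incs_append: "incs (w @ w') m = incs w (incs w' m)"
  by (simp add: incs_def)

lemma nth_incs: "j < length m \<Longrightarrow> incs w m ! j = m ! j + count (mset w) j"
  by (induction w) (auto simp: inc_def nth_list_update)

lemma less_list_update: "i < length m \<Longrightarrow> m ! i < v \<Longrightarrow> m < m[i := v]"
  for m :: "nat list"
  by (induction m arbitrary: i) (auto split: nat.split)

lemma list_update_le: "v \<le> m ! i \<Longrightarrow> m[i := v] \<le> m"
  for m :: "nat list"
  by (induction m arbitrary: i) (auto split: nat.split)

lemma less_inc: "i < length m \<Longrightarrow> m < inc i m"
  by (simp add: inc_def less_list_update)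

lemma inc_mono: "length x = length y \<Longrightarrow> x < y \<Longrightarrow> inc i x < inc i y"
  by (induction x y arbitrary: i rule: list_induct2) (auto simp: inc_def split: nat.split)

lemma inc_eq_iff: "length x = length y \<Longrightarrow> inc i x = inc i y \<longleftrightarrow> x = y"
  using inc_mono[of x y i] inc_mono[of y x i] by (metis linorder_neqE less_irrefl)

lemma inc_mono_le: "length x = length y \<Longrightarrow> x \<le> y \<Longrightarrow> inc i x \<le> inc i y"
  using inc_mono[of x y i] by (auto simp: le_less)

lemma incs_mono: "length x = length y \<Longrightarrow> x < y \<Longrightarrow> incs w x < incs w y"
  by (induction w) (auto intro: inc_mono)

lemma below_imp_le: "below x y \<Longrightarrow> x \<le> y"
  for x y :: "nat list"
  by (induction rule: list_all2_induct) auto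

lemma incs_less:
  assumes "mset u \<subset># mset w" "set w \<subseteq> {..<length m}"
  shows "incs u m < incs w m"
proof -
  have "below (incs u m) (incs w m)"
    using assms(1) by (auto simp: list_all2_conv_all_nth nth_incs mset_subset_eq_count subset_mset.less_imp_le)
  moreover have "incs u m \<noteq> incs w m"
  proof
    assume *: "incs u m = incs w m"
    have "count (mset u) j = count (mset w) j" for j
    proof (cases "j < length m")
      case True
      then show ?thesis using arg_cong[OF *, of "\<lambda>l. l ! j"] by (simp add: nth_incs)
    next
      case False
      then have "j \<notin># mset w" using assms(2) by auto
      then have "count (mset w) j = 0" by (simp add: count_eq_zero_iff)
      then show ?thesis
        using mset_subset_eq_count[OF subset_mset.less_imp_le[OF assms(1)], of j] by (simp only: le_zero_eq)
    qed
    then have "mset u = mset w" by (intro multiset_eqI)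
    with assms(1) show False by simp
  qed
  ultimately show ?thesis using below_imp_le[of "incs u m" "incs w m"] by (simp add: le_less)
qed

text \<open>The letters in the order \<open>t, s, x, \<partial>\<close> of normal forms.\<close>

definition word :: "nat list \<Rightarrow> nat list" where
  "word q = concat (map (\<lambda>i. replicate (q ! i) i) [0..<length q])"

definition mdiff :: "nat list \<Rightarrow> nat list \<Rightarrow> nat list" where
  "mdiff m m' = map (\<lambda>i. entry m i - entry m' i) [0..<length m]"

definition mlcm :: "nat list \<Rightarrow> nat list \<Rightarrow> nat list" where
  "mlcm m m' = map (\<lambda>i. max (entry m i) (entry m' i)) [0..<length m]"

lemma length_mlcm [simp]: "length (mlcm m m') = length m" by (simp add: mlcm_def)
lemma length_mdiff [simp]: "length (mdiff m m') = length m" by (simp add: mdiff_def)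

lemma set_word: "set (word q) \<subseteq> {..<length q}"
  by (auto simp: word_def)

lemma count_word: "j < length q \<Longrightarrow> count (mset (word q)) j = q ! j"
proof -
  have "count (mset (concat (map (\<lambda>i. replicate (q ! i) i) [0..<k]))) j = (if j < k then q ! j else 0)" for k
    by (induction k) (auto simp: less_Suc_eq)
  then show "j < length q \<Longrightarrow> ?thesis" by (simp add: word_def)
qed

lemma mlcm_commute: "length m = length m' \<Longrightarrow> mlcm m m' = mlcm m' m"
  by (simp add: mlcm_def max.commute)

lemma incs_word_lcm:
  "length m = length m' \<Longrightarrow> incs (word (mdiff (mlcm m m') m)) m = mlcm m m'"
  "length m = length m' \<Longrightarrow> incs (word (mdiff (mlcm m m') m')) m' = mlcm m m'"
  by (auto intro!: nth_equalityI simp: nth_incs count_word) (auto simp: mdiff_def mlcm_def)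

lemma mset_eq_incs:
  assumes "incs w m = incs w' m" "set w \<subseteq> {..<length m}" "set w' \<subseteq> {..<length m}"
  shows "mset w = mset w'"
proof (rule multiset_eqI)
  fix j show "count (mset w) j = count (mset w') j"
  proof (cases "j < length m")
    case True
    then show ?thesis using arg_cong[OF assms(1), of "\<lambda>l. l ! j"] by (simp add: nth_incs)
  next
    case False
    then have "j \<notin># mset w" "j \<notin># mset w'" using assms by auto
    then show ?thesis by (metis count_eq_zero_iff)
  qed
qed

lemma below_incs: "below m (incs w m)"
  by (auto simp: list_all2_conv_all_nth nth_incs)

lemma incs_word_mdiff: "below m M \<Longrightarrow> incs (word (mdiff M m)) m = M"
  by (auto intro!: nth_equalityI simp: nth_incs count_word list_all2_conv_all_nth) (auto simp: mdiff_def)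

lemma below_mlcm: "below m M \<Longrightarrow> below m' M \<Longrightarrow> below (mlcm m m') M"
  by (auto simp: list_all2_conv_all_nth mlcm_def)


section \<open>The extended algebra as a module over its letters\<close>

text \<open>The algebra \<open>A_n\<langle>s, t\<rangle>\<close> is represented by the vector space on its normally ordered monomials.
  Its full multiplication is never needed: left ideals are the subspaces closed under left
  multiplication by the letters.\<close>

type_synonym 'k vec = "nat list \<Rightarrow>\<^sub>0 'k"

definition scl :: "'k \<Rightarrow> 'k vec \<Rightarrow> 'k::comm_ring_1 vec" where
  "scl a = lin_ext (\<lambda>m b. Poly_Mapping.single m (a * b))"

lemma scl_single [simp]: "scl a (Poly_Mapping.single m b) = Poly_Mapping.single m (a * b)"
  by (simp add: scl_def)

lemma scl_add: "scl a (p + q) = scl a p + scl a q"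
  unfolding scl_def by (rule lin_ext_add) (simp_all add: distrib_left single_add)

lemma scl_0 [simp]: "scl a 0 = 0"
  by (simp add: scl_def)

lemma lookup_scl [simp]: "lookup (scl a p) m = a * lookup p m"
  by (induction p rule: poly_mapping_add_induct)
    (auto simp: scl_add lookup_add distrib_left lookup_single when_def)

interpretation vec: vector_space "scl :: 'k::field \<Rightarrow> 'k vec \<Rightarrow> 'k vec"
  by standard (auto intro!: poly_mapping_eqI simp: lookup_add algebra_simps)

text \<open>A letter \<open>i\<close> times a normally ordered monomial \<open>m\<close> is \<open>inc i m\<close> plus \<open>kap n i m\<close> times \<open>low n i m\<close>. The
  correction comes from \<open>s t^l = t^l s + l t^l\<close> for the letter \<open>1\<close> and from
  \<open>\<partial> x^k = x^k \<partial> + k x^(k-1)\<close> for the letters from \<open>n + 2\<close> on; the position of the variable of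
  \<open>\<partial>\<close> is \<open>i - n\<close>.\<close>

definition kap :: "nat \<Rightarrow> nat \<Rightarrow> nat list \<Rightarrow> nat" where
  "kap n i m = (if i = 1 then entry m 0 else if n + 2 \<le> i then entry m (i - n) else 0)"

definition low :: "nat \<Rightarrow> nat \<Rightarrow> nat list \<Rightarrow> nat list" where
  "low n i m = (if i = 1 then m else m[i - n := m ! (i - n) - 1])"

definition lop :: "nat \<Rightarrow> nat \<Rightarrow> 'k::comm_ring_1 vec \<Rightarrow> 'k vec" where
  "lop n i = lin_ext (\<lambda>m a. Poly_Mapping.single (inc i m) a +
     Poly_Mapping.single (low n i m) (of_nat (kap n i m) * a))"

definition mon :: "nat \<Rightarrow> nat list set" where
  "mon n = {m. length m = 2 * n + 2}"

abbreviation "indices n \<equiv> {..<2 * n + 2}"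

lemma length_low [simp]: "length (low n i m) = length m"
  by (simp add: low_def)

text \<open>The correction divides the main term properly. Therefore leading monomials multiply as in a commutative
  ring, in any monomial order.\<close>

lemma low_less_inc: "i < length m \<Longrightarrow> low n i m < inc i m"
  using less_inc[of i m] list_update_le[of "m ! (i - n) - 1" m "i - n"] by (auto simp: low_def)

lemma lop_single: "lop n i (Poly_Mapping.single m a) = Poly_Mapping.single (inc i m) a +
     Poly_Mapping.single (low n i m) (of_nat (kap n i m) * a)"
  by (simp add: lop_def)

lemma lop_add: "lop n i (p + q) = lop n i p + lop n i q"
  unfolding lop_def by (rule lin_ext_add) (simp_all add: distrib_left single_add)

lemma lop_0 [simp]: "lop n i 0 = 0"
  by (simp add: lop_def)

lemma lop_scl: "lop n i (scl a p) = scl a (lop n i p)"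
  by (induction p rule: poly_mapping_add_induct)
    (auto simp: scl_add lop_add lop_single mult_ac)

lemma lop_diff: "lop n i (p - q) = lop n i p - lop n i q"
  using lop_add[of n i "p - q" q] by (simp add: algebra_simps)

definition lw :: "nat \<Rightarrow> nat list \<Rightarrow> 'k::comm_ring_1 vec \<Rightarrow> 'k vec" where
  "lw n w v = foldr (lop n) w v"

lemma lw_Nil [simp]: "lw n [] v = v" and lw_Cons [simp]: "lw n (i # w) v = lop n i (lw n w v)"
  by (simp_all add: lw_def)

lemma lw_append: "lw n (w @ w') v = lw n w (lw n w' v)"
  by (simp add: lw_def)

lemma lw_add: "lw n w (u + v) = lw n w u + lw n w v"
  by (induction w) (auto simp: lop_add)

lemma lw_0 [simp]: "lw n w 0 = 0"
  by (induction w) auto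

lemma lw_scl: "lw n w (scl a v) = scl a (lw n w v)"
  by (induction w) (auto simp: lop_scl)

lemma lw_diff: "lw n w (u - v) = lw n w u - lw n w v"
  by (induction w) (auto simp: lop_diff)

text \<open>With a nonzero coefficient at \<open>m\<close>, the bound \<open>m\<close> is the leading monomial. Bounds are easier to
  propagate, because they survive when a coefficient vanishes.\<close>

definition bounded :: "nat \<Rightarrow> 'k::comm_ring_1 vec \<Rightarrow> nat list \<Rightarrow> bool" where
  "bounded n v m \<longleftrightarrow> m \<in> mon n \<and> (\<forall>k\<in>keys v. k \<in> mon n \<and> k \<le> m)"

lemma vec_single_induct:
  fixes v :: "'k::comm_ring_1 vec"
  assumes "keys v \<subseteq> A" "P 0" "\<And>m a. m \<in> A \<Longrightarrow> P (Poly_Mapping.single m a)"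
    "\<And>p q. P p \<Longrightarrow> P q \<Longrightarrow> P (p + q)"
  shows "P v"
proof -
  have "v = (\<Sum>m\<in>keys v. Poly_Mapping.single m (lookup v m))"
    by (rule poly_mapping_eqI) (auto simp: lookup_sum lookup_single when_def in_keys_iff)
  moreover have "P (\<Sum>m\<in>B. Poly_Mapping.single m (lookup v m))" if "finite B" "B \<subseteq> A" for B
    using that by (induction B rule: finite_induct) (auto simp: assms)
  ultimately show ?thesis using assms(1) by (metis finite_keys)
qed

lemma bounded_add: "bounded n u m \<Longrightarrow> bounded n v m \<Longrightarrow> bounded n (u + v) m"
  using Poly_Mapping.keys_add[of u v] by (auto simp: bounded_def)

lemma bounded_single: "k \<in> mon n \<Longrightarrow> m \<in> mon n \<Longrightarrow> k \<le> m \<Longrightarrow> bounded n (Poly_Mapping.single k a) m"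
  by (auto simp: bounded_def split: if_splits)

lemma bounded_lop_lookup:
  assumes "bounded n v m" "i < 2 * n + 2"
  shows "bounded n (lop n i v) (inc i m) \<and> lookup (lop n i v) (inc i m) = lookup v m"
proof (rule vec_single_induct[of v "{k \<in> mon n. k \<le> m}"])
  show "keys v \<subseteq> {k \<in> mon n. k \<le> m}" using assms by (auto simp: bounded_def)
  have m: "length m = 2 * n + 2" using assms by (auto simp: bounded_def mon_def)
  show "bounded n (lop n i 0) (inc i m) \<and> lookup (lop n i 0) (inc i m) = lookup (0 :: 'a vec) m"
    using m by (simp add: bounded_def mon_def)
  fix k and a :: 'a assume "k \<in> {k \<in> mon n. k \<le> m}"
  then have k: "length k = 2 * n + 2" "k \<le> m" by (auto simp: mon_def)
  have le: "inc i k \<le> inc i m" using k m by (intro inc_mono_le) auto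
  have lt: "low n i k < inc i m" using low_less_inc[of i k n] k le assms(2) by simp
  have "inc i k = inc i m \<longleftrightarrow> k = m" using k m by (intro inc_eq_iff) auto
  then show "bounded n (lop n i (Poly_Mapping.single k a)) (inc i m) \<and>
      lookup (lop n i (Poly_Mapping.single k a)) (inc i m) = lookup (Poly_Mapping.single k a) m"
    using k m le lt
    by (auto simp: lop_single lookup_add lookup_single when_def mon_def intro!: bounded_add bounded_single)
next
  fix p q :: "'a vec" assume "bounded n (lop n i p) (inc i m) \<and> lookup (lop n i p) (inc i m) = lookup p m"
    "bounded n (lop n i q) (inc i m) \<and> lookup (lop n i q) (inc i m) = lookup q m"
  then show "bounded n (lop n i (p + q)) (inc i m) \<and> lookup (lop n i (p + q)) (inc i m) = lookup (p + q) m"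
    by (auto simp: lop_add lookup_add bounded_add)
qed

lemma bounded_lw_lookup:
  assumes "bounded n v m" "set w \<subseteq> indices n"
  shows "bounded n (lw n w v) (incs w m) \<and> lookup (lw n w v) (incs w m) = lookup v m"
  using assms(2) by (induction w) (use assms(1) bounded_lop_lookup in auto)

lemma lop_keys:
  fixes v :: "'k::comm_ring_1 vec"
  assumes "keys v \<subseteq> mon n"
  shows "keys (lop n i v) \<subseteq> mon n"
  using assms
proof (rule vec_single_induct)
  fix m and a :: 'k assume "m \<in> mon n"
  then show "keys (lop n i (Poly_Mapping.single m a)) \<subseteq> mon n"
    unfolding lop_single by (intro order_trans[OF Poly_Mapping.keys_add]) (auto simp: mon_def)
next
  fix p q :: "'k vec" assume "keys (lop n i p) \<subseteq> mon n" "keys (lop n i q) \<subseteq> mon n"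
  then show "keys (lop n i (p + q)) \<subseteq> mon n"
    unfolding lop_add by (intro order_trans[OF Poly_Mapping.keys_add]) auto
qed simp

lemma lw_keys: "keys v \<subseteq> mon n \<Longrightarrow> keys (lw n w v) \<subseteq> mon n"
  by (induction w) (auto dest: lop_keys)

text \<open>The commutators of the letters: \<open>s t - t s = t\<close>, \<open>\<partial>_i x_i - x_i \<partial>_i = 1\<close>, and zero otherwise.\<close>

lemma lop_commute:
  fixes v :: "'k::comm_ring_1 vec"
  assumes "keys v \<subseteq> mon n" "j < i" "i < 2 * n + 2"
  shows "lop n i (lop n j v) = lop n j (lop n i v) +
    (if i = 1 then lop n 0 v else if n + 2 \<le> i \<and> j = i - n then v else 0)"
  using assms(1)
proof (rule vec_single_induct)
  fix m and a :: 'k assume m: "m \<in> mon n"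
  then have len: "length m = 2 * n + 2" by (simp add: mon_def)
  have cases: "i = 1 \<and> j = 0 \<or> 1 < i \<and> i < n + 2 \<or> n + 2 \<le> i \<and> j = i - n \<or>
      n + 2 \<le> i \<and> j \<noteq> i - n \<and> j < n + 2 \<and> j \<noteq> 1 \<or> n + 2 \<le> i \<and> j \<noteq> i - n \<and> (n + 2 \<le> j \<or> j = 1)"
    using assms(2,3) by linarith
  have inc: "inc i (inc j m) = inc j (inc i m)"
    using assms(2) by (simp add: inc_def list_update_swap)
  have up: "kap n i (inc j m) = kap n i m" "low n i (inc j m) = inc j (low n i m)"
    if "n + 2 \<le> i" "j \<noteq> i - n"
    using that by (simp_all add: kap_def low_def inc_def entry_def list_update_swap)
  have down: "kap n j (inc i m) = kap n j m" "low n j (inc i m) = inc i (low n j m)"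
    "kap n j (low n i m) = kap n j m" "low n j (low n i m) = low n i (low n j m)"
    "kap n i (low n j m) = kap n i m"
    if "n + 2 \<le> i" "n + 2 \<le> j \<or> j = 1"
    using that assms len by (auto simp: kap_def low_def inc_def list_update_swap nth_list_update)
  have zero: "kap n j l = 0" if "j < n + 2" "j \<noteq> 1" for l
    using that by (simp add: kap_def)
  have one: "kap n 1 (inc 0 m) = Suc (m ! 0)" "kap n 1 m = m ! 0" "low n 1 l = l" "kap n 0 l = 0" for l
    using len by (simp_all add: kap_def low_def inc_def)
  have der: "kap n i (inc j m) = Suc (m ! j)" "kap n i m = m ! j" "low n i (inc j m) = m"
      "m ! j \<noteq> 0 \<Longrightarrow> inc j (low n i m) = m" if "n + 2 \<le> i" "j = i - n"
    using that assms(2,3) len by (auto simp: kap_def low_def inc_def)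
  show "lop n i (lop n j (Poly_Mapping.single m a)) = lop n j (lop n i (Poly_Mapping.single m a)) +
      (if i = 1 then lop n 0 (Poly_Mapping.single m a) else if n + 2 \<le> i \<and> j = i - n then Poly_Mapping.single m a else 0)"
    using cases
  proof (elim disjE conjE)
    assume "i = 1" "j = 0"
    with inc show ?thesis
      by (simp add: lop_single lop_add one algebra_simps single_add del: One_nat_def)
  next
    assume i: "1 < i" "i < n + 2"
    then have "kap n i l = 0" for l by (simp add: kap_def)
    moreover have "kap n 1 (inc i m) = kap n 1 m" using i len by (simp add: kap_def inc_def)
    moreover have "kap n j l = 0" if "j \<noteq> 1" for l using that i assms(2) zero by simp
    ultimately show ?thesis using i inc one(3)
      by (cases "j = 1") (simp_all add: lop_single lop_add del: One_nat_def)
  next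
    assume i: "n + 2 \<le> i" "j = i - n"
    then have "j < n + 2" "j \<noteq> 1" using assms by linarith+
    then have "kap n j l = 0" for l by (rule zero)
    with i inc der[OF i] assms show ?thesis
      by (cases "m ! j = 0") (simp_all add: lop_single lop_add algebra_simps single_add)
  next
    assume "n + 2 \<le> i" "j \<noteq> i - n" "j < n + 2" "j \<noteq> 1"
    with inc up zero show ?thesis by (simp add: lop_single lop_add)
  next
    assume "n + 2 \<le> i" "j \<noteq> i - n" "n + 2 \<le> j"
    with inc up down show ?thesis by (simp add: lop_single lop_add algebra_simps)
  next
    assume "n + 2 \<le> i" "j \<noteq> i - n" "j = 1"
    with inc up down show ?thesis by (simp add: lop_single lop_add algebra_simps)
  qed
qed (auto simp: lop_add algebra_simps)


text \<open>The error that arises when letters of a word are reordered: every commutator replaces two letters by at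
  most one, so that only words with properly fewer letters appear.\<close>

definition lower_words :: "nat \<Rightarrow> nat multiset \<Rightarrow> 'k::field vec \<Rightarrow> 'k vec set" where
  "lower_words n W v = vec.span {lw n u v | u. set u \<subseteq> indices n \<and> mset u \<subset># W}"

lemma lower_words_lop:
  assumes "y \<in> lower_words n W v" "i \<in> indices n"
  shows "lop n i y \<in> lower_words n (add_mset i W) v"
  using assms(1) unfolding lower_words_def
proof (induction rule: vec.span_induct_alt)
  case base
  then show ?case by (simp add: vec.span_zero)
next
  case (step c x y)
  then obtain u where u: "x = lw n u v" "set u \<subseteq> indices n" "mset u \<subset># W" by auto
  have "lop n i x \<in> {lw n u v | u. set u \<subseteq> indices n \<and> mset u \<subset># add_mset i W}"
    using u assms(2) by (intro CollectI exI[of _ "i # u"]) auto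
  with step show ?case
    by (simp add: lop_add lop_scl vec.span_add vec.span_scale vec.span_base)
qed

lemma lower_words_base: "set u \<subseteq> indices n \<Longrightarrow> mset u \<subset># W \<Longrightarrow> lw n u v \<in> lower_words n W v"
  unfolding lower_words_def by (rule vec.span_base) auto

lemma lower_words_neg: "y \<in> lower_words n W v \<Longrightarrow> - y \<in> lower_words n W v"
  unfolding lower_words_def by (rule vec.span_neg)

lemma lower_words_0: "0 \<in> lower_words n W v"
  unfolding lower_words_def by (rule vec.span_zero)

lemma lower_words_add: "x \<in> lower_words n W v \<Longrightarrow> y \<in> lower_words n W v \<Longrightarrow> x + y \<in> lower_words n W v"
  unfolding lower_words_def by (rule vec.span_add)

lemma lw_swap:
  assumes v: "keys v \<subseteq> mon n" and i: "i \<in> indices n"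
  shows "set u \<subseteq> indices n \<Longrightarrow> set w \<subseteq> indices n \<Longrightarrow>
    lw n (i # u @ w) v - lw n (u @ i # w) v \<in> lower_words n (mset (i # u @ w)) v"
proof (induction u)
  case (Cons j u)
  let ?W = "mset (i # (j # u) @ w)"
  have X: "keys (lw n (u @ w) v) \<subseteq> mon n" using v by (rule lw_keys)
  have 1: "lw n (u @ w) v \<in> lower_words n ?W v"
    using Cons.prems by (intro lower_words_base) (auto simp: subset_mset.less_le)
  have 0: "lop n 0 (lw n (u @ w) v) \<in> lower_words n ?W v" if "0 < i \<and> j = 0 \<or> 0 < j \<and> i = 0"
    using Cons.prems that lower_words_base[of "0 # u @ w" n ?W v]
    by (auto simp: subset_mset.less_le)
  have "lop n i (lop n j (lw n (u @ w) v)) - lop n j (lop n i (lw n (u @ w) v)) \<in> lower_words n ?W v"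
  proof (cases i j rule: linorder_cases)
    case less
    then show ?thesis
      using lop_commute[OF X less] Cons.prems 0 1 by (auto intro: lower_words_neg lower_words_0)
  next
    case greater
    then show ?thesis
      using lop_commute[OF X greater] i 0 1 by (auto intro: lower_words_0)
  qed (simp add: lower_words_0)
  moreover have "lop n j (lw n (i # u @ w) v - lw n (u @ i # w) v) \<in> lower_words n ?W v"
    using lower_words_lop[OF Cons.IH, of j] Cons.prems by (simp add: add_mset_commute)
  ultimately show ?case
    using lower_words_add[of "lop n i (lop n j (lw n (u @ w) v)) - lop n j (lop n i (lw n (u @ w) v))" n ?W v
        "lop n j (lw n (i # u @ w) v - lw n (u @ i # w) v)"]
    by (simp add: lop_diff)
qed (simp add: lower_words_0)

lemma lw_perm:
  assumes v: "keys v \<subseteq> mon n"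
  shows "set w \<subseteq> indices n \<Longrightarrow> mset w = mset w' \<Longrightarrow> lw n w v - lw n w' v \<in> lower_words n (mset w) v"
proof (induction w arbitrary: w')
  case Nil
  then show ?case by (simp add: lower_words_0)
next
  case (Cons i w)
  have "i \<in> set w'" using Cons.prems by (metis list.set_intros(1) set_mset_mset)
  then obtain u1 u2 where w': "w' = u1 @ i # u2" by (meson split_list)
  with Cons.prems have w: "mset w = mset (u1 @ u2)" by simp
  have u: "set u1 \<subseteq> indices n" "set u2 \<subseteq> indices n" "i \<in> indices n"
    using Cons.prems mset_eq_setD[OF Cons.prems(2)] w' by auto
  have "lop n i (lw n w v - lw n (u1 @ u2) v) \<in> lower_words n (mset (i # w)) v"
    using lower_words_lop[OF Cons.IH[OF _ w] u(3)] Cons.prems by simp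
  moreover have "lw n (i # u1 @ u2) v - lw n w' v \<in> lower_words n (mset (i # w)) v"
    using lw_swap[OF v u(3,1,2)] w w' by simp
  ultimately show ?case
    using lower_words_add[of "lop n i (lw n w v - lw n (u1 @ u2) v)" n "mset (i # w)" v]
    by (fastforce simp: lop_diff)
qed

section \<open>The criterion of Buchberger\<close>

text \<open>The combinations of multiples of basis elements with leading monomial below \<open>M\<close>. A pair of the set
  \<open>B\<close> is an element with its leading monomial.\<close>

definition word_span :: "nat \<Rightarrow> (nat list \<times> 'k::field vec) set \<Rightarrow> nat list \<Rightarrow> 'k vec set" where
  "word_span n B M = vec.span {lw n w v | w m v. (m, v) \<in> B \<and> set w \<subseteq> indices n \<and> incs w m < M}"

definition leading :: "nat \<Rightarrow> (nat list \<times> 'k::field vec) set \<Rightarrow> bool" where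
  "leading n B \<longleftrightarrow> (\<forall>(m, v)\<in>B. bounded n v m \<and> lookup v m \<noteq> 0)"

lemma leadingD: "leading n B \<Longrightarrow> (m, v) \<in> B \<Longrightarrow>
    bounded n v m \<and> lookup v m \<noteq> 0 \<and> length m = 2 * n + 2 \<and> keys v \<subseteq> mon n"
  by (auto simp: leading_def bounded_def mon_def)

lemma word_span_lw:
  assumes "leading n B" "y \<in> word_span n B M" "length M = 2 * n + 2" "set u \<subseteq> indices n"
  shows "lw n u y \<in> word_span n B (incs u M)"
  using assms(2) unfolding word_span_def
proof (induction rule: vec.span_induct_alt)
  case base
  then show ?case by (simp add: vec.span_zero)
next
  case (step c x y)
  then obtain w m v where w: "x = lw n w v" "(m, v) \<in> B" "set w \<subseteq> indices n" "incs w m < M" by auto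
  have "incs (u @ w) m < incs u M"
    unfolding incs_append using w assms(3) leadingD[OF assms(1) w(2)] by (intro incs_mono) auto
  then have "lw n u x \<in> {lw n w v | w m v. (m, v) \<in> B \<and> set w \<subseteq> indices n \<and> incs w m < incs u M}"
    using w assms(4) by (intro CollectI exI[of _ "u @ w"] exI[of _ m] exI[of _ v]) (auto simp: lw_append)
  with step show ?case
    by (simp add: lw_add lw_scl vec.span_add vec.span_scale vec.span_base)
qed

lemma lower_words_word_span:
  assumes "leading n B" "(m, v) \<in> B" "set w \<subseteq> indices n"
  shows "lower_words n (mset w) v \<subseteq> word_span n B (incs w m)"
  unfolding lower_words_def word_span_def
proof (intro vec.span_mono subsetI, clarify)
  fix u assume "set u \<subseteq> indices n" "mset u \<subset># mset w"
  moreover from this have "incs u m < incs w m"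
    using assms leadingD[OF assms(1,2)] by (intro incs_less) auto
  ultimately show "\<exists>w' m' v'. lw n u v = lw n w' v' \<and> (m', v') \<in> B \<and> set w' \<subseteq> indices n \<and> incs w' m' < incs w m"
    using assms(2) by blast
qed

lemma span_image_lin_ext:
  fixes e :: "nat list \<Rightarrow> 'k::field vec"
  assumes "u \<in> vec.span (e ` S)"
  shows "\<exists>a :: 'k vec. keys a \<subseteq> S \<and> u = lin_ext (\<lambda>M c. scl c (e M)) a"
  using assms
proof (induction rule: vec.span_induct_alt)
  case base
  then show ?case by (intro exI[of _ 0]) simp
next
  case (step c x y)
  then obtain M a where a: "x = e M" "M \<in> S" "keys a \<subseteq> S" "y = lin_ext (\<lambda>M c. scl c (e M)) a" by auto
  have "keys (Poly_Mapping.single M c + a) \<subseteq> S"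
    using a Poly_Mapping.keys_add[of "Poly_Mapping.single M c" a] by (auto split: if_splits)
  moreover have "scl c x + y = lin_ext (\<lambda>M c. scl c (e M)) (Poly_Mapping.single M c + a)"
    using a by (subst lin_ext_add) (auto simp: vec.scale_left_distrib)
  ultimately show ?case by blast
qed

text \<open>For each monomial \<open>M\<close> divisible by a leading monomial, \<open>e M\<close> is one chosen multiple of a basis element
  that has leading monomial \<open>M\<close>. All multiples are combinations of these, by induction on \<open>M\<close>: up to
  terms below \<open>M\<close>, a change in the order of the letters turns two multiples with leading monomial \<open>M\<close>
  into a common multiple of the two members of an S-pair, and the S-pair has a representation below
  the least common multiple.\<close>

lemma span_of_leading:
  assumes lead: "leading n B"
    and spair: "\<And>m v m' v'. (m, v) \<in> B \<Longrightarrow> (m', v') \<in> B \<Longrightarrow>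
      scl (lookup v' m') (lw n (word (mdiff (mlcm m m') m)) v) -
      scl (lookup v m) (lw n (word (mdiff (mlcm m m') m')) v') \<in> word_span n B (mlcm m m')"
    and e: "\<And>M w m v. (m, v) \<in> B \<Longrightarrow> set w \<subseteq> indices n \<Longrightarrow> incs w m = M \<Longrightarrow>
      \<exists>w' m' v'. (m', v') \<in> B \<and> set w' \<subseteq> indices n \<and> incs w' m' = M \<and> e M = lw n w' v'"
    and S: "S = {incs w m | w m v. (m, v) \<in> B \<and> set w \<subseteq> indices n}"
  shows "(m, v) \<in> B \<Longrightarrow> set w \<subseteq> indices n \<Longrightarrow>
    lw n w v \<in> vec.span (e ` {M \<in> S. M \<le> incs w m})"
proof (induction "incs w m" arbitrary: w m v rule: wf_induct_rule[OF wf_monomial])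
  case 1
  let ?M = "incs w m"
  define V where "V = vec.span (e ` {M \<in> S. M \<le> ?M})"
  note mv = leadingD[OF lead "1.prems"(1)]
  have lower: "word_span n B ?M \<subseteq> V"
    unfolding word_span_def V_def
  proof (rule vec.span_minimal)
    show "{lw n w' v' | w' m' v'. (m', v') \<in> B \<and> set w' \<subseteq> indices n \<and> incs w' m' < ?M}
        \<subseteq> vec.span (e ` {M \<in> S. M \<le> ?M})"
    proof clarify
      fix w' m' v' assume *: "(m', v') \<in> B" "set w' \<subseteq> indices n" "incs w' m' < ?M"
      have "lw n w' v' \<in> vec.span (e ` {M \<in> S. M \<le> incs w' m'})"
        using * mv leadingD[OF lead *(1)] by (intro "1.hyps") auto
      moreover have "vec.span (e ` {M \<in> S. M \<le> incs w' m'}) \<subseteq> vec.span (e ` {M \<in> S. M \<le> ?M})"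
        using *(3) by (intro vec.span_mono image_mono) auto
      ultimately show "lw n w' v' \<in> vec.span (e ` {M \<in> S. M \<le> ?M})" by blast
    qed
  qed (rule vec.subspace_span)
  obtain w' m' v' where e': "(m', v') \<in> B" "set w' \<subseteq> indices n" "incs w' m' = ?M" "e ?M = lw n w' v'"
    using e[OF "1.prems" refl] by blast
  note mv' = leadingD[OF lead e'(1)]
  have len: "length m = length m'" using mv mv' by simp
  let ?l = "mlcm m m'"
  let ?q = "word (mdiff ?l m)" and ?q' = "word (mdiff ?l m')" and ?r = "word (mdiff ?M ?l)"
  have idx: "set ?q \<subseteq> indices n" "set ?q' \<subseteq> indices n" "set ?r \<subseteq> indices n"
    using set_word mv mv' by (metis length_mdiff length_mlcm length_incs)+
  have "below ?l ?M"
    using below_incs[of m w] below_incs[of m' w'] e'(3) by (intro below_mlcm) auto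
  then have r: "incs ?r ?l = ?M" by (rule incs_word_mdiff)
  have rq: "incs (?r @ ?q) m = ?M" "incs (?r @ ?q') m' = ?M"
    using r incs_word_lcm[OF len] by (simp_all add: incs_append)
  have perm: "lw n w v - lw n (?r @ ?q) v \<in> V"
  proof -
    have "mset w = mset (?r @ ?q)"
      using rq(1) "1.prems" idx mv by (intro mset_eq_incs[of w m]) auto
    then have "lw n w v - lw n (?r @ ?q) v \<in> lower_words n (mset w) v"
      using mv "1.prems" by (intro lw_perm) auto
    then show ?thesis using lower_words_word_span[OF lead "1.prems"] lower by blast
  qed
  have perm': "lw n (?r @ ?q') v' - e ?M \<in> V"
  proof -
    have "mset (?r @ ?q') = mset w'"
      using rq(2) e' idx mv' by (intro mset_eq_incs[of _ m']) auto
    then have "lw n (?r @ ?q') v' - lw n w' v' \<in> lower_words n (mset (?r @ ?q')) v'"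
      using mv' idx by (intro lw_perm) auto
    then show ?thesis
      using lower_words_word_span[OF lead e'(1), of "?r @ ?q'"] idx rq(2) lower e'(4) by auto
  qed
  have "lw n ?r (scl (lookup v' m') (lw n ?q v) - scl (lookup v m) (lw n ?q' v')) \<in> V"
    using word_span_lw[OF lead spair[OF "1.prems"(1) e'(1)] _ idx(3)] mv r lower by auto
  then have pair: "scl (lookup v' m') (lw n (?r @ ?q) v) - scl (lookup v m) (lw n (?r @ ?q') v') \<in> V"
    by (simp add: lw_diff lw_scl lw_append)
  have top: "e ?M \<in> V"
    unfolding V_def using "1.prems" by (intro vec.span_base imageI) (auto simp: S)
  have "scl (lookup v' m') (lw n w v) =
      scl (lookup v' m') (lw n w v - lw n (?r @ ?q) v) +
      (scl (lookup v' m') (lw n (?r @ ?q) v) - scl (lookup v m) (lw n (?r @ ?q') v')) +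
      scl (lookup v m) (lw n (?r @ ?q') v' - e ?M) + scl (lookup v m) (e ?M)"
    by (simp add: vec.scale_right_diff_distrib)
  also have "\<dots> \<in> V"
    using perm perm' pair top unfolding V_def
    by (intro vec.span_add vec.span_scale) auto
  finally have "scl (inverse (lookup v' m')) (scl (lookup v' m') (lw n w v)) \<in> V"
    unfolding V_def by (rule vec.span_scale)
  then show ?case using mv' by (simp add: V_def)
qed

lemma monomial_le_nth_0: "M \<le> M' \<Longrightarrow> length M = Suc k \<Longrightarrow> length M' = Suc l \<Longrightarrow> M ! 0 \<le> (M' ! 0 :: nat)"
  by (cases M; cases M') auto

text \<open>The elements \<open>e M\<close> have different leading monomials. So the largest \<open>M\<close> in a combination survives as a
  monomial of the result; if that is free of \<open>t\<close>, then so are this \<open>M\<close> and, the exponent of \<open>t\<close> being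
  compared first, all smaller ones.\<close>

theorem elimination:
  assumes lead: "leading n B"
    and spair: "\<And>m v m' v'. (m, v) \<in> B \<Longrightarrow> (m', v') \<in> B \<Longrightarrow>
      scl (lookup v' m') (lw n (word (mdiff (mlcm m m') m)) v) -
      scl (lookup v m) (lw n (word (mdiff (mlcm m m') m')) v') \<in> word_span n B (mlcm m m')"
    and u: "u \<in> vec.span {lw n w v | w m v. (m, v) \<in> B \<and> set w \<subseteq> indices n}"
    and no_t: "\<forall>k\<in>keys u. k ! 0 = 0"
  shows "u \<in> vec.span {lw n w v | w m v. (m, v) \<in> B \<and> m ! 0 = 0 \<and> set w \<subseteq> indices n - {0}}"
proof -
  define S where "S = {incs w m | w m v. (m, v) \<in> B \<and> set w \<subseteq> indices n}"
  have "\<forall>M. \<exists>x. M \<in> S \<longrightarrow> (\<exists>w m v. (m, v) \<in> B \<and> set w \<subseteq> indices n \<and> incs w m = M \<and> x = lw n w v)"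
    unfolding S_def by blast
  from choice[OF this] obtain e where e: "\<And>M. M \<in> S \<Longrightarrow>
      \<exists>w m v. (m, v) \<in> B \<and> set w \<subseteq> indices n \<and> incs w m = M \<and> e M = lw n w v"
    by auto
  have "u \<in> vec.span (e ` S)"
  proof -
    have "lw n w v \<in> vec.span (e ` S)" if "(m, v) \<in> B" "set w \<subseteq> indices n" for w m v
    proof -
      have "\<exists>w' m' v'. (m', v') \<in> B \<and> set w' \<subseteq> indices n \<and> incs w' m' = M \<and> e M = lw n w' v'"
        if "(m, v) \<in> B" "set w \<subseteq> indices n" "incs w m = M" for M w m v
        using e[of M] that by (auto simp: S_def)
      with lead spair have "lw n w v \<in> vec.span (e ` {M \<in> S. M \<le> incs w m})"
        using S_def \<open>(m, v) \<in> B\<close> \<open>set w \<subseteq> indices n\<close> by (rule span_of_leading)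
      then show ?thesis using vec.span_mono[of "e ` {M \<in> S. M \<le> incs w m}" "e ` S"] by auto
    qed
    then have "vec.span {lw n w v | w m v. (m, v) \<in> B \<and> set w \<subseteq> indices n} \<subseteq> vec.span (e ` S)"
      by (intro vec.span_minimal vec.subspace_span) auto
    with u show ?thesis by blast
  qed
  then obtain a where a: "keys a \<subseteq> S" "u = lin_ext (\<lambda>M c. scl c (e M)) a"
    using span_image_lin_ext by blast
  have u_sum: "u = (\<Sum>M\<in>keys a. scl (lookup a M) (e M))" using a(2) by (simp add: lin_ext_def)
  have bnd: "bounded n (e M) M" "lookup (e M) M \<noteq> 0" if M: "M \<in> S" for M
  proof -
    obtain w m v where *: "(m, v) \<in> B" "set w \<subseteq> indices n" "incs w m = M" "e M = lw n w v"
      using e[OF M] by blast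
    show "bounded n (e M) M" "lookup (e M) M \<noteq> 0"
      using bounded_lw_lookup[of n v m w] leadingD[OF lead *(1)] * by auto
  qed
  have t0: "M ! 0 = 0" if M: "M \<in> keys a" for M
  proof -
    define M0 where "M0 = Max (keys a)"
    have M0: "M0 \<in> keys a" "\<And>M. M \<in> keys a \<Longrightarrow> M \<le> M0"
      using M unfolding M0_def by (auto intro: Max_in)
    have "lookup u M0 = (\<Sum>M\<in>keys a. lookup a M * lookup (e M) M0)"
      by (simp add: u_sum lookup_sum)
    also have "\<dots> = (\<Sum>M\<in>{M0}. lookup a M * lookup (e M) M0)"
    proof (rule sum.mono_neutral_right)
      show "\<forall>M\<in>keys a - {M0}. lookup a M * lookup (e M) M0 = 0"
      proof
        fix M assume *: "M \<in> keys a - {M0}"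
        then have "M < M0" using M0(2)[of M] by auto
        then have "M0 \<notin> keys (e M)" using bnd(1)[of M] * a(1) unfolding bounded_def by fastforce
        then show "lookup a M * lookup (e M) M0 = 0" by (simp add: in_keys_iff)
      qed
    qed (use M0 in auto)
    also have "\<dots> \<noteq> 0" using M0 bnd(2)[of M0] a(1) by (auto simp: in_keys_iff)
    finally have "M0 ! 0 = 0" using no_t by (auto simp: in_keys_iff)
    moreover have "M \<in> mon n" "M0 \<in> mon n" using bnd(1) a(1) M M0 by (auto simp: bounded_def)
    ultimately show ?thesis using monomial_le_nth_0[OF M0(2)[OF M]] by (simp add: mon_def)
  qed
  have "e M \<in> {lw n w v | w m v. (m, v) \<in> B \<and> m ! 0 = 0 \<and> set w \<subseteq> indices n - {0}}" if M: "M \<in> keys a" for M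
  proof -
    obtain w m v where *: "(m, v) \<in> B" "set w \<subseteq> indices n" "incs w m = M" "e M = lw n w v"
      using e a(1) M by blast
    have "m ! 0 + count (mset w) 0 = 0"
      using t0[OF M] * nth_incs[of 0 m w] leadingD[OF lead *(1)] by simp
    then have "m ! 0 = 0" "0 \<notin> set w" by (auto simp: count_eq_zero_iff)
    with * show ?thesis by blast
  qed
  then show ?thesis
    unfolding u_sum by (intro vec.span_sum vec.span_scale vec.span_base) auto
qed

section \<open>The parametric algorithm\<close>

text \<open>A formal coefficient is a sum of signed products of indeterminates, \<open>True\<close> standing for a plus; an
  indeterminate \<open>a_v\<close> is given by the exponent list \<open>v\<close>. Formal coefficients and formal operators are
  not simplified: a term may be zero, or cancel against others. Signs are enough as constants, since
  integer multiples are repetitions.\<close>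

type_synonym fcoeff = "(bool \<times> nat list list) list"
type_synonym fpoly = "(fcoeff \<times> nat list) list"
type_synonym state = "fcoeff list \<times> fcoeff list \<times> fpoly list \<times> fpoly list"

definition cneg :: "fcoeff \<Rightarrow> fcoeff" where
  "cneg c = map (\<lambda>t. (\<not> fst t, snd t)) c"

definition cmul :: "fcoeff \<Rightarrow> fcoeff \<Rightarrow> fcoeff" where
  "cmul c c' = concat (map (\<lambda>t. map (\<lambda>t'. (fst t = fst t', snd t @ snd t')) c') c)"

definition fscale :: "fcoeff \<Rightarrow> fpoly \<Rightarrow> fpoly" where
  "fscale c p = map (\<lambda>t. (cmul c (fst t), snd t)) p"

definition flop :: "nat \<Rightarrow> nat \<Rightarrow> fpoly \<Rightarrow> fpoly" where
  "flop n i p = concat (map (\<lambda>t. (fst t, inc i (snd t)) #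
     replicate (kap n i (snd t)) (fst t, low n i (snd t))) p)"

definition flw :: "nat \<Rightarrow> nat list \<Rightarrow> fpoly \<Rightarrow> fpoly" where
  "flw n w p = foldr (flop n) w p"

text \<open>The leading monomial and coefficient of the formal expression. At a given point the leading
  coefficient may vanish.\<close>

definition flm :: "fpoly \<Rightarrow> nat list" where
  "flm p = foldl max (snd (hd p)) (map snd (tl p))"

definition flc :: "fpoly \<Rightarrow> fcoeff" where
  "flc p = concat (map fst (filter (\<lambda>t. snd t = flm p) p))"

definition fdrop :: "nat list \<Rightarrow> fpoly \<Rightarrow> fpoly" where
  "fdrop m p = filter (\<lambda>t. snd t \<noteq> m) p"

text \<open>The terms at the least common multiple cancel in value, though not as expressions, and are deleted. If
  the leading monomial of \<open>q\<close> divides that of \<open>p\<close>, this is at the same time a reduction step for \<open>p\<close>.\<close>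

definition spair :: "nat \<Rightarrow> fpoly \<Rightarrow> fpoly \<Rightarrow> fpoly" where
  "spair n p q = fdrop (mlcm (flm p) (flm q))
     (fscale (flc q) (flw n (word (mdiff (mlcm (flm p) (flm q)) (flm p))) p) @
      fscale (cneg (flc p)) (flw n (word (mdiff (mlcm (flm p) (flm q)) (flm q))) q))"

definition reducers :: "fpoly \<Rightarrow> fpoly list \<Rightarrow> fpoly list" where
  "reducers p G = filter (\<lambda>g. below (flm g) (flm p)) G"

definition todo :: "state \<Rightarrow> fpoly list" where
  "todo S = snd (snd (snd S))"

text \<open>A state consists of the coefficients assumed zero, those assumed nonzero, the basis, and the operators
  still to be treated.\<close>

definition step :: "nat \<Rightarrow> state \<Rightarrow> state list" where
  "step n S = (case S of (E, U, G, T) \<Rightarrow>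
     if T = [] then [S]
     else if hd T = [] then [(E, U, G, tl T)]
     else if reducers (hd T) G \<noteq> [] then [(E, U, G, spair n (hd T) (hd (reducers (hd T) G)) # tl T)]
     else [(flc (hd T) # E, U, G, fdrop (flm (hd T)) (hd T) # tl T),
           (E, flc (hd T) # U, hd T # G, map (spair n (hd T)) G @ tl T)])"

lemma step_cases:
  assumes "S' \<in> set (step n (E, U, G, p # T))"
  obtains (empty) "p = []" "S' = (E, U, G, T)"
  | (reduce) g where "p \<noteq> []" "g \<in> set G" "below (flm g) (flm p)" "S' = (E, U, G, spair n p g # T)"
  | (null) "p \<noteq> []" "S' = (flc p # E, U, G, fdrop (flm p) p # T)"
  | (new) "p \<noteq> []" "\<forall>g\<in>set G. \<not> below (flm g) (flm p)" "S' = (E, flc p # U, p # G, map (spair n p) G @ T)"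
proof (cases "reducers p G = []")
  case True
  then have "\<forall>g\<in>set G. \<not> below (flm g) (flm p)" by (auto simp: reducers_def filter_empty_conv)
  with True show ?thesis using assms empty null new by (auto simp: step_def split: if_splits)
next
  case False
  then have "hd (reducers p G) \<in> set (reducers p G)" by simp
  then have "hd (reducers p G) \<in> set G" "below (flm (hd (reducers p G))) (flm p)"
    by (auto simp: reducers_def)
  with False show ?thesis using assms empty reduce by (auto simp: step_def split: if_splits)
qed

subsection \<open>Well-formed data\<close>

definition var_ok :: "nat \<Rightarrow> nat \<Rightarrow> nat list \<Rightarrow> bool" where
  "var_ok n d v \<longleftrightarrow> length v = n \<and> sum_list v \<le> d"

definition form_of :: "nat \<Rightarrow> nat \<Rightarrow> int \<Rightarrow> fcoeff \<Rightarrow> bool" where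
  "form_of n d e c \<longleftrightarrow> (\<forall>t\<in>set c. int (length (snd t)) = e \<and> (\<forall>v\<in>set (snd t). var_ok n d v))"

text \<open>With \<open>t\<close> of degree \<open>- 1\<close> and the \<open>a_\<alpha>\<close> of degree \<open>1\<close>, the operator is homogeneous of degree \<open>e\<close>.
  Degrees are integers because multiplication by \<open>t\<close> lowers them.\<close>

definition graded :: "nat \<Rightarrow> nat \<Rightarrow> int \<Rightarrow> fpoly \<Rightarrow> bool" where
  "graded n d e p \<longleftrightarrow> (\<forall>t\<in>set p. snd t \<in> mon n \<and> form_of n d (e + int (snd t ! 0)) (fst t))"

lemma form_of_cneg: "form_of n d e c \<Longrightarrow> form_of n d e (cneg c)"
  by (auto simp: form_of_def cneg_def)

lemma form_of_cmul: "form_of n d e c \<Longrightarrow> form_of n d e' c' \<Longrightarrow> form_of n d (e + e') (cmul c c')"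
  by (fastforce simp: form_of_def cmul_def)

lemma graded_fscale: "form_of n d e c \<Longrightarrow> graded n d e' p \<Longrightarrow> graded n d (e + e') (fscale c p)"
  unfolding graded_def fscale_def using form_of_cmul[of n d e c] by (fastforce simp: add.assoc)

lemma graded_flop:
  assumes "graded n d e p" "i < 2 * n + 2"
  shows "graded n d (e - (if i = 0 then 1 else 0)) (flop n i p)"
  unfolding graded_def
proof
  fix t assume "t \<in> set (flop n i p)"
  then obtain s where s: "s \<in> set p" "t = (fst s, inc i (snd s)) \<or>
      kap n i (snd s) \<noteq> 0 \<and> t = (fst s, low n i (snd s))"
    by (auto simp: flop_def)
  have g: "snd s \<in> mon n" "form_of n d (e + int (snd s ! 0)) (fst s)"
    using assms s(1) by (auto simp: graded_def)
  then have len: "length (snd s) = 2 * n + 2" by (simp add: mon_def)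
  have "kap n i (snd s) \<noteq> 0 \<Longrightarrow> i \<noteq> 0 \<and> low n i (snd s) ! 0 = snd s ! 0"
    by (auto simp: kap_def low_def nth_list_update split: if_splits)
  then show "snd t \<in> mon n \<and> form_of n d (e - (if i = 0 then 1 else 0) + int (snd t ! 0)) (fst t)"
    using s(2) g len assms(2) by (auto simp: mon_def inc_def nth_list_update)
qed

lemma graded_flw:
  "graded n d e p \<Longrightarrow> set w \<subseteq> indices n \<Longrightarrow> graded n d (e - int (count (mset w) 0)) (flw n w p)"
proof (induction w)
  case (Cons i w)
  then have "graded n d (e - int (count (mset w) 0) - (if i = 0 then 1 else 0)) (flop n i (flw n w p))"
    by (intro graded_flop) auto
  then show ?case by (auto simp: flw_def algebra_simps split: if_splits)
qed (simp add: flw_def)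

lemma flm_Max: "p \<noteq> [] \<Longrightarrow> flm p = Max (snd ` set p)"
proof -
  have fold: "foldl max a xs = fold max xs a" for a and xs :: "nat list list"
    by (induction xs arbitrary: a) (simp_all add: max.commute)
  assume "p \<noteq> []"
  then obtain t p' where p: "p = t # p'" by (cases p) auto
  have "snd ` set p = set (snd t # map snd p')" by (simp add: p)
  then show ?thesis unfolding flm_def by (simp only: p list.sel fold Max.set_eq_fold)
qed

lemma flm_in: "p \<noteq> [] \<Longrightarrow> flm p \<in> snd ` set p"
  using Max_in[of "snd ` set p"] by (simp add: flm_Max)

lemma flm_ge: "t \<in> set p \<Longrightarrow> snd t \<le> flm p"
  using flm_Max[of p] by (cases "p = []") auto

lemma flm_less: "p \<noteq> [] \<Longrightarrow> \<forall>t\<in>set p. snd t < m \<Longrightarrow> flm p < m"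
  using flm_in[of p] by auto

lemma graded_flm: "graded n d e p \<Longrightarrow> p \<noteq> [] \<Longrightarrow> flm p \<in> mon n"
  using flm_in[of p] by (auto simp: graded_def)

lemma graded_flc: "graded n d e p \<Longrightarrow> form_of n d (e + int (flm p ! 0)) (flc p)"
  by (fastforce simp: graded_def flc_def form_of_def)

lemma graded_fdrop: "graded n d e p \<Longrightarrow> graded n d e (fdrop m p)"
  by (auto simp: graded_def fdrop_def)

lemma set_word_mdiff_lcm:
  assumes "m \<in> mon n" "m' \<in> mon n"
  shows "set (word (mdiff (mlcm m m') m)) \<subseteq> indices n" "set (word (mdiff (mlcm m m') m')) \<subseteq> indices n"
  using set_word[of "mdiff (mlcm m m') m"] set_word[of "mdiff (mlcm m m') m'"] assms
  by (auto simp: mon_def)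

text \<open>Both summands have the degree of \<open>p\<close> plus that of \<open>q\<close> plus the same correction for \<open>t\<close>: the degrees of
  the two leading coefficients compensate the different powers of \<open>t\<close> in the cofactors.\<close>

lemma graded_spair:
  assumes p: "graded n d e p" "p \<noteq> []" and q: "graded n d e' q" "q \<noteq> []"
  shows "\<exists>e. graded n d e (spair n p q)"
proof -
  let ?l = "mlcm (flm p) (flm q)"
  have m: "flm p \<in> mon n" "flm q \<in> mon n" using graded_flm assms by blast+
  then have "count (mset (word (mdiff ?l (flm p)))) 0 = ?l ! 0 - flm p ! 0"
    "count (mset (word (mdiff ?l (flm q)))) 0 = ?l ! 0 - flm q ! 0"
    by (simp_all add: count_word mon_def mdiff_def del: upt.simps)
  moreover have "flm p ! 0 \<le> ?l ! 0" "flm q ! 0 \<le> ?l ! 0" 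
    using m by (simp_all add: mlcm_def mon_def del: upt_Suc)
  ultimately have 1: "e - int (count (mset (word (mdiff ?l (flm p)))) 0) = e + int (flm p ! 0) - int (?l ! 0)"
    and 2: "e' - int (count (mset (word (mdiff ?l (flm q)))) 0) = e' + int (flm q ! 0) - int (?l ! 0)"
    by auto
  have "graded n d ((e' + int (flm q ! 0)) + (e + int (flm p ! 0) - int (?l ! 0)))
      (fscale (flc q) (flw n (word (mdiff ?l (flm p))) p))"
    using graded_fscale[OF graded_flc[OF q(1)] graded_flw[OF p(1) set_word_mdiff_lcm(1)[OF m]]] 1 by simp
  moreover have "graded n d ((e + int (flm p ! 0)) + (e' + int (flm q ! 0) - int (?l ! 0)))
      (fscale (cneg (flc p)) (flw n (word (mdiff ?l (flm q))) q))"
    using graded_fscale[OF form_of_cneg[OF graded_flc[OF p(1)]] graded_flw[OF q(1) set_word_mdiff_lcm(2)[OF m]]] 2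
    by simp
  ultimately have "graded n d (e + e' + int (flm p ! 0) + int (flm q ! 0) - int (?l ! 0)) (spair n p q)"
    unfolding spair_def by (intro graded_fdrop) (auto simp: graded_def algebra_simps)
  then show ?thesis by blast
qed

lemma flop_bound:
  assumes "\<forall>t\<in>set p. snd t \<in> mon n \<and> snd t \<le> m" "m \<in> mon n" "i \<in> indices n"
  shows "\<forall>t\<in>set (flop n i p). snd t \<in> mon n \<and> snd t \<le> inc i m"
proof
  fix t assume "t \<in> set (flop n i p)"
  then obtain s where s: "s \<in> set p" "snd t = inc i (snd s) \<or> snd t = low n i (snd s)"
    by (auto simp: flop_def)
  have "low n i (snd s) < inc i (snd s)" "inc i (snd s) \<le> inc i m"
    using assms s by (auto simp: mon_def intro!: low_less_inc inc_mono_le)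
  then show "snd t \<in> mon n \<and> snd t \<le> inc i m" using s assms by (auto simp: mon_def)
qed

lemma flw_bound:
  assumes "\<forall>t\<in>set p. snd t \<in> mon n \<and> snd t \<le> m" "m \<in> mon n" "set w \<subseteq> indices n"
  shows "\<forall>t\<in>set (flw n w p). snd t \<in> mon n \<and> snd t \<le> incs w m"
  using assms(3)
proof (induction w)
  case (Cons i w)
  have "incs w m \<in> mon n" using assms(2) by (simp add: mon_def)
  with Cons show ?case using flop_bound[of "flw n w p" n "incs w m" i] by (auto simp: flw_def)
qed (use assms in \<open>auto simp: flw_def\<close>)

lemma spair_less:
  assumes p: "graded n d e p" "p \<noteq> []" and q: "graded n d e' q" "q \<noteq> []"
  shows "\<forall>t\<in>set (spair n p q). snd t < mlcm (flm p) (flm q)"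
proof -
  have m: "flm p \<in> mon n" "flm q \<in> mon n" using graded_flm assms by blast+
  then have len: "length (flm p) = length (flm q)" by (simp add: mon_def)
  have "\<forall>t\<in>set (flw n (word (mdiff (mlcm (flm p) (flm q)) (flm p))) p). snd t \<le> mlcm (flm p) (flm q)"
    using flw_bound[OF _ m(1) set_word_mdiff_lcm(1)[OF m], of p] p flm_ge incs_word_lcm[OF len]
    by (auto simp: graded_def)
  moreover have "\<forall>t\<in>set (flw n (word (mdiff (mlcm (flm p) (flm q)) (flm q))) q). snd t \<le> mlcm (flm p) (flm q)"
    using flw_bound[OF _ m(2) set_word_mdiff_lcm(2)[OF m], of q] q flm_ge incs_word_lcm[OF len]
    by (auto simp: graded_def)
  ultimately show ?thesis by (auto simp: spair_def fdrop_def fscale_def le_less)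
qed

lemma flm_spair: "graded n d e p \<Longrightarrow> p \<noteq> [] \<Longrightarrow> graded n d e' q \<Longrightarrow> q \<noteq> [] \<Longrightarrow> spair n p q \<noteq> [] \<Longrightarrow>
    flm (spair n p q) < mlcm (flm p) (flm q)"
  using flm_less[OF _ spair_less] by blast

lemma mlcm_below: "below m' m \<Longrightarrow> mlcm m m' = m"
  by (auto simp: mlcm_def list_all2_conv_all_nth intro!: nth_equalityI)

lemma flm_fdrop: "fdrop (flm p) p \<noteq> [] \<Longrightarrow> flm (fdrop (flm p) p) < flm p"
  using flm_ge[of _ p] by (intro flm_less) (auto simp: fdrop_def less_le)

definition polys_ok :: "nat \<Rightarrow> nat \<Rightarrow> fpoly list \<Rightarrow> bool" where
  "polys_ok n d P \<longleftrightarrow> (\<forall>p\<in>set P. \<exists>e. graded n d e p)"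

definition state_ok :: "nat \<Rightarrow> nat \<Rightarrow> state \<Rightarrow> bool" where
  "state_ok n d S = (case S of (E, U, G, T) \<Rightarrow> polys_ok n d G \<and> polys_ok n d T \<and> [] \<notin> set G \<and>
     (\<forall>c\<in>set E \<union> set U. \<exists>e. form_of n d e c))"

lemma state_ok_step:
  assumes "state_ok n d S" "S' \<in> set (step n S)"
  shows "state_ok n d S'"
proof -
  obtain E U G T where S: "S = (E, U, G, T)" by (cases S)
  show ?thesis
  proof (cases T)
    case Nil
    with assms S show ?thesis by (simp add: step_def)
  next
    case (Cons p T')
    have ok: "\<exists>e. graded n d e p" "\<And>g. g \<in> set G \<Longrightarrow> g \<noteq> [] \<and> (\<exists>e. graded n d e g)"
      "polys_ok n d T'" "polys_ok n d G" "[] \<notin> set G" "\<forall>c\<in>set E \<union> set U. \<exists>e. form_of n d e c"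
      using assms(1) S Cons by (auto simp: state_ok_def polys_ok_def)
    have sp: "\<exists>e. graded n d e (spair n p g)" if "p \<noteq> []" "g \<in> set G" for g
      using graded_spair ok(1) ok(2)[OF that(2)] that(1) by blast
    have lc: "\<exists>e. form_of n d e (flc p)" using graded_flc ok(1) by blast
    have dr: "\<exists>e. graded n d e (fdrop (flm p) p)" using graded_fdrop ok(1) by blast
    from assms(2)[unfolded S Cons] show ?thesis
      by (cases rule: step_cases) (use ok sp lc dr in \<open>auto simp: state_ok_def polys_ok_def\<close>)
  qed
qed

subsection \<open>Termination\<close>

definition expand :: "nat \<Rightarrow> state list \<Rightarrow> state list" where
  "expand n Ss = concat (map (step n) Ss)"

definition finished :: "state list \<Rightarrow> bool" where
  "finished Ss = list_all (\<lambda>S. todo S = []) Ss"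

lemma expand_append: "(expand n ^^ t) (A @ B) = (expand n ^^ t) A @ (expand n ^^ t) B"
  by (induction t) (auto simp: expand_def)

lemma expand_finished: "finished Ss \<Longrightarrow> expand n Ss = Ss"
  unfolding finished_def expand_def
  by (induction Ss) (auto simp: step_def todo_def)

lemma finished_mono:
  assumes "finished ((expand n ^^ t) Ss)" "t \<le> t'"
  shows "finished ((expand n ^^ t') Ss)"
  using assms(2)
proof (induction t' rule: dec_induct)
  case (step k)
  then show ?case using expand_finished by simp
qed (use assms in simp)

definition halts :: "nat \<Rightarrow> state \<Rightarrow> bool" where
  "halts n S \<longleftrightarrow> (\<exists>t. finished ((expand n ^^ t) [S]))"

lemma halts_list: "\<forall>S\<in>set Ss. halts n S \<Longrightarrow> \<exists>t. finished ((expand n ^^ t) Ss)"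
proof (induction Ss)
  case Nil
  show ?case by (intro exI[of _ 0]) (simp add: finished_def)
next
  case (Cons S Ss)
  then obtain t t' where "finished ((expand n ^^ t) [S])" "finished ((expand n ^^ t') Ss)"
    by (auto simp: halts_def)
  then have "finished ((expand n ^^ max t t') [S])" "finished ((expand n ^^ max t t') Ss)"
    using finished_mono by (metis max.cobounded1 max.cobounded2)+
  then show ?case
    using expand_append[where A = "[S]" and B = Ss and n = n and t = "max t t'"]
    by (intro exI[of _ "max t t'"]) (simp add: finished_def)
qed

lemma halts_step: "\<forall>S'\<in>set (step n S). halts n S' \<Longrightarrow> halts n S"
proof -
  assume "\<forall>S'\<in>set (step n S). halts n S'"
  from halts_list[OF this] obtain t where "finished ((expand n ^^ t) (step n S))" by blast
  moreover have "(expand n ^^ Suc t) [S] = (expand n ^^ t) (step n S)"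
    by (simp add: funpow_Suc_right expand_def del: funpow.simps)
  ultimately show ?thesis unfolding halts_def by metis
qed

text \<open>The descent is lexicographic. The leading monomials of the basis grow only as in \<open>wf_dickson\<close>; while they stay
  the same, the list \<open>T\<close> becomes shorter, or its head becomes empty or gets a smaller leading monomial. The values of
  the coefficients do not enter.\<close>

lemma halts_state:
  assumes "polys_ok n d G" "[] \<notin> set G" "polys_ok n d T"
  shows "halts n (E, U, G, T)"
  using assms
proof (induction "map flm G" arbitrary: E U G T
    rule: wf_induct_rule[OF wf_dickson[of "2 * n + 2"]])
  case (1 G)
  note outer = "1.hyps" and G = "1.prems"(1,2)
  show ?case
    using "1.prems"(3)
  proof (induction T arbitrary: E U)
    case Nil
    show ?case unfolding halts_def by (intro exI[of _ 0]) (simp add: finished_def todo_def)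
  next
    case (Cons p T)
    have T: "polys_ok n d T" using Cons.prems by (simp add: polys_ok_def)
    have empty: "halts n (E, U, G, [] # T)" for E U
      using Cons.IH[OF T] by (intro halts_step) (simp add: step_def)
    have "\<exists>e. graded n d e p" using Cons.prems by (simp add: polys_ok_def)
    then show ?case
    proof (induction "flm p" arbitrary: p E U rule: wf_induct_rule[OF wf_monomial])
      case (1 p)
      then obtain e where p: "graded n d e p" by blast
      show ?case
      proof (rule halts_step, rule ballI)
        fix S' assume "S' \<in> set (step n (E, U, G, p # T))"
        then show "halts n S'"
        proof (cases rule: step_cases)
          case empty
          then show ?thesis using Cons.IH[OF T] by simp
        next
          case (reduce g)
          obtain e' where g: "graded n d e' g" "g \<noteq> []" using reduce G by (auto simp: polys_ok_def)
          show ?thesis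
          proof (cases "spair n p g = []")
            case True
            with reduce empty show ?thesis by simp
          next
            case False
            obtain e'' where e'': "graded n d e'' (spair n p g)" using graded_spair[OF p reduce(1) g] by blast
            have "flm (spair n p g) < flm p"
              using flm_spair[OF p reduce(1) g False] mlcm_below[OF reduce(3)] by simp
            moreover have "length (flm (spair n p g)) = length (flm p)"
              using graded_flm[OF e'' False] graded_flm[OF p reduce(1)] by (simp add: mon_def)
            ultimately show ?thesis using "1.hyps" e'' reduce by blast
          qed
        next
          case null
          show ?thesis
          proof (cases "fdrop (flm p) p = []")
            case True
            with null empty show ?thesis by simp
          next
            case False
            have g: "graded n d e (fdrop (flm p) p)" using p by (rule graded_fdrop)
            have "length (flm (fdrop (flm p) p)) = length (flm p)"
              using graded_flm[OF g False] graded_flm[OF p null(1)] by (simp add: mon_def)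
            then show ?thesis using "1.hyps" g flm_fdrop[OF False] null by blast
          qed
        next
          case new
          have "length (flm p) = 2 * n + 2" using graded_flm[OF p new(1)] by (simp add: mon_def)
          moreover have "polys_ok n d (map (spair n p) G @ T)"
            using graded_spair[OF p new(1)] G T by (fastforce simp: polys_ok_def)
          ultimately show ?thesis
            unfolding new(3) using new(1,2) p G by (intro outer) (auto simp: polys_ok_def)
        qed
      qed
    qed
  qed
qed

subsection \<open>Values at a point\<close>

definition cval :: "(nat list \<Rightarrow> 'k::comm_ring_1) \<Rightarrow> fcoeff \<Rightarrow> 'k" where
  "cval e c = (\<Sum>t\<leftarrow>c. (if fst t then 1 else - 1) * prod_list (map e (snd t)))"

definition fval :: "(nat list \<Rightarrow> 'k::comm_ring_1) \<Rightarrow> fpoly \<Rightarrow> 'k vec" where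
  "fval e p = (\<Sum>t\<leftarrow>p. Poly_Mapping.single (snd t) (cval e (fst t)))"

lemma cval_simps [simp]: "cval e [] = 0" "cval e (c @ c') = cval e c + cval e c'"
  by (simp_all add: cval_def)

lemma cval_concat: "cval e (concat cs) = (\<Sum>c\<leftarrow>cs. cval e c)"
  by (induction cs) auto

lemma cval_cneg: "cval e (cneg c) = - cval e c"
  by (induction c) (auto simp: cval_def cneg_def)

lemma cval_cmul: "cval e (cmul c c') = cval e c * cval e c'"
proof -
  have "cval e (map (\<lambda>t'. (fst t = fst t', snd t @ snd t')) c') =
      (if fst t then 1 else - 1) * prod_list (map e (snd t)) * cval e c'" for t
    by (induction c') (auto simp: cval_def algebra_simps)
  then have "cval e (cmul c c') = (\<Sum>t\<leftarrow>c. (if fst t then 1 else - 1) * prod_list (map e (snd t)) * cval e c')"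
    by (simp add: cmul_def cval_concat o_def)
  then show ?thesis by (simp only: sum_list_mult_const cval_def)
qed

lemma fval_simps [simp]: "fval e [] = 0" "fval e (p @ q) = fval e p + fval e q"
  "fval e (t # p) = Poly_Mapping.single (snd t) (cval e (fst t)) + fval e p"
  by (simp_all add: fval_def)

lemma fval_fscale: "fval e (fscale c p) = scl (cval e c) (fval e p)"
  by (induction p) (auto simp: fscale_def cval_cmul scl_add)

lemma fval_replicate: "fval e (replicate k t) = Poly_Mapping.single (snd t) (of_nat k * cval e (fst t))"
  by (induction k) (auto simp: algebra_simps simp flip: single_add)

lemma fval_flop: "fval e (flop n i p) = lop n i (fval e p)"
  by (induction p) (auto simp: flop_def lop_add lop_single fval_replicate)

lemma fval_flw: "fval e (flw n w p) = lw n w (fval e p)"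
  by (induction w) (auto simp: flw_def fval_flop)

lemma lookup_fval: "lookup (fval e p) m = (\<Sum>t\<leftarrow>filter (\<lambda>t. snd t = m) p. cval e (fst t))"
  by (induction p) (auto simp: lookup_add lookup_single when_def)

lemma lookup_fval_flm: "lookup (fval e p) (flm p) = cval e (flc p)"
  by (simp add: lookup_fval flc_def cval_concat o_def)

lemma keys_fval: "keys (fval e p) \<subseteq> snd ` set p"
proof
  fix m assume "m \<in> keys (fval e p)"
  then have "filter (\<lambda>t. snd t = m) p \<noteq> []" by (auto simp: lookup_fval in_keys_iff)
  then show "m \<in> snd ` set p" by (auto simp: filter_empty_conv)
qed

lemma lookup_fval_fdrop: "lookup (fval e (fdrop m p)) k = (if k = m then 0 else lookup (fval e p) k)"
  by (induction p) (auto simp: fdrop_def lookup_add lookup_single when_def)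

lemma fval_fdrop: "lookup (fval e p) m = 0 \<Longrightarrow> fval e (fdrop m p) = fval e p"
  by (rule poly_mapping_eqI) (simp add: lookup_fval_fdrop)

lemma bounded_fval: "graded n d g p \<Longrightarrow> p \<noteq> [] \<Longrightarrow> bounded n (fval e p) (flm p)"
  unfolding bounded_def using keys_fval[of e p] flm_ge[of _ p] graded_flm[of n d g p]
  by (fastforce simp: graded_def)

text \<open>The deletion of the terms at the least common multiple does not change the value.\<close>

lemma fval_spair:
  assumes p: "graded n d g p" "p \<noteq> []" and q: "graded n d g' q" "q \<noteq> []"
  shows "fval e (spair n p q) =
    scl (cval e (flc q)) (lw n (word (mdiff (mlcm (flm p) (flm q)) (flm p))) (fval e p)) -
    scl (cval e (flc p)) (lw n (word (mdiff (mlcm (flm p) (flm q)) (flm q))) (fval e q))" (is "_ = ?rhs")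
proof -
  let ?l = "mlcm (flm p) (flm q)"
  let ?s = "fscale (flc q) (flw n (word (mdiff ?l (flm p))) p) @
      fscale (cneg (flc p)) (flw n (word (mdiff ?l (flm q))) q)"
  have m: "flm p \<in> mon n" "flm q \<in> mon n" using graded_flm assms by blast+
  then have len: "length (flm p) = length (flm q)" by (simp add: mon_def)
  have s: "fval e ?s = ?rhs"
    by (simp add: fval_fscale fval_flw cval_cneg poly_mapping_eqI lookup_add lookup_minus)
  have "lookup (lw n (word (mdiff ?l (flm p))) (fval e p)) ?l = cval e (flc p)"
    "lookup (lw n (word (mdiff ?l (flm q))) (fval e q)) ?l = cval e (flc q)"
    using bounded_lw_lookup[OF bounded_fval[OF p] set_word_mdiff_lcm(1)[OF m], of e]
      bounded_lw_lookup[OF bounded_fval[OF q] set_word_mdiff_lcm(2)[OF m], of e]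
    by (simp_all add: incs_word_lcm[OF len] lookup_fval_flm)
  then have "lookup (fval e ?s) ?l = 0"
    unfolding s by (simp add: lookup_minus mult.commute)
  then show ?thesis unfolding spair_def using fval_fdrop s by metis
qed

definition gen_span :: "nat \<Rightarrow> 'k::field vec set \<Rightarrow> 'k vec set" where
  "gen_span n X = vec.span {lw n w v | w v. v \<in> X \<and> set w \<subseteq> indices n}"

lemma gen_span_base: "v \<in> X \<Longrightarrow> v \<in> gen_span n X"
  unfolding gen_span_def by (rule vec.span_base) (auto intro!: exI[of _ "[]"] exI[of _ v])

lemma gen_span_lw:
  assumes "y \<in> gen_span n X" "set u \<subseteq> indices n"
  shows "lw n u y \<in> gen_span n X"
  using assms(1) unfolding gen_span_def
proof (induction rule: vec.span_induct_alt)
  case base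
  then show ?case by (simp add: vec.span_zero)
next
  case (step c x y)
  then obtain w v where w: "x = lw n w v" "v \<in> X" "set w \<subseteq> indices n" by auto
  have "lw n u x \<in> {lw n w v | w v. v \<in> X \<and> set w \<subseteq> indices n}"
    using w assms(2) by (intro CollectI exI[of _ "u @ w"] exI[of _ v]) (auto simp: lw_append)
  with step show ?case
    by (simp add: lw_add lw_scl vec.span_add vec.span_scale vec.span_base)
qed

lemma gen_span_le:
  assumes "X \<subseteq> gen_span n Y"
  shows "gen_span n X \<subseteq> gen_span n Y"
proof -
  have "{lw n w v | w v. v \<in> X \<and> set w \<subseteq> indices n} \<subseteq> gen_span n Y"
    using assms gen_span_lw by blast
  then show ?thesis
    unfolding gen_span_def[of n X] by (rule vec.span_minimal) (simp add: gen_span_def)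
qed

lemma gen_span_mono: "X \<subseteq> Y \<Longrightarrow> gen_span n X \<subseteq> gen_span n Y"
  by (rule gen_span_le) (auto intro: gen_span_base)

lemma gen_span_0: "0 \<in> gen_span n X"
  unfolding gen_span_def by (rule vec.span_zero)

lemma gen_span_add: "x \<in> gen_span n X \<Longrightarrow> y \<in> gen_span n X \<Longrightarrow> x + y \<in> gen_span n X"
  and gen_span_diff: "x \<in> gen_span n X \<Longrightarrow> y \<in> gen_span n X \<Longrightarrow> x - y \<in> gen_span n X"
  and gen_span_scale: "x \<in> gen_span n X \<Longrightarrow> scl c x \<in> gen_span n X"
  unfolding gen_span_def by (auto intro: vec.span_add vec.span_diff vec.span_scale)

text \<open>Below a bound \<open>M\<close>, elements of the list \<open>T\<close> still to be treated count with the trivial word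
  only. In this form the span survives all steps of the algorithm.\<close>

definition bspan :: "nat \<Rightarrow> (nat list \<Rightarrow> 'k::field) \<Rightarrow> fpoly list \<Rightarrow> fpoly list \<Rightarrow> nat list \<Rightarrow> 'k vec set" where
  "bspan n e G T M = vec.span
     ({lw n w (fval e g) | w g. g \<in> set G \<and> set w \<subseteq> indices n \<and> incs w (flm g) < M} \<union>
      {fval e p | p. p \<in> set T \<and> p \<noteq> [] \<and> flm p < M})"

lemma bspan_word: "g \<in> set G \<Longrightarrow> set w \<subseteq> indices n \<Longrightarrow> incs w (flm g) < M \<Longrightarrow> lw n w (fval e g) \<in> bspan n e G T M"
  unfolding bspan_def by (rule vec.span_base) blast

lemma bspan_todo: "p \<in> set T \<Longrightarrow> p \<noteq> [] \<Longrightarrow> flm p < M \<Longrightarrow> fval e p \<in> bspan n e G T M"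
  unfolding bspan_def by (rule vec.span_base) blast

lemma bspan_le:
  assumes "set G \<subseteq> set G'"
    and "\<And>p. p \<in> set T \<Longrightarrow> p \<noteq> [] \<Longrightarrow> flm p < M \<Longrightarrow> fval e p \<in> bspan n e G' T' M"
  shows "bspan n e G T M \<subseteq> bspan n e G' T' M"
proof -
  have "{lw n w (fval e g) | w g. g \<in> set G \<and> set w \<subseteq> indices n \<and> incs w (flm g) < M} \<union>
      {fval e p | p. p \<in> set T \<and> p \<noteq> [] \<and> flm p < M} \<subseteq> bspan n e G' T' M"
    using assms bspan_word[of _ G'] by blast
  then show ?thesis
    unfolding bspan_def[of n e G T M] by (rule vec.span_minimal) (simp add: bspan_def)
qed

lemma bspan_closed: "0 \<in> bspan n e G T M" "x \<in> bspan n e G T M \<Longrightarrow> y \<in> bspan n e G T M \<Longrightarrow> x + y \<in> bspan n e G T M"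
  "x \<in> bspan n e G T M \<Longrightarrow> scl c x \<in> bspan n e G T M" "x \<in> bspan n e G T M \<Longrightarrow> - x \<in> bspan n e G T M"
  unfolding bspan_def by (auto intro: vec.span_add vec.span_scale vec.span_zero vec.span_neg)

text \<open>The predicate \<open>Z\<close> tells which coefficients vanish. It is used both for the values at a rational point and
  for membership in a prime ideal.\<close>

definition satisfies :: "(fcoeff \<Rightarrow> bool) \<Rightarrow> state \<Rightarrow> bool" where
  "satisfies Z S = (case S of (E, U, G, T) \<Rightarrow> (\<forall>c\<in>set E. Z c) \<and> (\<forall>c\<in>set U. \<not> Z c))"

text \<open>The invariant at a point: leading coefficients of basis elements do not vanish, the left ideal generated
  is the given one, and the S-pairs of the basis have a representation below the least common
  multiple, in which elements still to be treated may occur. When nothing is left to be treated, this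
  is the hypothesis of \<open>elimination\<close>.\<close>

definition correct_at :: "nat \<Rightarrow> (nat list \<Rightarrow> 'k::field) \<Rightarrow> 'k vec set \<Rightarrow> state \<Rightarrow> bool" where
  "correct_at n e I S = (case S of (E, U, G, T) \<Rightarrow>
     (\<forall>g\<in>set G. cval e (flc g) \<noteq> 0) \<and> gen_span n (fval e ` (set G \<union> set T)) = I \<and>
     (\<forall>p\<in>set G. \<forall>q\<in>set G. fval e (spair n p q) \<in> bspan n e G T (mlcm (flm p) (flm q))))"

lemma satisfies_step:
  assumes "satisfies Z S"
  shows "\<exists>S'\<in>set (step n S). satisfies Z S'"
proof -
  obtain E U G T where S: "S = (E, U, G, T)" by (cases S)
  with assms show ?thesis by (auto simp: step_def satisfies_def)
qed

lemma satisfies_step_back: "S' \<in> set (step n S) \<Longrightarrow> satisfies Z S' \<Longrightarrow> satisfies Z S"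
  by (cases S) (auto simp: step_def satisfies_def split: if_splits)

text \<open>The first element \<open>p\<close> still to be treated may be replaced by a smaller \<open>p'\<close> that differs from a multiple
  of \<open>p\<close> by an element of the basis ideal. This covers reductions and the deletion of vanishing
  leading terms.\<close>

lemma correct_replace:
  assumes "correct_at n e I (E, U, G, p # T)"
    and p: "fval e p = scl a (fval e p') + b" "fval e p' = scl c (fval e p) + b'"
    and gen: "b \<in> gen_span n (fval e ` set G)" "b' \<in> gen_span n (fval e ` set G)"
    and bspan: "\<And>M. flm p < M \<Longrightarrow> p \<noteq> [] \<Longrightarrow> b \<in> bspan n e G (p' # T) M"
    and less: "p' \<noteq> [] \<Longrightarrow> p \<noteq> [] \<Longrightarrow> flm p' < flm p"
  shows "correct_at n e I (E', U', G, p' # T)"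
proof -
  have *: "gen_span n (fval e ` set G) \<subseteq> gen_span n (fval e ` (set G \<union> set (q # T)))" for q
    by (intro gen_span_mono) auto
  have "gen_span n (fval e ` (set G \<union> set (p # T))) = gen_span n (fval e ` (set G \<union> set (p' # T)))"
  proof -
    have "fval e p \<in> gen_span n (fval e ` (set G \<union> set (p' # T)))"
      using *[of p'] gen unfolding p(1)
      by (intro gen_span_add gen_span_scale gen_span_base[of "fval e p'"]) auto
    moreover have "fval e p' \<in> gen_span n (fval e ` (set G \<union> set (p # T)))"
      using *[of p] gen unfolding p(2)
      by (intro gen_span_add gen_span_scale gen_span_base[of "fval e p"]) auto
    ultimately show ?thesis
      by (intro antisym gen_span_le) (auto intro: gen_span_base)
  qed
  moreover have "bspan n e G (p # T) M \<subseteq> bspan n e G (p' # T) M" for M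
  proof (rule bspan_le)
    fix q assume q: "q \<in> set (p # T)" "q \<noteq> []" "flm q < M"
    show "fval e q \<in> bspan n e G (p' # T) M"
    proof (cases "q = p")
      case True
      have "fval e p' \<in> bspan n e G (p' # T) M"
        using less q True by (cases "p' = []") (auto intro: bspan_closed bspan_todo)
      with bspan q True show ?thesis unfolding True p(1) by (auto intro!: bspan_closed)
    next
      case False
      with q show ?thesis by (auto intro: bspan_todo)
    qed
  qed simp
  ultimately show ?thesis using assms(1) by (fastforce simp: correct_at_def)
qed

lemma correct_step:
  assumes ok: "state_ok n d S" and correct: "correct_at n e I S"
    and S': "S' \<in> set (step n S)" "satisfies (\<lambda>c. cval e c = 0) S'"
  shows "correct_at n e I S'"
proof -
  obtain E U G T where S: "S = (E, U, G, T)" by (cases S)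
  show ?thesis
  proof (cases T)
    case Nil
    with assms S show ?thesis by (simp add: step_def)
  next
    case (Cons p T')
    have p: "\<exists>g. graded n d g p" and G: "\<And>g. g \<in> set G \<Longrightarrow> g \<noteq> [] \<and> (\<exists>e. graded n d e g)"
      using ok S Cons by (auto simp: state_ok_def polys_ok_def)
    have correct': "correct_at n e I (E, U, G, p # T')" using correct S Cons by simp
    from S'(1)[unfolded S Cons] show ?thesis
    proof (cases rule: step_cases)
      case empty
      have "gen_span n (fval e ` (set G \<union> set (p # T'))) = gen_span n (fval e ` (set G \<union> set T'))"
        using empty by (intro antisym gen_span_le) (auto intro: gen_span_base gen_span_0)
      moreover have "bspan n e G (p # T') M = bspan n e G T' M" for M
        using empty unfolding bspan_def by (intro arg_cong[of _ _ vec.span]) auto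
      ultimately show ?thesis using correct' empty by (auto simp: correct_at_def)
    next
      case (reduce g)
      obtain d1 d2 where gr: "graded n d d1 p" "graded n d d2 g" "g \<noteq> []" using p G reduce by blast
      have m: "flm p \<in> mon n" "flm g \<in> mon n" using graded_flm gr reduce by blast+
      have lcm: "mlcm (flm p) (flm g) = flm p" using reduce by (simp add: mlcm_below)
      let ?w = "word (mdiff (flm p) (flm g))"
      have w: "set ?w \<subseteq> indices n" "incs ?w (flm g) = flm p"
        using set_word_mdiff_lcm(2)[OF m] incs_word_mdiff[OF reduce(3)] lcm by auto
      have "word (mdiff (flm p) (flm p)) = []"
        using mset_eq_incs[of "word (mdiff (flm p) (flm p))" "flm p" "[]"] set_word_mdiff_lcm(1)[OF m] lcm m
          incs_word_mdiff[of "flm p" "flm p"] by (auto simp: mon_def list_all2_refl)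
      then have val: "fval e (spair n p g) =
          scl (cval e (flc g)) (fval e p) - scl (cval e (flc p)) (lw n ?w (fval e g))"
        using fval_spair[OF gr(1) reduce(1) gr(2,3), of e] lcm by simp
      have nz: "cval e (flc g) \<noteq> 0" using correct' reduce by (auto simp: correct_at_def)
      have gen: "lw n ?w (fval e g) \<in> gen_span n (fval e ` set G)"
        using w reduce by (intro gen_span_lw gen_span_base) auto
      show ?thesis
        unfolding reduce(4)
      proof (rule correct_replace[OF correct'])
        let ?i = "inverse (cval e (flc g))"
        show "fval e p = scl ?i (fval e (spair n p g)) + scl (?i * cval e (flc p)) (lw n ?w (fval e g))"
          using nz by (auto simp: val lookup_add lookup_minus algebra_simps intro!: poly_mapping_eqI)
        show "fval e (spair n p g) = scl (cval e (flc g)) (fval e p) + scl (- cval e (flc p)) (lw n ?w (fval e g))"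
          unfolding val by (auto simp: lookup_add lookup_minus intro!: poly_mapping_eqI)
        show "flm (spair n p g) < flm p" if "spair n p g \<noteq> []"
          using flm_spair[OF gr(1) reduce(1) gr(2,3) that] lcm by simp
        show "scl (?i * cval e (flc p)) (lw n ?w (fval e g)) \<in> bspan n e G (spair n p g # T') M"
          if "flm p < M" for M
          using w reduce that by (intro bspan_closed bspan_word) auto
      qed (rule gen_span_scale[OF gen])+
    next
      case null
      have "cval e (flc p) = 0" using S'(2) null by (auto simp: satisfies_def)
      then have val: "fval e (fdrop (flm p) p) = fval e p"
        by (intro fval_fdrop) (simp add: lookup_fval_flm)
      show ?thesis
        unfolding null(2)
        by (rule correct_replace[OF correct', where a = 1 and b = 0 and c = 1 and b' = 0])
          (auto simp: val flm_fdrop bspan_closed gen_span_0)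
    next
      case new
      obtain d1 where p': "graded n d d1 p" using p by blast
      have nz: "cval e (flc p) \<noteq> 0" using S'(2) new by (auto simp: satisfies_def)
      let ?T = "map (spair n p) G @ T'"
      have sp: "fval e (spair n p g) \<in> gen_span n (fval e ` (set G \<union> set (p # T')))" if gG: "g \<in> set G" for g
      proof -
        obtain d2 where g: "graded n d d2 g" "g \<noteq> []" using G[OF gG] by blast
        have m: "flm p \<in> mon n" "flm g \<in> mon n" using graded_flm p' new g by blast+
        show ?thesis
          unfolding fval_spair[OF p' new(1) g]
          using gG set_word_mdiff_lcm[OF m]
          by (intro gen_span_diff gen_span_scale gen_span_lw gen_span_base) auto
      qed
      have "gen_span n (fval e ` (set (p # G) \<union> set ?T)) = gen_span n (fval e ` (set G \<union> set (p # T')))"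
        using sp by (intro antisym gen_span_le) (auto intro: gen_span_base)
      moreover have mono: "bspan n e G (p # T') M \<subseteq> bspan n e (p # G) ?T M" for M
      proof (rule bspan_le)
        fix q assume q: "q \<in> set (p # T')" "q \<noteq> []" "flm q < M"
        show "fval e q \<in> bspan n e (p # G) ?T M"
          using q bspan_word[of p "p # G" "[]" n M e ?T] by (auto intro: bspan_todo)
      qed auto
      have pg: "fval e (spair n p g) \<in> bspan n e (p # G) ?T (mlcm (flm p) (flm g))" if gG: "g \<in> set G" for g
      proof (cases "spair n p g = []")
        case True
        then show ?thesis by (simp add: bspan_closed)
      next
        case False
        obtain d2 where g: "graded n d d2 g" "g \<noteq> []" using G[OF gG] by blast
        show ?thesis
          using flm_spair[OF p' new(1) g False] False gG by (intro bspan_todo) auto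
      qed
      have swap: "fval e (spair n q q') = - fval e (spair n q' q)"
        if qq: "q \<in> set (p # G)" "q' \<in> set (p # G)" for q q'
      proof -
        obtain d1 d2 where g: "graded n d d1 q" "q \<noteq> []" "graded n d d2 q'" "q' \<noteq> []"
          using G p' new(1) qq by (metis set_ConsD)
        have "flm q \<in> mon n" "flm q' \<in> mon n" using graded_flm g by blast+
        then have "mlcm (flm q) (flm q') = mlcm (flm q') (flm q)"
          by (intro mlcm_commute) (simp add: mon_def)
        then show ?thesis using fval_spair[OF g, of e] fval_spair[OF g(3,4,1,2), of e] by simp
      qed
      have pp: "fval e (spair n p p) = 0" using fval_spair[OF p' new(1) p' new(1), of e] by simp
      have "fval e (spair n q q') \<in> bspan n e (p # G) ?T (mlcm (flm q) (flm q'))"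
        if q: "q \<in> set (p # G)" "q' \<in> set (p # G)" for q q'
      proof -
        consider "q = p" "q' = p" | "q = p" "q' \<in> set G" | "q \<in> set G" "q' = p" | "q \<in> set G" "q' \<in> set G"
          using q by auto
        then show ?thesis
        proof cases
          case 1
          then show ?thesis by (simp add: pp bspan_closed)
        next
          case 2
          then show ?thesis using pg by simp
        next
          case 3
          have "flm q \<in> mon n" "flm p \<in> mon n" using graded_flm G[OF 3(1)] p' new(1) by blast+
          then have "mlcm (flm q) (flm p) = mlcm (flm p) (flm q)"
            by (intro mlcm_commute) (simp add: mon_def)
          then show ?thesis using pg[OF 3(1)] swap[OF q] 3 by (simp add: bspan_closed)
        next
          case 4
          then have "fval e (spair n q q') \<in> bspan n e G (p # T') (mlcm (flm q) (flm q'))"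
            using correct' by (auto simp: correct_at_def)
          then show ?thesis using mono by blast
        qed
      qed
      ultimately show ?thesis
        using correct' nz unfolding new(3) correct_at_def by auto
    qed
  qed
qed

section \<open>Input and output\<close>

definition exps :: "nat \<Rightarrow> nat \<Rightarrow> nat list list" where
  "exps n d = filter (\<lambda>v. sum_list v \<le> d)
     (rec_nat [[]] (\<lambda>_ L. concat (map (\<lambda>j. map (\<lambda>v. j # v) L) [0..<Suc d])) n)"

text \<open>The operators \<open>s + f t\<close> and \<open>\<partial>_i + (\<partial>_i f) t\<close> for the polynomial with indeterminate coefficients.\<close>

definition gen_s :: "nat \<Rightarrow> nat \<Rightarrow> fpoly" where
  "gen_s n d = ([(True, [])], inc 1 (replicate (Suc (Suc (n + n))) 0)) #
     map (\<lambda>v. ([(True, [v])], 1 # 0 # v @ replicate n 0)) (exps n d)"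

definition gen_d :: "nat \<Rightarrow> nat \<Rightarrow> nat \<Rightarrow> fpoly" where
  "gen_d n d i = ([(True, [])], inc (n + 2 + i) (replicate (Suc (Suc (n + n))) 0)) #
     concat (map (\<lambda>v. replicate (entry v i) ([(True, [v])], 1 # 0 # v[i := entry v i - 1] @ replicate n 0)) (exps n d))"

definition start :: "nat \<Rightarrow> nat \<Rightarrow> state" where
  "start n d = ([], [], [], gen_s n d # map (gen_d n d) [0..<n])"

definition run :: "nat \<Rightarrow> nat \<Rightarrow> state list" where
  "run n d = (expand n ^^ (LEAST t. finished ((expand n ^^ t) [start n d]))) [start n d]"

type_synonym out_coeff = "((nat \<times> nat) \<times> nat list list) list"
type_synonym out_op = "(out_coeff list \<times> nat list) list"

text \<open>The pairs \<open>(2, 0)\<close> and \<open>(1, 0)\<close> code the rational numbers \<open>1\<close> and \<open>- 1\<close>; the numbers \<open>2 i\<close> and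
  \<open>2 i + 1\<close> code the letters \<open>x_i\<close> and \<open>\<partial>_i\<close>.\<close>

definition out_coeff :: "fcoeff \<Rightarrow> out_coeff" where
  "out_coeff c = map (\<lambda>t. ((if fst t then 2 else 1, 0), snd t)) c"

definition out_word :: "nat \<Rightarrow> nat list \<Rightarrow> nat list" where
  "out_word n m = concat (map (\<lambda>i. replicate (entry m (2 + i)) (i + i)) [0..<n]) @
     concat (map (\<lambda>i. replicate (entry m (n + 2 + i)) (Suc (i + i))) [0..<n])"

definition out_op :: "nat \<Rightarrow> fpoly \<Rightarrow> out_op" where
  "out_op n p = map (\<lambda>t. (replicate (entry (snd t) 1) [] @ [out_coeff (fst t)], out_word n (snd t))) p"

text \<open>The first component keeps the basis elements free of \<open>t\<close>. The nonvanishing of the coefficients in \<open>U\<close>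
  is expressed by their product alone; for empty \<open>U\<close> this is \<open>1\<close>, which vanishes nowhere.\<close>

definition out_state :: "nat \<Rightarrow> state \<Rightarrow> out_op list \<times> out_coeff list \<times> out_coeff list" where
  "out_state n S = (case S of (E, U, G, T) \<Rightarrow>
     (map (out_op n) (filter (\<lambda>g. entry (flm g) 0 = 0) G), map out_coeff E,
      [out_coeff (foldr cmul U [(True, [])])]))"

definition algorithm :: "nat \<Rightarrow> nat \<Rightarrow> (out_op list \<times> out_coeff list \<times> out_coeff list) list" where
  "algorithm n d = map (out_state n) (run n d)"

subsection \<open>Computability\<close>

lemma computable_le [computable_intros]: "computable f \<Longrightarrow> computable g \<Longrightarrow> computable (\<lambda>x. (f x :: nat) \<le> g x)"
  unfolding linorder_not_less[symmetric] by (intro computable_intros)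

lemma computable_max [computable_intros]: "computable f \<Longrightarrow> computable g \<Longrightarrow> computable (\<lambda>x. max (f x :: nat) (g x))"
  by (rule computable_comp2[of max]) (unfold max_def, intro computable_intros)

lemma computable_take [computable_intros]: "computable k \<Longrightarrow> computable f \<Longrightarrow> computable (\<lambda>x. take (k x) (f x :: nat list))"
proof (rule computable_comp2[of take])
  have "take k m = map (\<lambda>i. entry m i) [0..<if k \<le> length m then k else length m]" for k m
    by (rule nth_equalityI) auto
  then show "computable (\<lambda>p. take (fst p) (snd p :: nat list))" by (simp only:) (intro computable_intros)
qed

lemma computable_list_less [computable_intros]: "computable f \<Longrightarrow> computable g \<Longrightarrow> computable (\<lambda>x. (f x :: nat list) < g x)"
proof (rule computable_comp2[of "(<)"])
  have "x < y \<longleftrightarrow> \<not> (\<not> (length x < length y \<and> take (length x) y = x) \<and>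
     list_all (\<lambda>i. \<not> (i < length y \<and> take i x = take i y \<and> entry x i < entry y i)) [0..<length x])"
    for x y :: "nat list"
    unfolding list_less_def lexord_take_index_conv by (auto simp: list_all_iff)
  then show "computable (\<lambda>p. (fst p :: nat list) < snd p)" by (simp only:) (intro computable_intros)
qed

lemma computable_inc [computable_intros]: "computable k \<Longrightarrow> computable f \<Longrightarrow> computable (\<lambda>x. inc (k x) (f x))"
proof (rule computable_comp2[of inc])
  have "inc i m = map (\<lambda>j. if j = i then Suc (entry m j) else entry m j) [0..<length m]" for i m
    by (rule nth_equalityI) (auto simp: inc_def nth_list_update)
  then show "computable (\<lambda>p. inc (fst p) (snd p))" by (simp only:) (intro computable_intros)
qed

lemma dec_entry: "m[i := m ! i - 1] = map (\<lambda>j. if j = i then entry m j - 1 else entry m j) [0..<length m]"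
  by (rule nth_equalityI) (auto simp: nth_list_update)

lemma dec_entry': "m[i := entry m i - 1] = map (\<lambda>j. if j = i then entry m j - 1 else entry m j) [0..<length m]"
  by (rule nth_equalityI) (auto simp: nth_list_update)

lemma computable_kap [computable_intros]: "computable a \<Longrightarrow> computable b \<Longrightarrow> computable c \<Longrightarrow> computable (\<lambda>x. kap (a x) (b x) (c x))"
  by (rule computable_comp3[of kap]) (unfold kap_def, intro computable_intros)

lemma computable_low [computable_intros]: "computable a \<Longrightarrow> computable b \<Longrightarrow> computable c \<Longrightarrow> computable (\<lambda>x. low (a x) (b x) (c x))"
  by (rule computable_comp3[of low]) (unfold low_def dec_entry, intro computable_intros)

lemma computable_mdiff [computable_intros]: "computable f \<Longrightarrow> computable g \<Longrightarrow> computable (\<lambda>x. mdiff (f x) (g x))"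
  by (rule computable_comp2[of mdiff]) (unfold mdiff_def, intro computable_intros)

lemma computable_mlcm [computable_intros]: "computable f \<Longrightarrow> computable g \<Longrightarrow> computable (\<lambda>x. mlcm (f x) (g x))"
  by (rule computable_comp2[of mlcm]) (unfold mlcm_def, intro computable_intros)

lemma computable_below [computable_intros]: "computable f \<Longrightarrow> computable g \<Longrightarrow> computable (\<lambda>x. below (f x) (g x))"
proof (rule computable_comp2[of below])
  have "below x y \<longleftrightarrow> length x = length y \<and> list_all (\<lambda>i. entry x i \<le> entry y i) [0..<length x]" for x y
    by (auto simp: list_all2_conv_all_nth list_all_iff)
  then show "computable (\<lambda>p. below (fst p) (snd p))" by (simp only:) (intro computable_intros)
qed

lemma computable_word [computable_intros]: "computable f \<Longrightarrow> computable (\<lambda>x. word (f x))"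
proof (rule computable_comp[of word])
  have "word q = concat (map (\<lambda>i. replicate (entry q i) i) [0..<length q])" for q
    unfolding word_def by (intro arg_cong[of _ _ concat] map_cong) auto
  then show "computable (\<lambda>q. word q)" by (simp only:) (intro computable_intros)
qed

lemma computable_cneg [computable_intros]: "computable f \<Longrightarrow> computable (\<lambda>x. cneg (f x))"
  by (rule computable_comp[of cneg]) (unfold cneg_def, intro computable_intros)

lemma computable_cmul [computable_intros]: "computable f \<Longrightarrow> computable g \<Longrightarrow> computable (\<lambda>x. cmul (f x) (g x))"
  by (rule computable_comp2[of cmul]) (unfold cmul_def, intro computable_intros)

lemma computable_fscale [computable_intros]: "computable f \<Longrightarrow> computable g \<Longrightarrow> computable (\<lambda>x. fscale (f x) (g x))"
  by (rule computable_comp2[of fscale]) (unfold fscale_def, intro computable_intros)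

lemma computable_flop [computable_intros]: "computable a \<Longrightarrow> computable b \<Longrightarrow> computable c \<Longrightarrow> computable (\<lambda>x. flop (a x) (b x) (c x))"
  by (rule computable_comp3[of flop]) (unfold flop_def, intro computable_intros)

lemma computable_flw [computable_intros]: "computable a \<Longrightarrow> computable b \<Longrightarrow> computable c \<Longrightarrow> computable (\<lambda>x. flw (a x) (b x) (c x))"
  by (rule computable_comp3[of flw]) (unfold flw_def, intro computable_intros computable_foldr)

lemma computable_flm [computable_intros]: "computable f \<Longrightarrow> computable (\<lambda>x. flm (f x))"
proof (rule computable_comp[of flm])
  have max: "max = (\<lambda>a b :: nat list. if b < a then a else b)" by (auto simp: fun_eq_iff max_def)
  show "computable (\<lambda>p. flm p)" unfolding flm_def max by (intro computable_intros computable_foldl)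
qed

lemma computable_flc [computable_intros]: "computable f \<Longrightarrow> computable (\<lambda>x. flc (f x))"
  by (rule computable_comp[of flc]) (unfold flc_def, intro computable_intros)

lemma computable_fdrop [computable_intros]: "computable f \<Longrightarrow> computable g \<Longrightarrow> computable (\<lambda>x. fdrop (f x) (g x))"
  by (rule computable_comp2[of fdrop]) (unfold fdrop_def, intro computable_intros)

lemma computable_spair [computable_intros]: "computable a \<Longrightarrow> computable b \<Longrightarrow> computable c \<Longrightarrow> computable (\<lambda>x. spair (a x) (b x) (c x))"
  by (rule computable_comp3[of spair]) (unfold spair_def, intro computable_intros)

lemma computable_reducers [computable_intros]: "computable f \<Longrightarrow> computable g \<Longrightarrow> computable (\<lambda>x. reducers (f x) (g x))"
  by (rule computable_comp2[of reducers]) (unfold reducers_def, intro computable_intros)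

lemma computable_step [computable_intros]: "computable f \<Longrightarrow> computable g \<Longrightarrow> computable (\<lambda>x. step (f x) (g x))"
  by (rule computable_comp2[of step]) (unfold step_def case_prod_unfold, intro computable_intros)

lemma computable_expand [computable_intros]: "computable f \<Longrightarrow> computable g \<Longrightarrow> computable (\<lambda>x. expand (f x) (g x))"
  by (rule computable_comp2[of expand]) (unfold expand_def, intro computable_intros)

lemma computable_finished [computable_intros]: "computable f \<Longrightarrow> computable (\<lambda>x. finished (f x))"
  by (rule computable_comp[of finished]) (unfold finished_def todo_def, intro computable_intros)

lemma computable_exps [computable_intros]: "computable f \<Longrightarrow> computable g \<Longrightarrow> computable (\<lambda>x. exps (f x) (g x))"
  by (rule computable_comp2[of exps]) (unfold exps_def, intro computable_intros computable_rec_nat)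

lemma computable_gen_s [computable_intros]: "computable f \<Longrightarrow> computable g \<Longrightarrow> computable (\<lambda>x. gen_s (f x) (g x))"
  by (rule computable_comp2[of gen_s]) (unfold gen_s_def, intro computable_intros)

lemma computable_gen_d [computable_intros]: "computable a \<Longrightarrow> computable b \<Longrightarrow> computable c \<Longrightarrow> computable (\<lambda>x. gen_d (a x) (b x) (c x))"
  by (rule computable_comp3[of gen_d]) (unfold gen_d_def dec_entry', intro computable_intros)

lemma computable_start [computable_intros]: "computable f \<Longrightarrow> computable g \<Longrightarrow> computable (\<lambda>x. start (f x) (g x))"
  by (rule computable_comp2[of start]) (unfold start_def, intro computable_intros)

lemma computable_out_coeff [computable_intros]: "computable f \<Longrightarrow> computable (\<lambda>x. out_coeff (f x))"
  by (rule computable_comp[of out_coeff]) (unfold out_coeff_def, intro computable_intros)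

lemma computable_out_word [computable_intros]: "computable f \<Longrightarrow> computable g \<Longrightarrow> computable (\<lambda>x. out_word (f x) (g x))"
  by (rule computable_comp2[of out_word]) (unfold out_word_def, intro computable_intros)

lemma computable_out_op [computable_intros]: "computable f \<Longrightarrow> computable g \<Longrightarrow> computable (\<lambda>x. out_op (f x) (g x))"
  by (rule computable_comp2[of out_op]) (unfold out_op_def, intro computable_intros)

lemma computable_out_state [computable_intros]: "computable f \<Longrightarrow> computable g \<Longrightarrow> computable (\<lambda>x. out_state (f x) (g x))"
  by (rule computable_comp2[of out_state]) (unfold out_state_def case_prod_unfold, intro computable_intros computable_foldr)

lemma exps_rec: "set (rec_nat [[]] (\<lambda>_ L. concat (map (\<lambda>j. map (\<lambda>v. j # v) L) [0..<Suc d])) n) =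
    {v. length v = n \<and> (\<forall>x\<in>set v. x \<le> d)}"
  by (induction n) (auto simp: length_Suc_conv less_Suc_eq_le image_iff simp del: upt_Suc)

lemma set_exps: "set (exps n d) = {v. var_ok n d v}"
  unfolding exps_def set_filter exps_rec var_ok_def
  by (auto dest: member_le_sum_list order_trans)

lemma distinct_exps: "distinct (exps n d)"
proof -
  define L where "L = (\<lambda>n. rec_nat [[]] (\<lambda>_ L. concat (map (\<lambda>j. map (\<lambda>v. j # v) L) [0..<Suc d])) n)"
  have "replicate n 0 \<in> set (L n)" for n
    unfolding L_def exps_rec by simp
  then have nonempty: "L n \<noteq> []" for n by (metis empty_iff list.set(1))
  have "distinct (L n)"
  proof (induction n)
    case (Suc n)
    have Suc': "L (Suc n) = concat (map (\<lambda>j. map (\<lambda>v. j # v) (L n)) [0..<Suc d])" by (simp add: L_def)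
    show ?case
      unfolding Suc' using Suc nonempty[of n]
      by (auto simp: distinct_map inj_on_def intro!: distinct_concat simp del: upt_Suc)
  qed (simp add: L_def)
  then show ?thesis by (simp add: exps_def L_def)
qed

lemma graded_gens:
  "graded n d 0 (gen_s n d)" "i < n \<Longrightarrow> graded n d 0 (gen_d n d i)"
  by (auto simp: graded_def gen_s_def gen_d_def form_of_def set_exps mon_def inc_def var_ok_def
      split: if_splits simp del: replicate.simps)

lemma state_ok_start: "state_ok n d (start n d)"
proof -
  have "\<forall>p\<in>set (gen_s n d # map (gen_d n d) [0..<n]). \<exists>e. graded n d e p"
    using graded_gens(1)[of n d] graded_gens(2)[of _ n d] by (intro ballI exI[of _ 0]) auto
  then show ?thesis by (simp add: state_ok_def polys_ok_def start_def)
qed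

lemma run_halts: "\<exists>t. finished ((expand n ^^ t) [start n d])"
  using halts_state[of n d "[]" "todo (start n d)" "[]" "[]"] state_ok_start[of n d]
  by (simp add: halts_def start_def todo_def state_ok_def polys_ok_def)

lemma run_finished: "finished (run n d)"
  unfolding run_def using run_halts by (rule LeastI_ex)

lemma computable_algorithm: "computable (\<lambda>p. algorithm (fst p) (snd p))"
proof -
  let ?h = "\<lambda>q :: nat \<times> state list. (fst q, expand (fst q) (snd q))"
  let ?P = "\<lambda>q :: nat \<times> state list. finished (snd q)"
  let ?s = "\<lambda>p :: nat \<times> nat. (fst p, [start (fst p) (snd p)])"
  have it: "(?h ^^ t) (n, Ss) = (n, (expand n ^^ t) Ss)" for t n Ss by (induction t) auto
  have "computable (\<lambda>x. (?h ^^ (LEAST t. ?P ((?h ^^ t) (?s x)))) (?s x))"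
    by (rule computable_iterate) (use run_halts in \<open>(intro computable_intros | simp add: it)+\<close>)
  then have "computable (\<lambda>p. snd (fst p, run (fst p) (snd p)))"
    unfolding it run_def by (intro computable_snd) simp
  then have "computable (\<lambda>p. run (fst p) (snd p))" by simp
  then show ?thesis unfolding algorithm_def by (intro computable_intros)
qed

theorem algorithm_computable: "\<exists>F. \<forall>n d. computes F [n, d] (enc (algorithm n d))"
proof -
  obtain A where A: "\<And>p. computes A [enc p] (enc (algorithm (fst p) (snd p)))"
    using computable_algorithm unfolding computable_def by blast
  have "rf2 (\<lambda>x y. prod_encode (x, y))" by (intro total_rec_prod_encode total_rec_proj) auto
  then obtain T where T: "\<And>x y. computes T [x, y] (prod_encode (x, y))"
    using rf2E[of "\<lambda>x y. prod_encode (x, y)"] by blast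
  have "computes (RComp A [T]) [n, d] (enc (algorithm n d))" for n d
    using T A[of "(n, d)"] by (auto intro!: computes.Comp[where ys = "[_]"])
  then show ?thesis by blast
qed

subsection \<open>Invariants of the run\<close>

lemma run_induct:
  assumes "P (start n d)" "\<And>S S'. P S \<Longrightarrow> S' \<in> set (step n S) \<Longrightarrow> P S'" "S \<in> set (run n d)"
  shows "P S"
proof -
  have "\<forall>S\<in>set ((expand n ^^ t) [start n d]). P S" for t
    by (induction t) (use assms in \<open>auto simp: expand_def\<close>)
  with assms(3) show ?thesis unfolding run_def by blast
qed

lemma run_satisfies: "\<exists>S\<in>set (run n d). satisfies Z S"
proof -
  have "\<exists>S\<in>set ((expand n ^^ t) [start n d]). satisfies Z S" for t
  proof (induction t)
    case 0
    show ?case by (simp add: satisfies_def start_def)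
  next
    case (Suc t)
    then obtain S where S: "S \<in> set ((expand n ^^ t) [start n d])" "satisfies Z S" by blast
    obtain S' where "S' \<in> set (step n S)" "satisfies Z S'" using satisfies_step[OF S(2)] by blast
    moreover have "S' \<in> set (expand n ((expand n ^^ t) [start n d]))"
      using S(1) calculation(1) by (subst expand_def) auto
    ultimately show ?case by auto
  qed
  then show ?thesis unfolding run_def by blast
qed

lemma run_state_ok: "S \<in> set (run n d) \<Longrightarrow> state_ok n d S"
  by (rule run_induct[of "state_ok n d"]) (use state_ok_start state_ok_step in blast)+

lemma run_correct:
  fixes e :: "nat list \<Rightarrow> 'k::field"
  assumes "S \<in> set (run n d)" "satisfies (\<lambda>c. cval e c = 0) S"
  shows "correct_at n e (gen_span n (fval e ` insert (gen_s n d) (gen_d n d ` {..<n}))) S"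
proof -
  let ?I = "gen_span n (fval e ` insert (gen_s n d) (gen_d n d ` {..<n}))"
  have "state_ok n d S \<and> (satisfies (\<lambda>c. cval e c = 0) S \<longrightarrow> correct_at n e ?I S)"
  proof (rule run_induct[OF _ _ assms(1)], goal_cases)
    case 1
    have "set [0..<n] = {..<n}" by auto
    then show ?case using state_ok_start[of n d] by (simp add: correct_at_def start_def)
  next
    case (2 S S')
    then show ?case
      using state_ok_step[of n d S S'] correct_step[of n d S e ?I S'] satisfies_step_back[of S' n S "\<lambda>c. cval e c = 0"]
      by blast
  qed
  with assms(2) show ?thesis by blast
qed

lemma run_todo: "S \<in> set (run n d) \<Longrightarrow> todo S = []"
  using run_finished[of n d] by (auto simp: finished_def list_all_iff)

text \<open>Here the invariant at the end of the run meets the criterion of Buchberger.\<close>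

theorem run_basis:
  fixes e :: "nat list \<Rightarrow> 'k::field"
  assumes "(E, U, G, T) \<in> set (run n d)" "satisfies (\<lambda>c. cval e c = 0) (E, U, G, T)"
    and u: "u \<in> gen_span n (fval e ` insert (gen_s n d) (gen_d n d ` {..<n}))"
    and no_t: "\<forall>k\<in>keys u. k ! 0 = 0"
  shows "u \<in> vec.span {lw n w (fval e g) | w g. g \<in> set G \<and> entry (flm g) 0 = 0 \<and> set w \<subseteq> indices n - {0}}"
proof -
  have T: "T = []" using run_todo[OF assms(1)] by (simp add: todo_def)
  have ok: "\<And>g. g \<in> set G \<Longrightarrow> g \<noteq> [] \<and> (\<exists>k. graded n d k g)"
    using run_state_ok[OF assms(1)] by (auto simp: state_ok_def polys_ok_def)
  note correct = run_correct[OF assms(1,2), unfolded correct_at_def T]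
  define B where "B = (\<lambda>g. (flm g, fval e g)) ` set G"
  have lead: "leading n B"
    unfolding leading_def B_def
  proof clarsimp
    fix g assume g: "g \<in> set G"
    then show "bounded n (fval e g) (flm g) \<and> lookup (fval e g) (flm g) \<noteq> 0"
      using correct ok[OF g] bounded_fval by (auto simp: lookup_fval_flm)
  qed
  have len: "length (flm g) = 2 * n + 2" if g: "g \<in> set G" for g
    using ok[OF g] graded_flm[of n d _ g] by (auto simp: mon_def)
  have "u \<in> vec.span {lw n w v | w m v. (m, v) \<in> B \<and> m ! 0 = 0 \<and> set w \<subseteq> indices n - {0}}"
  proof (rule elimination[OF lead _ _ no_t])
    have "word_span n B M = bspan n e G T M" for M
      unfolding word_span_def bspan_def T by (rule arg_cong[of _ _ vec.span]) (auto simp: B_def)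
    then show "scl (lookup v' m') (lw n (word (mdiff (mlcm m m') m)) v) -
        scl (lookup v m) (lw n (word (mdiff (mlcm m m') m')) v') \<in> word_span n B (mlcm m m')"
      if B: "(m, v) \<in> B" "(m', v') \<in> B" for m v m' v'
    proof -
      obtain p q where pq: "p \<in> set G" "m = flm p" "v = fval e p" "q \<in> set G" "m' = flm q" "v' = fval e q"
        using B by (auto simp: B_def)
      obtain k k' where "graded n d k p" "p \<noteq> []" "graded n d k' q" "q \<noteq> []" using ok pq by meson
      note val = fval_spair[OF this, of e]
      have "fval e (spair n p q) \<in> bspan n e G [] (mlcm (flm p) (flm q))"
        using correct pq by blast
      then show ?thesis
        unfolding val using pq \<open>\<And>M. word_span n B M = bspan n e G T M\<close> by (simp add: lookup_fval_flm T)
    qed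
    show "u \<in> vec.span {lw n w v | w m v. (m, v) \<in> B \<and> set w \<subseteq> indices n}"
    proof -
      have "{lw n w v | w m v. (m, v) \<in> B \<and> set w \<subseteq> indices n} =
          {lw n w v | w v. v \<in> fval e ` (set G \<union> set []) \<and> set w \<subseteq> indices n}"
        by (auto simp: B_def)
      then show ?thesis using u correct unfolding gen_span_def by auto
    qed
  qed
  moreover have "{lw n w v | w m v. (m, v) \<in> B \<and> m ! 0 = 0 \<and> set w \<subseteq> indices n - {0}} =
      {lw n w (fval e g) | w g. g \<in> set G \<and> entry (flm g) 0 = 0 \<and> set w \<subseteq> indices n - {0}}"
    using len by (auto simp: B_def) fastforce+
  ultimately show ?thesis by simp
qed

section \<open>Evaluation of normal forms in a representation\<close>

definition block :: "nat \<Rightarrow> nat \<Rightarrow> nat list \<Rightarrow> nat list" where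
  "block a b m = concat (map (\<lambda>i. replicate (m ! i) i) [a..<b])"

lemma word_block: "word m = block 0 (length m) m"
  by (simp add: word_def block_def)

lemma block_split: "a \<le> i \<Longrightarrow> i < b \<Longrightarrow> block a b m = block a i m @ replicate (m ! i) i @ block (Suc i) b m"
proof -
  assume "a \<le> i" "i < b"
  then have "[a..<b] = [a..<i] @ i # [Suc i..<b]"
    using upt_add_eq_append[of a i "b - i"] upt_conv_Cons[of i b] by simp
  then show ?thesis by (simp add: block_def)
qed

lemma block_update: "k < a \<or> b \<le> k \<Longrightarrow> block a b (m[k := v]) = block a b m"
  unfolding block_def by (intro arg_cong[of _ _ concat] map_cong) auto

lemma set_block: "set (block a b m) \<subseteq> {a..<b}"
  by (auto simp: block_def)

text \<open>Normal forms will be evaluated in two modules, \<open>R[t]\<close> and the Weyl algebra. What the two evaluations share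
  is derived from the commutators of the letters; \<open>emb\<close> maps the constants.\<close>

locale letter_rep =
  fixes n :: nat and L :: "nat \<Rightarrow> 'm \<Rightarrow> 'm::ring_1" and emb :: "'k::comm_ring_1 \<Rightarrow> 'm"
  assumes L_add: "L i (g + h) = L i g + L i h"
    and L_emb: "L i (emb a * h) = emb a * L i h"
    and emb_add: "emb (a + b) = emb a + emb b" and emb_mult: "emb (a * b) = emb a * emb b" and emb_1: "emb 1 = 1"
    and L_commute: "j < i \<Longrightarrow> i < 2 * n + 2 \<Longrightarrow> L i (L j h) = L j (L i h) +
      (if i = 1 then L 0 h else if n + 2 \<le> i \<and> j = i - n then h else 0)"
begin

lemma emb_0 [simp]: "emb 0 = 0"
  using emb_add[of 0 0] by simp

lemma emb_of_nat: "emb (of_nat k) = of_nat k"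
  by (induction k) (simp_all add: emb_add emb_1)

lemma L_0 [simp]: "L i 0 = 0"
  using L_add[of i 0 0] by simp

lemma L_of_nat: "L i (of_nat k * h) = of_nat k * L i h"
  using L_emb[of i "of_nat k" h] by (simp add: emb_of_nat)

lemma word_L_add: "foldr L w (g + h) = foldr L w g + foldr L w h"
  by (induction w) (simp_all add: L_add)

lemma word_L_of_nat: "foldr L w (of_nat k * h) = of_nat k * foldr L w h"
  by (induction w) (simp_all add: L_of_nat)

lemma L_pass:
  assumes "i < 2 * n + 2" "\<forall>j\<in>set w. j < i \<and> i \<noteq> 1 \<and> (n + 2 \<le> i \<longrightarrow> j \<noteq> i - n)"
  shows "L i (foldr L w h) = foldr L w (L i h)"
  using assms(2) by (induction w) (use assms(1) L_commute in auto)

text \<open>Moving a letter to its place in a normally ordered word costs the correction of \<open>kap\<close> and \<open>low\<close>: all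
  letters on the way commute with it, except \<open>t\<close> with \<open>s\<close> and \<open>x_i\<close> with \<open>\<partial>_i\<close>.\<close>

lemma L_word:
  assumes m: "length m = 2 * n + 2" and i: "i < 2 * n + 2"
  shows "L i (foldr L (word m) h) = foldr L (word (inc i m)) h +
    of_nat (kap n i m) * foldr L (word (low n i m)) h"
proof -
  have split: "word m' = block 0 i m' @ replicate (m' ! i) i @ block (Suc i) (length m') m'"
    if "length m' = length m" for m'
    unfolding word_block using that m i by (intro block_split) auto
  define h' where "h' = foldr L (replicate (m ! i) i @ block (Suc i) (length m) m) h"
  have inc: "foldr L (word (inc i m)) h = foldr L (block 0 i m) (L i h')"
    using split[of "inc i m"] m i by (simp add: inc_def block_update h'_def)
  have word: "foldr L (word m) h = foldr L (block 0 i m) h'"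
    using split[of m] by (simp add: h'_def)
  consider "i = 1" | "i \<noteq> 1" "i < n + 2" | "n + 2 \<le> i" by linarith
  then show ?thesis
  proof cases
    case 1
    have "L 1 (foldr L (replicate a 0) g) = foldr L (replicate a 0) (L 1 g) + of_nat a * foldr L (replicate a 0) g" for a g
      using L_commute[of 0 1] by (induction a) (auto simp: L_add L_of_nat algebra_simps)
    from this[of "m ! 0" h'] show ?thesis
      using 1 m unfolding inc word by (simp add: block_def kap_def low_def word[unfolded 1 block_def, simplified] split: if_splits)
  next
    case 2
    then have "kap n i m = 0" by (simp add: kap_def)
    moreover have "L i (foldr L (block 0 i m) h') = foldr L (block 0 i m) (L i h')"
      using set_block[of 0 i m] 2 i by (intro L_pass) auto
    ultimately show ?thesis unfolding inc word by simp
  next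
    case 3
    define p where "p = i - n"
    have p: "p < i" "2 \<le> p" "p < length m" "p < n + 2" using 3 i m by (auto simp: p_def)
    let ?w = "block 0 p m" and ?w' = "block (Suc p) i m"
    have b: "block 0 i m = ?w @ replicate (m ! p) p @ ?w'"
      using p by (intro block_split) auto
    have pow: "L i (foldr L (replicate a p) g) = foldr L (replicate a p) (L i g) + of_nat a * foldr L (replicate (a - 1) p) g" for a g
    proof (induction a)
      case (Suc a)
      have "L i (foldr L (replicate (Suc a) p) g) = L p (L i (foldr L (replicate a p) g)) + foldr L (replicate a p) g"
        using L_commute[of p i] p i 3 by (simp add: p_def)
      also have "L p (L i (foldr L (replicate a p) g)) =
          foldr L (replicate (Suc a) p) (L i g) + of_nat a * foldr L (replicate a p) g"
        unfolding Suc by (cases a) (simp_all add: L_add L_of_nat del: of_nat_Suc)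
      finally show ?case by (simp add: algebra_simps)
    qed simp
    have pass: "L i (foldr L ?w g) = foldr L ?w (L i g)" "L i (foldr L ?w' g) = foldr L ?w' (L i g)" for g
      using set_block[of 0 p m] set_block[of "Suc p" i m] p 3 i by (auto intro!: L_pass simp: p_def)
    have "L i (foldr L (word m) h) = foldr L (block 0 i m) (L i h') +
        of_nat (m ! p) * foldr L (?w @ replicate (m ! p - 1) p @ ?w') h'"
      unfolding word b by (simp add: pass pow word_L_add word_L_of_nat del: foldr_replicate)
    also have "foldr L (?w @ replicate (m ! p - 1) p @ ?w') h' = foldr L (word (low n i m)) h"
    proof -
      have low: "low n i m = m[p := m ! p - 1]" using 3 by (simp add: low_def p_def)
      have "word (low n i m) = block 0 i (low n i m) @ replicate (m ! i) i @ block (Suc i) (length m) m"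
        using split[of "low n i m"] p by (simp add: low block_update)
      also have "block 0 i (low n i m) = ?w @ replicate (m ! p - 1) p @ ?w'"
        using block_split[of 0 p i "low n i m"] p by (simp add: low block_update)
      finally show ?thesis by (simp add: h'_def)
    qed
    also have "m ! p = kap n i m" using 3 p by (simp add: kap_def p_def)
    finally show ?thesis unfolding inc .
  qed
qed

definition ev :: "'k vec \<Rightarrow> 'm" where
  "ev = lin_ext (\<lambda>m a. emb a * foldr L (word m) 1)"

lemma ev_single: "ev (Poly_Mapping.single m a) = emb a * foldr L (word m) 1"
  by (simp add: ev_def)

lemma ev_0 [simp]: "ev 0 = 0"
  by (simp add: ev_def)

lemma ev_add: "ev (u + v) = ev u + ev v"
  unfolding ev_def by (rule lin_ext_add) (simp_all add: emb_add distrib_right)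

lemma ev_diff: "ev (u - v) = ev u - ev v"
  using ev_add[of "u - v" v] by (simp add: algebra_simps)

lemma ev_scl: "ev (scl a v) = emb a * ev v"
  by (induction v rule: poly_mapping_add_induct)
    (simp_all add: scl_add ev_add ev_single emb_mult distrib_left mult.assoc)

lemma ev_lop:
  assumes "keys v \<subseteq> mon n" "i < 2 * n + 2"
  shows "ev (lop n i v) = L i (ev v)"
  using assms(1)
proof (rule vec_single_induct)
  fix m and a :: 'k assume "m \<in> mon n"
  moreover have "emb (of_nat k * a) = emb a * of_nat k" for k
    using emb_mult[of a "of_nat k"] by (simp add: emb_of_nat mult.commute)
  ultimately show "ev (lop n i (Poly_Mapping.single m a)) = L i (ev (Poly_Mapping.single m a))"
    using assms(2)
    by (simp add: lop_single ev_add ev_single L_emb L_word mon_def distrib_left mult.assoc)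
qed (simp_all add: lop_add ev_add L_add)

lemma ev_lw: "keys v \<subseteq> mon n \<Longrightarrow> set w \<subseteq> indices n \<Longrightarrow> ev (lw n w v) = foldr L w (ev v)"
proof (induction w)
  case (Cons i w)
  then show ?case using ev_lop[OF lw_keys[OF Cons.prems(1), of w], of i] by simp
qed simp

end

section \<open>The module \<open>R[t]\<close>\<close>

text \<open>The quotient of the extended algebra by the left ideal of \<open>s + f t\<close> and the
  \<open>\<partial>_i + f_i t\<close> is \<open>R[t]\<close>; on it \<open>s\<close> acts by \<open>t d/dt - f t\<close> and \<open>\<partial>_i\<close> by \<open>\<partial>_i - f_i t\<close>.\<close>

definition nop :: "(nat, 'k::idom) mpoly \<Rightarrow> nat \<Rightarrow> nat \<Rightarrow> (nat, 'k) mpoly poly \<Rightarrow> (nat, 'k) mpoly poly" where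
  "nop f n i h = (if i = 0 then [:0, 1:] * h
     else if i = 1 then [:0, 1:] * pderiv h - [:f:] * [:0, 1:] * h
     else if i < n + 2 then [:Var (i - 2):] * h
     else coeff_deriv (i - n - 2) h - [:mpoly_deriv (i - n - 2) f:] * [:0, 1:] * h)"

lemma coeff_deriv_simps:
  "coeff_deriv i [:a:] = [:mpoly_deriv i a:]" "coeff_deriv i [:0, 1 :: (nat, 'k::idom) mpoly:] = 0"
  "coeff_deriv i (g - h) = coeff_deriv i g - coeff_deriv i h"
  using coeff_deriv_add[of i "g - h" h]
  by (auto simp: map_poly_pCons)

lemma coeff_deriv_pderiv: "coeff_deriv i (pderiv h) = pderiv (coeff_deriv i h)"
proof -
  have "mpoly_deriv i (of_nat k * a) = of_nat k * mpoly_deriv i a" for k and a :: "(nat, 'a) mpoly"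
    by (induction k) (simp_all add: distrib_right mpoly_deriv_add)
  then show ?thesis
    by (intro poly_eqI) (simp add: coeff_map_poly coeff_pderiv del: of_nat_Suc)
qed

lemma letter_rep_nop: "letter_rep n (nop f n) (\<lambda>a. [:Const a:])" for f :: "(nat, 'k::idom) mpoly"
proof
  fix i j :: nat and g h :: "(nat, 'k) mpoly poly" and a b :: 'k
  show "nop f n i (g + h) = nop f n i g + nop f n i h"
    by (simp add: nop_def coeff_deriv_add pderiv_add algebra_simps del: mult_pCons_left mult_pCons_right)
  show "nop f n i ([:Const a:] * h) = [:Const a:] * nop f n i h"
    by (simp add: nop_def coeff_deriv_mult coeff_deriv_simps pderiv_mult pderiv_pCons algebra_simps
        del: mult_pCons_left mult_pCons_right)
  show "[:Const (a + b) :: (nat, 'k) mpoly:] = [:Const a:] + [:Const b:]" by (simp add: single_add)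
  show "[:Const (a * b) :: (nat, 'k) mpoly:] = [:Const a:] * [:Const b:]"
    by (simp add: mult_single mult.commute[of a b])
  show "[:Const 1 :: (nat, 'k) mpoly:] = 1" by (simp add: one_pCons)
  assume ij: "j < i" "i < 2 * n + 2"
  have t: "pderiv [:0, 1 :: (nat, 'k) mpoly:] = 1" by (simp add: pderiv_pCons one_pCons)
  have c: "pderiv [:u :: (nat, 'k) mpoly:] = 0" for u by (simp add: pderiv_pCons)
  show "nop f n i (nop f n j h) = nop f n j (nop f n i h) +
      (if i = 1 then nop f n 0 h else if n + 2 \<le> i \<and> j = i - n then h else 0)"
  proof (cases "i < n + 2")
    case True
    with ij show ?thesis
      by (auto simp: nop_def pderiv_mult t c algebra_simps simp del: mult_pCons_left mult_pCons_right)
  next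
    case False
    define p where "p = i - n - 2"
    have i: "i = n + 2 + p" "p < n" using False ij by (auto simp: p_def)
    consider "j = 0" | "j = 1" | "2 \<le> j" "j < n + 2" | "n + 2 \<le> j" by linarith
    then show ?thesis
    proof cases
      case 1
      then show ?thesis using i
        by (simp add: nop_def coeff_deriv_mult coeff_deriv_simps algebra_simps del: mult_pCons_left mult_pCons_right)
    next
      case 2
      then show ?thesis using i
        by (simp add: nop_def coeff_deriv_mult coeff_deriv_simps coeff_deriv_pderiv pderiv_mult pderiv_diff t c
            algebra_simps del: mult_pCons_left mult_pCons_right)
    next
      case 3
      have "[:mpoly_deriv p (Var (j - 2)) :: (nat, 'k) mpoly:] = (if j = i - n then 1 else 0)"
        using 3 i by (auto simp: mpoly_deriv_Var one_pCons)
      then show ?thesis using 3 i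
        by (simp add: nop_def coeff_deriv_mult coeff_deriv_simps algebra_simps del: mult_pCons_left mult_pCons_right)
    next
      case 4
      then show ?thesis using i ij coeff_deriv_commute[of p "j - n - 2" h] mpoly_deriv_commute[of p "j - n - 2" f]
        by (simp add: nop_def coeff_deriv_mult coeff_deriv_simps algebra_simps del: mult_pCons_left mult_pCons_right)
    qed
  qed
qed


definition xpart :: "nat \<Rightarrow> nat list \<Rightarrow> (nat \<Rightarrow>\<^sub>0 nat)" where
  "xpart n m = Poly_Mapping.nth (take n (drop 2 m))"

text \<open>The monomials \<open>t^l x^v\<close>, which represent \<open>R[t]\<close>.\<close>

definition tmon :: "nat \<Rightarrow> nat list set" where
  "tmon n = {m. \<exists>l v. length v = n \<and> m = l # 0 # v @ replicate n 0}"

declare Poly_Mapping.lookup_nth [simp del] Poly_Mapping.keys_nth [simp del]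

lemma lookup_nth_list: "lookup (Poly_Mapping.nth v) i = (if i < length v then v ! i else 0)"
  by (simp add: nth.rep_eq nth_default_def)

lemma tmon_mon: "m \<in> tmon n \<Longrightarrow> m \<in> mon n"
  by (auto simp: tmon_def mon_def)

lemma xpart_tmon: "length v = n \<Longrightarrow> xpart n (l # 0 # v @ replicate n 0) = Poly_Mapping.nth v"
  by (simp add: xpart_def)

lemma nth_inj: "length v = length w \<Longrightarrow> Poly_Mapping.nth v = Poly_Mapping.nth w \<Longrightarrow> v = w"
proof (rule nth_equalityI)
  fix i assume "length v = length w" "Poly_Mapping.nth v = Poly_Mapping.nth w" "i < length v"
  then show "v ! i = w ! i" using lookup_nth_list[of v i] lookup_nth_list[of w i] by simp
qed

lemma tmon_inj: "m \<in> tmon n \<Longrightarrow> m' \<in> tmon n \<Longrightarrow> m ! 0 = m' ! 0 \<Longrightarrow> xpart n m = xpart n m' \<Longrightarrow> m = m'"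
  by (auto simp: tmon_def xpart_tmon intro: nth_inj)

lemma tmon_inc:
  assumes "m \<in> tmon n" "i \<noteq> 1" "i < n + 2"
  shows "inc i m \<in> tmon n"
proof -
  obtain l v where m: "length v = n" "m = l # 0 # v @ replicate n 0" using assms(1) by (auto simp: tmon_def)
  show ?thesis
  proof (cases "i = 0")
    case True
    then show ?thesis using m by (auto simp: tmon_def inc_def)
  next
    case False
    then obtain k where "i = Suc (Suc k)" "k < n" using assms(2,3)
      by (metis One_nat_def add_2_eq_Suc' less_Suc_eq_0_disj Suc_less_eq not0_implies_Suc)
    then have "inc i m = l # 0 # v[k := Suc (v ! k)] @ replicate n 0"
      using m by (simp add: inc_def list_update_append nth_append)
    then show ?thesis using m by (auto simp: tmon_def)
  qed
qed

lemma tmon_dec: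
  assumes "m \<in> tmon n" "j < n"
  shows "m[j + 2 := k] \<in> tmon n"
  using assms by (auto simp: tmon_def list_update_append)

lemma tmon_kap: "m \<in> tmon n \<Longrightarrow> i \<noteq> 1 \<Longrightarrow> i < n + 2 \<Longrightarrow> kap n i m = 0"
  by (simp add: kap_def)

lemma lop_tmon:
  assumes "keys u \<subseteq> tmon n" "i \<noteq> 1" "i < n + 2"
  shows "keys (lop n i u) \<subseteq> tmon n"
  using assms(1)
proof (rule vec_single_induct)
  fix m and a :: 'a assume "m \<in> tmon n"
  then show "keys (lop n i (Poly_Mapping.single m a)) \<subseteq> tmon n"
    using tmon_inc[OF _ assms(2,3)] tmon_kap[OF _ assms(2,3)] by (auto simp: lop_single)
next
  fix p q :: "'a vec" assume "keys (lop n i p) \<subseteq> tmon n" "keys (lop n i q) \<subseteq> tmon n"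
  then show "keys (lop n i (p + q)) \<subseteq> tmon n"
    unfolding lop_add by (intro order_trans[OF Poly_Mapping.keys_add]) auto
qed simp

lemma lw_tmon: "keys u \<subseteq> tmon n \<Longrightarrow> \<forall>i\<in>set w. i \<noteq> 1 \<and> i < n + 2 \<Longrightarrow> keys (lw n w u) \<subseteq> tmon n"
  by (induction w) (auto dest: lop_tmon)

lemma lw_single_tx:
  "m \<in> mon n \<Longrightarrow> \<forall>i\<in>set w. i \<noteq> 1 \<and> i < n + 2 \<Longrightarrow>
    lw n w (Poly_Mapping.single m a) = Poly_Mapping.single (incs w m) a"
  by (induction w) (auto simp: lop_single kap_def)

lemma set_word_tmon: "m \<in> tmon n \<Longrightarrow> \<forall>i\<in>set (word m). i \<noteq> 1 \<and> i < n + 2"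
proof
  fix i assume m: "m \<in> tmon n" and "i \<in> set (word m)"
  then have "i < length m" "m ! i \<noteq> 0" by (auto simp: word_def)
  with m show "i \<noteq> 1 \<and> i < n + 2"
    by (cases i; cases "i - 1") (auto simp: tmon_def nth_append split: if_splits)
qed

definition unit_mon :: "nat \<Rightarrow> nat \<Rightarrow> nat list" where
  "unit_mon n i = inc i (replicate (2 * n + 2) 0)"

lemma incs_word_unit:
  assumes "m \<in> mon n" "i < 2 * n + 2"
  shows "incs (word m) (unit_mon n i) = inc i m"
  using assms by (intro nth_equalityI)
    (auto simp: unit_mon_def mon_def nth_incs inc_def nth_list_update count_word simp del: replicate_Suc)

text \<open>If \<open>I\<close> contains elements \<open>s + \<dots>\<close> and \<open>\<partial>_i + \<dots>\<close> with tails in \<open>R[t]\<close>, then \<open>s\<close> or \<open>\<partial>_i\<close> at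
  the end of \<open>t^l x^v s\<close> or \<open>t^l x^v \<partial>_i\<close> can be traded for its tail. So the elements congruent to
  \<open>R[t]\<close> are closed under the letters, and they contain \<open>1\<close>.\<close>

lemma reduce_to_tmon:
  fixes I :: "'k::field vec set"
  assumes I: "I = gen_span n X"
    and X: "\<And>i. i = 1 \<or> n + 2 \<le> i \<and> i < 2 * n + 2 \<Longrightarrow>
      \<exists>y. keys y \<subseteq> tmon n \<and> Poly_Mapping.single (unit_mon n i) 1 + y \<in> I"
    and u: "keys u \<subseteq> mon n"
  shows "\<exists>y. keys y \<subseteq> tmon n \<and> u - y \<in> I"
proof -
  define Y where "Y = {u. \<exists>y. keys y \<subseteq> tmon n \<and> u - y \<in> I}"
  have Y_add: "p + q \<in> Y" if "p \<in> Y" "q \<in> Y" for p q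
  proof -
    obtain y z where "keys y \<subseteq> tmon n" "p - y \<in> I" "keys z \<subseteq> tmon n" "q - z \<in> I"
      using \<open>p \<in> Y\<close> \<open>q \<in> Y\<close> by (auto simp: Y_def)
    moreover from this have "(p - y) + (q - z) \<in> I" unfolding I by (intro gen_span_add)
    ultimately show ?thesis
      using Poly_Mapping.keys_add[of y z] unfolding Y_def
      by (intro CollectI exI[of _ "y + z"]) (auto simp: algebra_simps)
  qed
  have Y_scl: "scl a p \<in> Y" if "p \<in> Y" for a p
  proof -
    obtain y where "keys y \<subseteq> tmon n" "p - y \<in> I" using \<open>p \<in> Y\<close> by (auto simp: Y_def)
    moreover from this have "scl a (p - y) \<in> I" unfolding I by (intro gen_span_scale)
    moreover have "keys (scl a y) \<subseteq> keys y" by (auto simp: in_keys_iff)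
    ultimately show ?thesis
      unfolding Y_def by (intro CollectI exI[of _ "scl a y"]) (auto simp: vec.scale_right_diff_distrib)
  qed
  have Y_I: "p \<in> Y" if "p \<in> I" for p
    using that unfolding Y_def by (intro CollectI exI[of _ 0]) auto
  have Y_tmon: "p \<in> Y" if "keys p \<subseteq> tmon n" for p
    using that unfolding Y_def I by (intro CollectI exI[of _ p]) (auto intro: gen_span_0)
  have Y_diff: "p - q \<in> Y" if "p \<in> Y" "q \<in> Y" for p q
    using Y_add[OF \<open>p \<in> Y\<close> Y_scl[OF \<open>q \<in> Y\<close>, of "- 1"]] by simp
  have lop_single_Y: "lop n i (Poly_Mapping.single t a) \<in> Y" if t: "t \<in> tmon n" and i: "i < 2 * n + 2" for t a i
  proof -
    have tm: "t \<in> mon n" using t by (rule tmon_mon)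
    have 1: "Poly_Mapping.single (inc i t) 1 \<in> Y"
    proof (cases "i \<noteq> 1 \<and> i < n + 2")
      case True
      then show ?thesis using tmon_inc[OF t] by (intro Y_tmon) auto
    next
      case False
      then obtain y where y: "keys y \<subseteq> tmon n" "Poly_Mapping.single (unit_mon n i) 1 + y \<in> I"
        using X[of i] i by auto
      have w: "set (word t) \<subseteq> indices n" using set_word[of t] tm by (auto simp: mon_def)
      have "unit_mon n i \<in> mon n" by (simp add: unit_mon_def mon_def)
      then have "lw n (word t) (Poly_Mapping.single (unit_mon n i) (1 :: 'k)) = Poly_Mapping.single (inc i t) 1"
        using lw_single_tx[OF _ set_word_tmon[OF t]] incs_word_unit[OF tm i] by metis
      \<comment> \<open>left multiplication by the monomial \<open>t\<close> of the element \<open>s + \<dots>\<close> or \<open>\<partial>_i + \<dots>\<close> of \<open>I\<close>\<close>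
      then have "Poly_Mapping.single (inc i t) 1 + lw n (word t) y \<in> I"
        using gen_span_lw[OF y(2)[unfolded I] w] by (simp add: lw_add I)
      from Y_diff[OF Y_I[OF this] Y_tmon[OF lw_tmon[OF y(1) set_word_tmon[OF t]]]]
      show ?thesis by simp
    qed
    have 2: "Poly_Mapping.single (low n i t) (of_nat (kap n i t)) \<in> Y"
    proof (cases "i \<noteq> 1 \<and> i < n + 2")
      case True
      then show ?thesis using tmon_kap[OF t] by (intro Y_tmon) auto
    next
      case False
      have "low n i t \<in> tmon n"
      proof (cases "i = 1")
        case False
        then have "i - n = (i - n - 2) + 2" "i - n - 2 < n" using \<open>\<not> (i \<noteq> 1 \<and> i < n + 2)\<close> i by auto
        then show ?thesis using tmon_dec[OF t] False by (metis low_def)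
      qed (use t in \<open>simp add: low_def\<close>)
      then show ?thesis by (intro Y_tmon) (auto split: if_splits)
    qed
    have "lop n i (Poly_Mapping.single t a) =
        scl a (Poly_Mapping.single (inc i t) 1 + Poly_Mapping.single (low n i t) (of_nat (kap n i t)))"
      by (simp add: lop_single scl_add mult.commute)
    then show ?thesis using Y_scl[OF Y_add[OF 1 2]] by simp
  qed
  have lop_Y: "lop n i p \<in> Y" if p: "p \<in> Y" and i: "i < 2 * n + 2" for i p
  proof -
    obtain y where y: "keys y \<subseteq> tmon n" "p - y \<in> I" using p by (auto simp: Y_def)
    have "lop n i y \<in> Y"
      using y(1) by (rule vec_single_induct) (auto simp: lop_add intro: Y_add lop_single_Y i Y_tmon)
    moreover have "lop n i (p - y) \<in> I"
      using gen_span_lw[OF y(2)[unfolded I], of "[i]"] i by (simp add: I)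
    ultimately have "lop n i (p - y) + lop n i y \<in> Y" by (intro Y_add[OF Y_I])
    then show ?thesis by (simp add: lop_diff)
  qed
  have single_Y: "Poly_Mapping.single m 1 \<in> Y" if "m \<in> mon n" for m
    using that
  proof (induction "sum_list m" arbitrary: m rule: less_induct)
    case less
    show ?case
    proof (cases "\<exists>i<length m. m ! i \<noteq> 0")
      case False
      then have "m = 0 # 0 # replicate n 0 @ replicate n 0"
        using less.prems by (intro nth_equalityI) (auto simp: mon_def nth_Cons' nth_append)
      then show ?thesis by (intro Y_tmon) (auto simp: tmon_def)
    next
      case True
      then obtain i where i: "i < length m" "m ! i \<noteq> 0" by blast
      define m' where "m' = m[i := m ! i - 1]"
      have m': "inc i m' = m" "m' \<in> mon n" using i less.prems by (auto simp: m'_def inc_def mon_def)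
      have dec: "sum_list (l[k := l ! k - 1]) \<le> sum_list l" for l :: "nat list" and k
        by (induction l arbitrary: k) (auto split: nat.split)
      have "sum_list m = Suc (sum_list m')"
        using i elem_le_sum_list[OF i(1)] unfolding m'_def by (simp add: sum_list_update)
      moreover have "sum_list (low n i m') \<le> sum_list m'" unfolding low_def using dec by simp
      moreover have "low n i m' \<in> mon n" using m' by (simp add: mon_def)
      ultimately have "Poly_Mapping.single m' 1 \<in> Y" "Poly_Mapping.single (low n i m') 1 \<in> Y"
        using less.hyps m' by auto
      moreover have "Poly_Mapping.single m 1 = lop n i (Poly_Mapping.single m' 1) -
          scl (of_nat (kap n i m')) (Poly_Mapping.single (low n i m') (1 :: 'k))"
        using m' by (simp add: lop_single)
      moreover have "i < 2 * n + 2" using i less.prems by (simp add: mon_def)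
      ultimately show ?thesis by (metis Y_diff Y_scl lop_Y)
    qed
  qed
  have "u \<in> Y"
    using u
  proof (rule vec_single_induct)
    fix m and a :: 'k assume "m \<in> mon n"
    from Y_scl[OF single_Y[OF this], of a] show "Poly_Mapping.single m a \<in> Y" by simp
  qed (auto intro: Y_add Y_tmon)
  then show ?thesis by (simp add: Y_def)
qed


subsection \<open>The kernel\<close>

lemma mdeg_nth: "mdeg (Poly_Mapping.nth v) = sum_list v"
proof -
  have "mdeg (Poly_Mapping.nth v) = (\<Sum>i<length v. lookup (Poly_Mapping.nth v) i)"
    unfolding mdeg_def by (rule sum.mono_neutral_left) (auto simp: in_keys_iff lookup_nth_list split: if_splits)
  then show ?thesis by (simp add: lookup_nth_list sum_list_sum_nth atLeast0LessThan)
qed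

lemma nth_exponents: "var_ok n d v \<Longrightarrow> Poly_Mapping.nth v \<in> exponents n d"
  by (auto simp: exponents_def mdeg_nth var_ok_def in_keys_iff lookup_nth_list split: if_splits)

lemma exps_bij: "bij_betw Poly_Mapping.nth (set (exps n d)) (exponents n d)"
proof (rule bij_betwI')
  fix v w assume "v \<in> set (exps n d)" "w \<in> set (exps n d)"
  then show "(Poly_Mapping.nth v = Poly_Mapping.nth w) = (v = w)"
    by (auto simp: set_exps var_ok_def intro: nth_inj)
next
  fix v assume "v \<in> set (exps n d)"
  then show "Poly_Mapping.nth v \<in> exponents n d" by (simp add: set_exps nth_exponents)
next
  fix \<alpha> assume \<alpha>: "\<alpha> \<in> exponents n d"
  define v where "v = map (lookup \<alpha>) [0..<n]"
  have nth: "\<alpha> = Poly_Mapping.nth v"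
    using \<alpha> by (intro poly_mapping_eqI) (auto simp: lookup_nth_list v_def exponents_def in_keys_iff)
  then have "mdeg \<alpha> = sum_list v" by (metis mdeg_nth)
  then have "v \<in> set (exps n d)"
    using \<alpha> by (simp add: set_exps var_ok_def exponents_def) (simp add: v_def)
  with nth show "\<exists>v\<in>set (exps n d). \<alpha> = Poly_Mapping.nth v" by blast
qed

lemma sum_exps: "(\<Sum>v\<leftarrow>exps n d. g (Poly_Mapping.nth v)) = (\<Sum>\<alpha>\<in>exponents n d. g \<alpha>)"
  using sum.reindex_bij_betw[OF exps_bij, of g n d]
  by (simp add: sum_list_distinct_conv_sum_set[OF distinct_exps])

lemma finite_exponents: "finite (exponents n d)"
  using exps_bij[of n d] by (metis bij_betw_finite List.finite_set)

lemma sum_single_exponents: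
  assumes "keys f \<subseteq> exponents n d"
  shows "(\<Sum>\<alpha>\<in>exponents n d. Poly_Mapping.single \<alpha> (lookup f \<alpha>)) = f"
  using assms finite_exponents
  by (intro poly_mapping_eqI) (auto simp: lookup_sum lookup_single when_def in_keys_iff sum.delta)

definition at_point :: "((nat \<Rightarrow>\<^sub>0 nat) \<Rightarrow> 'k) \<Rightarrow> nat list \<Rightarrow> 'k" where
  "at_point c v = c (Poly_Mapping.nth v)"

definition ann_span :: "nat \<Rightarrow> nat \<Rightarrow> (nat, 'k::field) mpoly \<Rightarrow> 'k vec set" where
  "ann_span n d f = gen_span n (fval (at_point (lookup f)) ` insert (gen_s n d) (gen_d n d ` {..<n}))"

abbreviation nev :: "nat \<Rightarrow> (nat, 'k::idom) mpoly \<Rightarrow> 'k vec \<Rightarrow> (nat, 'k) mpoly poly" where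
  "nev n f \<equiv> letter_rep.ev (nop f n) (\<lambda>a. [:Const a:])"

lemma nop_word_tx:
  assumes "\<forall>i\<in>set w. i \<noteq> 1 \<and> i < n + 2"
  shows "\<exists>\<beta>. foldr (nop f n) w (monom (Poly_Mapping.single 0 1) 0) = monom (Poly_Mapping.single \<beta> 1) (count (mset w) 0) \<and>
    (\<forall>j. lookup \<beta> j = count (mset w) (j + 2))"
  using assms
proof (induction w)
  case Nil
  show ?case by (intro exI[of _ 0]) simp
next
  case (Cons i w)
  then obtain \<beta> where \<beta>: "foldr (nop f n) w (monom (Poly_Mapping.single 0 1) 0) = monom (Poly_Mapping.single \<beta> 1) (count (mset w) 0)"
    "\<forall>j. lookup \<beta> j = count (mset w) (j + 2)" by auto
  show ?case
  proof (cases "i = 0")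
    case True
    then show ?thesis using \<beta> by (intro exI[of _ \<beta>]) (simp add: nop_def[of f n 0] monom_Suc)
  next
    case False
    then show ?thesis using \<beta> Cons.prems
      by (intro exI[of _ "Poly_Mapping.single (i - 2) 1 + \<beta>"])
        (auto simp: nop_def[of f n i] Var_def mult_single smult_monom lookup_add lookup_single when_def)
  qed
qed

lemma nev_tmon:
  assumes "m \<in> tmon n"
  shows "nev n f (Poly_Mapping.single m a) = monom (Poly_Mapping.single (xpart n m) a) (m ! 0)"
proof -
  interpret N: letter_rep n "nop f n" "\<lambda>a. [:Const a:]" by (rule letter_rep_nop)
  have len: "length m = 2 * n + 2" using tmon_mon[OF assms] by (simp add: mon_def)
  obtain \<beta> where \<beta>: "foldr (nop f n) (word m) (monom (Poly_Mapping.single 0 1) 0) = monom (Poly_Mapping.single \<beta> 1) (count (mset (word m)) 0)"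
    "\<forall>j. lookup \<beta> j = count (mset (word m)) (j + 2)"
    using nop_word_tx[OF set_word_tmon[OF assms]] by blast
  have "count (mset (word m)) (j + 2) = (if j < n then m ! (j + 2) else 0)" for j
  proof (cases "j < n")
    case True
    then show ?thesis using len by (simp add: count_word)
  next
    case False
    then have "j + 2 \<notin> set (word m)" using set_word_tmon[OF assms] by fastforce
    then have "count (mset (word m)) (j + 2) = 0" by (metis count_mset_0_iff)
    then show ?thesis using False by simp
  qed
  then have "\<beta> = xpart n m"
    using \<beta>(2) len by (intro poly_mapping_eqI) (simp add: xpart_def lookup_nth_list add.commute)
  moreover have "count (mset (word m)) 0 = m ! 0" using len by (simp add: count_word)
  moreover have "monom (Poly_Mapping.single 0 1) 0 = (1 :: (nat, 'a) mpoly poly)" by simp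
  ultimately show ?thesis using \<beta>(1) by (simp add: N.ev_single smult_monom mult_single del: single_one)
qed

lemma fval_gen_s: "fval e (gen_s n d) = Poly_Mapping.single (unit_mon n 1) 1 +
    (\<Sum>v\<leftarrow>exps n d. Poly_Mapping.single (1 # 0 # v @ replicate n 0) (e v))"
  by (simp add: gen_s_def fval_def cval_def o_def unit_mon_def mult_2 del: replicate_Suc)

lemma fval_concat: "fval e (concat ps) = (\<Sum>p\<leftarrow>ps. fval e p)"
  by (induction ps) auto

lemma fval_gen_d: "fval e (gen_d n d i) = Poly_Mapping.single (unit_mon n (n + 2 + i)) 1 +
    (\<Sum>v\<leftarrow>exps n d. Poly_Mapping.single (1 # 0 # v[i := entry v i - 1] @ replicate n 0) (of_nat (entry v i) * e v))"
  by (simp add: gen_d_def fval_concat o_def fval_replicate cval_def unit_mon_def mult_2 del: replicate_Suc)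

lemma keys_sum_list: "\<forall>v\<in>set xs. keys (g v) \<subseteq> A \<Longrightarrow> keys (\<Sum>v\<leftarrow>xs. g v) \<subseteq> A"
proof (induction xs)
  case (Cons x xs)
  then show ?case using Poly_Mapping.keys_add[of "g x" "\<Sum>v\<leftarrow>xs. g v"] by auto
qed simp

context
  fixes n d :: nat and f :: "(nat, 'k::field_char_0) mpoly"
  assumes keys_f: "keys f \<subseteq> exponents n d"
begin

interpretation N: letter_rep n "nop f n" "\<lambda>a. [:Const a:]" by (rule letter_rep_nop)

lemma nev_unit: "i < 2 * n + 2 \<Longrightarrow> nev n f (Poly_Mapping.single (unit_mon n i) 1) = nop f n i 1"
proof -
  let ?z = "replicate (2 * n + 2) 0 :: nat list"
  assume i: "i < 2 * n + 2"
  have z: "?z = 0 # 0 # replicate n 0 @ replicate n 0"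
    by (simp add: replicate_add[symmetric] mult_2)
  then have zt: "?z \<in> tmon n" unfolding tmon_def by (intro CollectI exI[of _ 0] exI[of _ "replicate n 0"]) simp
  have "kap n i ?z = 0" using i by (auto simp: kap_def entry_def simp del: replicate_Suc)
  then have "lop n i (Poly_Mapping.single ?z (1 :: 'k)) = Poly_Mapping.single (unit_mon n i) 1"
    by (simp add: lop_single unit_mon_def del: replicate_Suc)
  moreover have "nev n f (Poly_Mapping.single ?z 1) = 1"
  proof -
    have "xpart n ?z = 0" unfolding z by (rule poly_mapping_eqI) (simp add: xpart_tmon lookup_nth_list)
    then show ?thesis using nev_tmon[OF zt, of f 1] z by simp
  qed
  moreover have "keys (Poly_Mapping.single ?z (1 :: 'k)) \<subseteq> mon n" using tmon_mon[OF zt] by simp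
  ultimately show ?thesis using N.ev_lop[of "Poly_Mapping.single ?z 1" i] i by simp
qed

lemma nev_sum_list: "nev n f (\<Sum>v\<leftarrow>xs. g v) = (\<Sum>v\<leftarrow>xs. nev n f (g v))"
  by (induction xs) (auto simp: N.ev_add)

lemma monom_sum_list: "(\<Sum>v\<leftarrow>xs. monom (g v) l) = monom (\<Sum>v\<leftarrow>xs. g v) l"
  by (induction xs) (auto simp: add_monom)

lemma gen_s_kernel: "nev n f (fval (at_point (lookup f)) (gen_s n d)) = 0"
proof -
  have t: "1 # 0 # v @ replicate n 0 \<in> tmon n" if "v \<in> set (exps n d)" for v
    using that by (auto simp: tmon_def set_exps var_ok_def)
  have "(\<Sum>v\<leftarrow>exps n d. nev n f (Poly_Mapping.single (1 # 0 # v @ replicate n 0) (at_point (lookup f) v))) =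
      (\<Sum>v\<leftarrow>exps n d. monom (Poly_Mapping.single (Poly_Mapping.nth v) (lookup f (Poly_Mapping.nth v))) 1)"
    using t by (intro arg_cong[of _ _ sum_list] map_cong)
      (auto simp: nev_tmon xpart_tmon at_point_def set_exps var_ok_def)
  also have "\<dots> = monom f 1"
    unfolding monom_sum_list sum_exps[of "\<lambda>\<alpha>. Poly_Mapping.single \<alpha> (lookup f \<alpha>)"]
    by (simp add: sum_single_exponents[OF keys_f])
  finally show ?thesis
    by (simp add: fval_gen_s N.ev_add nev_sum_list nev_unit nop_def monom_Suc monom_0)
qed

lemma gen_d_kernel:
  assumes "i < n"
  shows "nev n f (fval (at_point (lookup f)) (gen_d n d i)) = 0"
proof -
  let ?g = "\<lambda>\<alpha>. mpoly_deriv i (Poly_Mapping.single \<alpha> (lookup f \<alpha>))"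
  have t: "1 # 0 # v[i := entry v i - 1] @ replicate n 0 \<in> tmon n" if "v \<in> set (exps n d)" for v
    using that by (auto simp: tmon_def set_exps var_ok_def)
  have nth: "Poly_Mapping.nth (v[i := v ! i - Suc 0]) = Poly_Mapping.nth v - Poly_Mapping.single i (Suc 0)"
    if "length v = n" for v
    using that assms
    by (intro poly_mapping_eqI) (auto simp: lookup_nth_list lookup_minus lookup_single nth_list_update when_def)
  have "(\<Sum>v\<leftarrow>exps n d. nev n f (Poly_Mapping.single (1 # 0 # v[i := entry v i - 1] @ replicate n 0)
        (of_nat (entry v i) * at_point (lookup f) v))) = (\<Sum>v\<leftarrow>exps n d. monom (?g (Poly_Mapping.nth v)) 1)"
    using t assms by (intro arg_cong[of _ _ sum_list] map_cong)
      (auto simp: nev_tmon xpart_tmon at_point_def nth mpoly_deriv_single lookup_nth_list set_exps var_ok_def)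
  also have "\<dots> = monom (mpoly_deriv i (\<Sum>\<alpha>\<in>exponents n d. Poly_Mapping.single \<alpha> (lookup f \<alpha>))) 1"
    unfolding monom_sum_list sum_exps[of ?g] by (simp only: mpoly_deriv_sum)
  finally show ?thesis
    using assms
    by (simp add: fval_gen_d N.ev_add nev_sum_list nev_unit nop_def monom_Suc monom_0 sum_single_exponents[OF keys_f]
        coeff_deriv_1)
qed

text \<open>The generators act as zero on \<open>1\<close>. Conversely an element of the kernel is congruent to some \<open>y\<close> in
  \<open>R[t]\<close>, which again evaluates to zero; but \<open>y\<close> evaluates to itself.\<close>

lemma ann_span_iff_kernel:
  assumes u: "keys u \<subseteq> mon n"
  shows "u \<in> ann_span n d f \<longleftrightarrow> nev n f u = 0"
proof -
  let ?e = "at_point (lookup f)"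
  let ?X = "fval ?e ` insert (gen_s n d) (gen_d n d ` {..<n})"
  have keys: "keys v \<subseteq> mon n" "nev n f v = 0" if v: "v \<in> ?X" for v
  proof -
    obtain p where p: "v = fval ?e p" "graded n d 0 p" using v graded_gens by blast
    then show "keys v \<subseteq> mon n" using keys_fval[of ?e p] by (auto simp: graded_def)
    show "nev n f v = 0" using v gen_s_kernel gen_d_kernel by auto
  qed
  have word_0: "foldr (nop f n) w 0 = 0" for w by (induction w) simp_all
  have sub: "nev n f p = 0" if "p \<in> ann_span n d f" for p
    using that unfolding ann_span_def gen_span_def
  proof (induction rule: vec.span_induct_alt)
    case (step c x y)
    then obtain w v where "x = lw n w v" "v \<in> ?X" "set w \<subseteq> indices n" by blast
    with step keys[of v] show ?case by (simp add: N.ev_add N.ev_scl N.ev_lw word_0)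
  qed simp
  show ?thesis
  proof
    assume 0: "nev n f u = 0"
    have "\<exists>y. keys y \<subseteq> tmon n \<and> u - y \<in> ann_span n d f"
    proof (rule reduce_to_tmon[OF ann_span_def _ u])
      fix i assume i: "i = 1 \<or> n + 2 \<le> i \<and> i < 2 * n + 2"
      show "\<exists>y. keys y \<subseteq> tmon n \<and> Poly_Mapping.single (unit_mon n i) 1 + y \<in> ann_span n d f"
      proof (cases "i = 1")
        case True
        have "fval ?e (gen_s n d) \<in> ann_span n d f" unfolding ann_span_def by (intro gen_span_base) auto
        then show ?thesis
          using True unfolding fval_gen_s
          by (intro exI conjI) (auto intro!: keys_sum_list simp: tmon_def set_exps var_ok_def split: if_splits)
      next
        case False
        then obtain k where k: "i = n + 2 + k" "k < n" using i by (metis add_less_cancel_left le_Suc_ex mult_2 add.assoc add.commute)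
        have "fval ?e (gen_d n d k) \<in> ann_span n d f" unfolding ann_span_def using k by (intro gen_span_base) auto
        then show ?thesis
          using k unfolding fval_gen_d
          by (intro exI conjI) (auto intro!: keys_sum_list simp: tmon_def set_exps var_ok_def split: if_splits)
      qed
    qed
    then obtain y where y: "keys y \<subseteq> tmon n" "u - y \<in> ann_span n d f" by blast
    have ev0: "nev n f y = 0" using sub[OF y(2)] 0 by (simp add: N.ev_diff)
    have "y = 0"
    proof (rule ccontr)
      assume "y \<noteq> 0"
      then obtain m0 where m0: "m0 \<in> keys y" by (meson keys_eq_empty ex_in_conv)
      have "lookup (coeff (nev n f v) (m0 ! 0)) (xpart n m0) = lookup v m0" if "keys v \<subseteq> tmon n" for v
        using that
      proof (rule vec_single_induct)
        fix m and a :: 'k assume m: "m \<in> tmon n"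
        show "lookup (coeff (nev n f (Poly_Mapping.single m a)) (m0 ! 0)) (xpart n m0) = lookup (Poly_Mapping.single m a) m0"
          using tmon_inj[OF m, of m0] m0 y(1) by (auto simp: nev_tmon[OF m] lookup_single when_def)
      qed (simp_all add: N.ev_add lookup_add)
      from this[OF y(1)] ev0 m0 show False by (simp add: in_keys_iff)
    qed
    with y(2) show "u \<in> ann_span n d f" by simp
  qed (rule sub)
qed

end

subsection \<open>From \<open>R[t]\<close> to the module generated by \<open>f^s\<close>\<close>

text \<open>As \<open>t\<close> maps \<open>g(s) f^s\<close> to \<open>- s g(s-1) f^(s-1)\<close>, the power \<open>t^j\<close> maps \<open>f^s\<close> to
  \<open>(- 1)^j s (s - 1) \<dots> (s - j + 1) f^(s-j)\<close>.\<close>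

abbreviation "fract_s \<equiv> to_fract [:0, 1 :: (nat, 'k::idom) mpoly:]"

primrec tpow :: "(nat, 'k::idom) mpoly \<Rightarrow> nat \<Rightarrow> (nat, 'k) mpoly poly fract" where
  "tpow f 0 = 1"
| "tpow f (Suc j) = tpow f j * (of_nat j - fract_s) * inverse (to_fract [:f:])"

text \<open>This map transports the question whether an operator annihilates \<open>f^s\<close> to \<open>R[t]\<close>, where \<open>t\<close> acts by a
  plain multiplication; it commutes with the action of \<open>A_n[s]\<close>.\<close>

definition phi :: "(nat, 'k::idom) mpoly \<Rightarrow> (nat, 'k) mpoly poly \<Rightarrow> (nat, 'k) mpoly poly fract" where
  "phi f h = (\<Sum>j\<le>degree h. to_fract [:coeff h j:] * tpow f j)"

lemma phi_bound: "degree h \<le> K \<Longrightarrow> phi f h = (\<Sum>j\<le>K. to_fract [:coeff h j:] * tpow f j)"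
  unfolding phi_def by (rule sum.mono_neutral_left) (auto simp: coeff_eq_0 simp flip: Zero_fract_def)

lemma phi_add: "phi f (g + h) = phi f g + phi f h"
proof -
  let ?K = "max (degree g) (degree h)"
  have "to_fract [:a + b:] = to_fract [:a:] + to_fract [:b :: (nat, 'a) mpoly:]" for a b by simp
  then show ?thesis
    by (simp add: phi_bound[of _ ?K] degree_add_le distrib_right sum.distrib del: add_fract)
qed

lemma phi_monom: "phi f (monom g j) = to_fract [:g:] * tpow f j"
proof -
  have "phi f (monom g j) = (\<Sum>i\<le>j. to_fract [:coeff (monom g j) i:] * tpow f i)"
    by (rule phi_bound) (rule degree_monom_le)
  also have "\<dots> = (\<Sum>i\<in>{j}. to_fract [:coeff (monom g j) i:] * tpow f i)"
    by (rule sum.mono_neutral_right) (auto simp flip: Zero_fract_def)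
  finally show ?thesis by simp
qed

lemma poly_monom_induct:
  assumes "P 0" "\<And>a j. P (monom a j)" "\<And>p q. P p \<Longrightarrow> P q \<Longrightarrow> P (p + q)"
  shows "P (h :: 'a::comm_monoid_add poly)"
proof -
  have "P (\<Sum>i\<in>A. monom (coeff h i) i)" if "finite A" for A
    using that by (induction A) (auto simp: assms)
  from this[of "{..degree h}"] show ?thesis by (simp add: poly_as_sum_of_monoms)
qed

lemma phi_0 [simp]: "phi f 0 = 0" using phi_monom[of f 0 0] by (simp flip: Zero_fract_def)

lemma phi_diff: "phi f (g - h) = phi f g - phi f h"
  using phi_add[of f "g - h" h] by (simp add: algebra_simps)

lemma to_fract_mult_const: "to_fract [:a * b:] = to_fract [:a:] * to_fract [:b :: (nat, 'k::idom) mpoly:]"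
  by (simp add: mult.commute[of a b])

lemma to_fract_eq_0: "to_fract a = 0 \<longleftrightarrow> a = 0"
  unfolding Zero_fract_def by (subst eq_fract(1)) auto

lemma phi_const_mult: "phi f ([:a:] * h) = to_fract [:a:] * phi f h"
proof (induction h rule: poly_monom_induct)
  case (2 g j)
  have "[:a:] * monom g j = monom (a * g) j" by (simp add: smult_monom)
  then show ?case by (simp only: phi_monom to_fract_mult_const mult.assoc)
qed (simp_all add: distrib_left phi_add smult_add_right)

lemma of_nat_fract: "to_fract [:of_nat k:] = (of_nat k :: (nat, 'k::idom) mpoly poly fract)"
proof (induction k)
  case (Suc k)
  have "to_fract [:of_nat (Suc k) :: (nat, 'k) mpoly:] = to_fract [:of_nat k:] + 1"
    by (simp add: One_fract_def one_pCons add.commute)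
  then show ?case using Suc by simp
qed (simp add: fract_collapse)

lemma fract_deriv_simps:
  fixes a :: "(nat, 'k::idom) mpoly" and g h :: "(nat, 'k) mpoly poly fract"
  shows
  "fract_deriv i (to_fract [:a:]) = to_fract [:mpoly_deriv i a:]"
  "fract_deriv i (fract_s :: (nat, 'k) mpoly poly fract) = 0"
  "fract_deriv i (of_nat k :: (nat, 'k) mpoly poly fract) = 0" "fract_deriv i (1 :: (nat, 'k) mpoly poly fract) = 0"
  "fract_deriv i (g - h) = fract_deriv i g - fract_deriv i h"
proof -
  show 1: "fract_deriv i (to_fract [:a:]) = to_fract [:mpoly_deriv i a:]" for a :: "(nat, 'k) mpoly"
    by (simp add: fract_deriv_Fract coeff_deriv_1 coeff_deriv_simps)
  show "fract_deriv i (fract_s :: (nat, 'k) mpoly poly fract) = 0"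
    by (simp add: fract_deriv_Fract coeff_deriv_1 coeff_deriv_simps fract_collapse)
  have "mpoly_deriv i (of_nat k :: (nat, 'k) mpoly) = 0" for k by (induction k) (simp_all add: mpoly_deriv_add)
  then show 2: "fract_deriv i (of_nat k :: (nat, 'k) mpoly poly fract) = 0" for k
    using 1[of "of_nat k"] by (simp add: of_nat_fract fract_collapse)
  show "fract_deriv i (1 :: (nat, 'k) mpoly poly fract) = 0" using 2[of 1] by simp
  show "fract_deriv i (g - h) = fract_deriv i g - fract_deriv i h"
    using fract_deriv_add[of i "g - h" h] by (simp add: algebra_simps)
qed

text \<open>The ring identities behind the next lemmas, with \<open>j\<close> for a natural number, \<open>u\<close> for
  \<open>t^j f^s\<close>, \<open>b\<close> for \<open>1/f\<close> and \<open>a\<close> for \<open>\<partial>_i f\<close>.\<close>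

lemma ring_identities:
  fixes a b j s u g g' f v :: "'r::comm_ring_1"
  shows "(- j * a * b * u * (j - s) + u * (0 - 0)) * b + u * (j - s) * (- a * b * b) = - (1 + j) * a * b * (u * (j - s) * b)"
    "j * g * u - f * g * v = g * (j * u - f * v)"
    "g * (j * u - u * (j - s)) = s * (g * u)"
    "g' * u - a * g * (u * (j - s) * b) = g' * u + g * (- j * a * b * u) + s * (a * b) * (g * u)"
  by (simp_all add: algebra_simps)

lemma derivation_of_inverse:
  fixes x y a z :: "'r::comm_ring_1"
  assumes "x * y = 1" "a * y + x * z = 0"
  shows "z = - a * y * y"
proof -
  have xz: "x * z = - (a * y)" using assms(2) by (simp add: eq_neg_iff_add_eq_0 add.commute)
  have "z = (x * y) * z" using assms(1) by simp
  also have "\<dots> = y * (x * z)" by (simp only: mult_ac)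
  finally show ?thesis unfolding xz by (simp add: mult_ac)
qed

context
  fixes f :: "(nat, 'k::field_char_0) mpoly"
  assumes f: "f \<noteq> 0"
begin

lemma to_fract_f: "to_fract [:f:] \<noteq> 0"
  using f by (simp add: to_fract_eq_0)

lemma fract_deriv_inverse:
  "fract_deriv i (inverse (to_fract [:f:])) = - to_fract [:mpoly_deriv i f:] * inverse (to_fract [:f:]) * inverse (to_fract [:f:])"
proof -
  let ?F = "to_fract [:f:]" and ?G = "inverse (to_fract [:f:])"
  have FG: "?F * ?G = 1" using to_fract_f by (rule right_inverse)
  have "to_fract [:mpoly_deriv i f:] * ?G + ?F * fract_deriv i ?G = 0"
    using arg_cong[OF FG, of "fract_deriv i"] by (simp only: fract_deriv_mult fract_deriv_simps)
  with FG show ?thesis by (rule derivation_of_inverse)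
qed

lemma tpow_deriv: "fract_deriv i (tpow f j) =
    - of_nat j * to_fract [:mpoly_deriv i f:] * inverse (to_fract [:f:]) * tpow f j"
proof (induction j)
  case (Suc j)
  show ?case
    unfolding tpow.simps fract_deriv_mult fract_deriv_simps fract_deriv_inverse Suc of_nat_Suc
    by (rule ring_identities(1))
qed (simp add: fract_deriv_simps)

lemma tpow_Suc_f: "to_fract [:f:] * tpow f (Suc j) = tpow f j * (of_nat j - fract_s)"
  using to_fract_f by (simp del: mult_fract inverse_fract)

lemma nop_monom:
  "nop f n 1 (monom g j) = monom (of_nat j * g) j - monom (f * g) (Suc j)"
  "nop f n (n + 2 + i) (monom g j) = monom (mpoly_deriv i g) j - monom (mpoly_deriv i f * g) (Suc j)"
proof -
  have t: "[:0, 1:] * monom a k = monom a (Suc k)" for a :: "(nat, 'k) mpoly" and k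
    by (simp add: monom_Suc)
  have pd: "[:0, 1:] * pderiv (monom g j) = monom (of_nat j * g) j"
    by (cases j) (simp_all add: pderiv_monom t del: mult_pCons_left)
  have c: "[:a:] * [:0, 1:] * monom g j = monom (a * g) (Suc j)" for a
    by (simp only: mult.assoc t) (simp add: smult_monom)
  show "nop f n 1 (monom g j) = monom (of_nat j * g) j - monom (f * g) (Suc j)"
    unfolding nop_def c pd by simp
  have "coeff_deriv i (monom g j) = monom (mpoly_deriv i g) j" by (simp add: map_poly_monom)
  then show "nop f n (n + 2 + i) (monom g j) = monom (mpoly_deriv i g) j - monom (mpoly_deriv i f * g) (Suc j)"
    unfolding nop_def by (simp add: c del: mult_pCons_left mult_pCons_right)
qed

lemma phi_nop_s: "phi f (nop f n 1 h) = fract_s * phi f h"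
proof (induction h rule: poly_monom_induct)
  case (2 g j)
  have "phi f (nop f n 1 (monom g j)) =
      to_fract [:g:] * (of_nat j * tpow f j - to_fract [:f:] * tpow f (Suc j))"
    unfolding nop_monom phi_diff phi_monom to_fract_mult_const of_nat_fract by (rule ring_identities(2))
  also have "\<dots> = fract_s * phi f (monom g j)"
    unfolding tpow_Suc_f phi_monom by (rule ring_identities(3))
  finally show ?case .
next
  case (3 p q)
  then show ?case
    by (simp only: letter_rep.L_add[OF letter_rep_nop] phi_add distrib_left)
qed (simp add: letter_rep.L_0[OF letter_rep_nop])

lemma fs_letter_D: "fs_letter f (LD i) h =
    fract_deriv i h + fract_s * (to_fract [:mpoly_deriv i f:] * inverse (to_fract [:f:])) * h"
  using f by (simp add: fs_letter_def)

lemma phi_nop_D: "phi f (nop f n (n + 2 + i) h) = fs_letter f (LD i) (phi f h)"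
proof (induction h rule: poly_monom_induct)
  case 1
  have "fract_deriv i 0 = 0" using fract_deriv_simps(5)[of i 0 0] by simp
  then show ?case by (simp add: letter_rep.L_0[OF letter_rep_nop] fs_letter_D)
next
  case (2 g j)
  show ?case
    unfolding nop_monom phi_diff phi_monom to_fract_mult_const fs_letter_D tpow.simps fract_deriv_mult tpow_deriv
      fract_deriv_simps
    by (rule ring_identities(4))
next
  case (3 p q)
  then show ?case
    by (simp only: letter_rep.L_add[OF letter_rep_nop] phi_add fs_letter_D fract_deriv_add distrib_left) (simp add: add_ac)
qed

text \<open>The numerator of \<open>t^j f^s\<close> has degree \<open>j\<close> in \<open>s\<close>; hence the images of the \<open>t^j\<close> are
  independent over \<open>R\<close>.\<close>

lemma phi_eq_0: "phi f h = 0 \<Longrightarrow> h = 0"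
proof (rule ccontr)
  assume phi: "phi f h = 0" and h: "h \<noteq> 0"
  define r where "r j = (\<Prod>i<j. [:of_nat i, - 1 :: (nat, 'k) mpoly:])" for j
  have deg: "degree (r j) = j \<and> coeff (r j) j = (- 1) ^ j" for j
  proof (induction j)
    case (Suc j)
    have nz: "r j \<noteq> 0" by (simp add: r_def)
    have r: "r (Suc j) = r j * [:of_nat j, - 1:]" by (simp add: r_def)
    have "degree (r (Suc j)) = Suc j" unfolding r using Suc nz by (subst degree_mult_eq) auto
    moreover have "coeff (r (Suc j)) (Suc j) = coeff (r j) j * (- 1)"
      unfolding r using Suc coeff_mult_degree_sum[of "r j" "[:of_nat j, - 1:]"] by simp
    ultimately show ?case using Suc by simp
  qed (simp add: r_def)
  have tpow: "to_fract [:f ^ j:] * tpow f j = to_fract (r j)" for j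
  proof (induction j)
    case 0
    show ?case by (simp add: r_def One_fract_def one_pCons)
  next
    case (Suc j)
    have "to_fract [:f ^ Suc j:] * tpow f (Suc j) = to_fract [:f ^ j:] * (to_fract [:f:] * tpow f (Suc j))"
      by (simp only: power_Suc2 to_fract_mult_const mult.assoc)
    also have "\<dots> = to_fract (r j) * (of_nat j - fract_s)"
      unfolding tpow_Suc_f using Suc by (simp only: mult.assoc[symmetric])
    also have "of_nat j - fract_s = to_fract [:of_nat j, - 1 :: (nat, 'k) mpoly:]"
      unfolding of_nat_fract[symmetric] by simp
    finally show ?case by (simp add: r_def mult.commute)
  qed
  let ?D = "degree h"
  define P where "P = (\<Sum>j\<le>?D. [:coeff h j * f ^ (?D - j):] * r j)"
  have "to_fract [:f ^ ?D:] * phi f h = (\<Sum>j\<le>?D. to_fract ([:coeff h j * f ^ (?D - j):] * r j))"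
    unfolding phi_def sum_distrib_left
  proof (rule sum.cong)
    fix j assume "j \<in> {..?D}"
    then have "f ^ ?D = f ^ (?D - j) * f ^ j" by (simp flip: power_add)
    then have "to_fract [:f ^ ?D:] * (to_fract [:coeff h j:] * tpow f j) =
        to_fract [:coeff h j * f ^ (?D - j):] * (to_fract [:f ^ j:] * tpow f j)"
      by (simp only: to_fract_mult_const mult_ac)
    then show "to_fract [:f ^ ?D:] * (to_fract [:coeff h j:] * tpow f j) = to_fract ([:coeff h j * f ^ (?D - j):] * r j)"
      by (simp only: tpow to_fract_mult)
  qed simp
  also have "\<dots> = to_fract P"
  proof -
    have "(\<Sum>j\<in>A. to_fract (g j)) = to_fract (\<Sum>j\<in>A. g j)" if "finite A" for A and g :: "nat \<Rightarrow> (nat, 'k) mpoly poly"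
      using that by (induction A) (simp_all add: fract_collapse)
    then show ?thesis by (simp add: P_def)
  qed
  finally have "P = 0" using phi by (simp add: to_fract_eq_0)
  moreover have "coeff P ?D = coeff h ?D * (- 1) ^ ?D"
  proof -
    have "coeff P ?D = (\<Sum>j\<le>?D. coeff h j * f ^ (?D - j) * coeff (r j) ?D)"
      by (simp add: P_def coeff_sum)
    also have "\<dots> = (\<Sum>j\<in>{?D}. coeff h j * f ^ (?D - j) * coeff (r j) ?D)"
    proof (rule sum.mono_neutral_right)
      show "\<forall>j\<in>{..?D} - {?D}. coeff h j * f ^ (?D - j) * coeff (r j) ?D = 0"
        using deg by (auto simp: coeff_eq_0)
    qed auto
    finally show ?thesis using deg by simp
  qed
  ultimately show False using h by (simp add: leading_coeff_0_iff)
qed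

end

section \<open>The Weyl algebra and its elements in normal form\<close>

lemma weyl_const_add: "weyl_const (a + b) = weyl_const a + weyl_const b"
  by (simp add: weyl_const_def plus_weyl.abs_eq single_add)

lemma weyl_const_mult: "weyl_const (a * b) = weyl_const a * weyl_const b"
  by (simp add: weyl_const_def times_weyl.abs_eq mult_single)

lemma weyl_const_1: "weyl_const 1 = 1"
  by (simp add: weyl_const_def one_weyl.abs_eq)

lemma weyl_const_0: "weyl_const 0 = 0"
  by (simp add: weyl_const_def zero_weyl.abs_eq)

lemma weyl_const_letter: "weyl_letter l * weyl_const a = weyl_const a * weyl_letter l"
  by (simp add: weyl_const_def weyl_letter_def times_weyl.abs_eq mult_single)

lemma weyl_const_central: "weyl_const a * weyl_const b = weyl_const b * weyl_const a"
  by (simp add: mult.commute flip: weyl_const_mult)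

lemma weyl_XX: "weyl_letter (LX i) * weyl_letter (LX j) = weyl_letter (LX j) * weyl_letter (LX i)"
  using weyl_relations.XX[of i j]
  by (simp add: weyl_letter_def times_weyl.abs_eq weyl.abs_eq_iff weyl_eq_def)

lemma weyl_DD: "weyl_letter (LD i) * weyl_letter (LD j) = weyl_letter (LD j) * weyl_letter (LD i)"
  using weyl_relations.DD[of i j]
  by (simp add: weyl_letter_def times_weyl.abs_eq weyl.abs_eq_iff weyl_eq_def)

text \<open>The Weyl algebra has no \<open>t\<close>; letting it act as zero gives a representation all the same.\<close>

definition wop :: "nat \<Rightarrow> nat \<Rightarrow> 'k::comm_ring_1 poly weyl \<Rightarrow> 'k poly weyl" where
  "wop n i h = (if i = 0 then 0 else if i = 1 then weyl_const [:0, 1:] * h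
     else if i < n + 2 then weyl_letter (LX (i - 2)) * h else weyl_letter (LD (i - n - 2)) * h)"

lemma letter_rep_wop: "letter_rep n (wop n) (\<lambda>a :: 'k::comm_ring_1. weyl_const [:a:])"
proof
  fix i j :: nat and g h :: "'k poly weyl" and a b :: 'k
  show "wop n i (g + h) = wop n i g + wop n i h"
    by (simp add: wop_def distrib_left)
  show "wop n i (weyl_const [:a:] * h) = weyl_const [:a:] * wop n i h"
    by (simp add: wop_def weyl_const_letter weyl_const_central[of "[:a:]"] flip: mult.assoc)
  show "weyl_const [:a + b:] = weyl_const [:a:] + weyl_const [:b:]" by (simp flip: weyl_const_add)
  show "weyl_const [:a * b:] = weyl_const [:a:] * weyl_const [:b:]"
    by (simp add: mult.commute[of a b] flip: weyl_const_mult)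
  show "weyl_const [:1 :: 'k:] = 1" by (simp add: weyl_const_1 flip: one_pCons)
  assume ij: "j < i" "i < 2 * n + 2"
  show "wop n i (wop n j h) = wop n j (wop n i h) +
      (if i = 1 then wop n 0 h else if n + 2 \<le> i \<and> j = i - n then h else 0)"
  proof (cases "j = 0")
    case False
    consider "j = 1" | "2 \<le> j" "i < n + 2" | "2 \<le> j" "j < n + 2" "n + 2 \<le> i" | "n + 2 \<le> j"
      using False by linarith
    then show ?thesis
    proof cases
      case 1
      have "i < n + 2 \<or> Suc 0 \<noteq> i - n" by linarith
      with 1 show ?thesis using ij
        by (auto simp: wop_def weyl_const_letter simp flip: mult.assoc)
    next
      case 2
      then show ?thesis using ij
        by (simp add: wop_def weyl_XX[of "j - 2"] flip: mult.assoc)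
    next
      case 3
      have "i - n - 2 = j - 2 \<longleftrightarrow> j = i - n" using 3 by linarith
      then show ?thesis using ij 3 weyl_DX[of "i - n - 2" "j - 2", where 'a = "'k poly"]
        by (auto simp: wop_def distrib_right simp flip: mult.assoc)
    next
      case 4
      then obtain a b where "i = n + 2 + a" "j = n + 2 + b" "j \<noteq> i - n"
        using ij that[of "i - (n + 2)" "j - (n + 2)"] by linarith
      then show ?thesis using ij
        by (simp add: wop_def weyl_DD[of b a] flip: mult.assoc)
    qed
  qed (use ij in \<open>simp add: wop_def\<close>)
qed

abbreviation wev :: "nat \<Rightarrow> 'k::comm_ring_1 vec \<Rightarrow> 'k poly weyl" where
  "wev n \<equiv> letter_rep.ev (wop n) (\<lambda>a. weyl_const [:a:])"

text \<open>The monomials without \<open>t\<close>; they span the normal forms of \<open>A_n[s]\<close>.\<close>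

definition mon0 :: "nat \<Rightarrow> nat list set" where
  "mon0 n = {m \<in> mon n. m ! 0 = 0}"

lemma lop_mon0:
  assumes "keys u \<subseteq> mon0 n" "i \<noteq> 0"
  shows "keys (lop n i u) \<subseteq> mon0 n"
  using assms(1)
proof (rule vec_single_induct)
  fix m and a :: 'a assume m: "m \<in> mon0 n"
  then have "m \<noteq> []" by (auto simp: mon0_def mon_def)
  then have "inc i m \<in> mon0 n" "kap n i m \<noteq> 0 \<Longrightarrow> low n i m \<in> mon0 n"
    using m assms(2) by (auto simp: mon0_def mon_def inc_def low_def kap_def nth_list_update split: if_splits)
  then have "keys (Poly_Mapping.single (inc i m) a) \<subseteq> mon0 n"
    "keys (Poly_Mapping.single (low n i m) (of_nat (kap n i m) * a)) \<subseteq> mon0 n"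
    by (cases "kap n i m = 0"; auto)+
  then show "keys (lop n i (Poly_Mapping.single m a)) \<subseteq> mon0 n"
    unfolding lop_single by (intro order_trans[OF Poly_Mapping.keys_add]) auto
next
  fix p q :: "'a vec" assume "keys (lop n i p) \<subseteq> mon0 n" "keys (lop n i q) \<subseteq> mon0 n"
  then show "keys (lop n i (p + q)) \<subseteq> mon0 n"
    unfolding lop_add by (intro order_trans[OF Poly_Mapping.keys_add]) auto
qed simp

lemma mon0_mon: "keys u \<subseteq> mon0 n \<Longrightarrow> keys u \<subseteq> mon n"
  by (auto simp: mon0_def)

lemma weyl_const_over: "weyl_const c \<in> weyl_over n UNIV"
  by (rule weyl_over.const) simp

lemma wop_over:
  assumes "h \<in> weyl_over n UNIV" "i < 2 * n + 2"
  shows "wop n i h \<in> weyl_over n UNIV"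
proof -
  have "0 \<in> weyl_over n (UNIV :: 'a poly set)" using weyl_const_over[of 0] by (simp add: weyl_const_0)
  then show ?thesis using assms unfolding wop_def
    by (auto intro!: weyl_over.mult weyl_over.X weyl_over.D weyl_const_over)
qed

lemma wop_word_over:
  "set w \<subseteq> indices n \<Longrightarrow> h \<in> weyl_over n UNIV \<Longrightarrow> foldr (wop n) w h \<in> weyl_over n UNIV"
  by (induction w) (auto intro: wop_over)

lemma one_over: "1 \<in> weyl_over n UNIV"
  using weyl_const_over[of 1] by (simp add: weyl_const_1)

lemma wev_over:
  assumes "keys u \<subseteq> mon n"
  shows "wev n u \<in> weyl_over n UNIV"
  using assms
proof (rule vec_single_induct)
  interpret W: letter_rep n "wop n" "\<lambda>a :: 'a. weyl_const [:a:]" by (rule letter_rep_wop)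
  show "wev n (0 :: 'a vec) \<in> weyl_over n UNIV" using weyl_const_over[of 0] by (simp add: weyl_const_0)
  fix m and a :: 'a assume "m \<in> mon n"
  then have "set (word m) \<subseteq> indices n" using set_word[of m] by (simp add: mon_def)
  then show "wev n (Poly_Mapping.single m a) \<in> weyl_over n UNIV"
    unfolding W.ev_single by (intro weyl_over.mult weyl_const_over wop_word_over one_over)
next
  interpret W: letter_rep n "wop n" "\<lambda>a :: 'a. weyl_const [:a:]" by (rule letter_rep_wop)
  fix p q :: "'a vec" assume "wev n p \<in> weyl_over n UNIV" "wev n q \<in> weyl_over n UNIV"
  then show "wev n (p + q) \<in> weyl_over n UNIV" unfolding W.ev_add by (rule weyl_over.add)
qed

lemma keys_scl: "keys (scl a u) \<subseteq> keys u"
  by (auto simp: in_keys_iff)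

text \<open>Every element of \<open>A_n[s]\<close> has a normal form: the elements that map normal forms to normal forms by left
  multiplication contain the constants and the letters, and are closed under sums and products.\<close>

lemma wev_surj:
  fixes P :: "'k::comm_ring_1 poly weyl"
  assumes "P \<in> weyl_over n UNIV"
  shows "\<exists>u. keys u \<subseteq> mon0 n \<and> P = wev n u"
proof -
  interpret W: letter_rep n "wop n" "\<lambda>a :: 'k. weyl_const [:a:]" by (rule letter_rep_wop)
  have add: "keys (p + q) \<subseteq> mon0 n" if "keys p \<subseteq> mon0 n" "keys q \<subseteq> mon0 n" for p q :: "'k vec"
    using that Poly_Mapping.keys_add[of p q] by blast
  have lop: "\<exists>u'. keys u' \<subseteq> mon0 n \<and> wop n i (wev n u) = wev n u'"
    if "keys u \<subseteq> mon0 n" "i \<noteq> 0" "i < 2 * n + 2" for i and u :: "'k vec"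
    using that lop_mon0 W.ev_lop[OF mon0_mon, of u i] by metis
  have "\<exists>u'. keys u' \<subseteq> mon0 n \<and> P * wev n u = wev n u'" if "keys u \<subseteq> mon0 n" for u
    using assms that
  proof (induction arbitrary: u rule: weyl_over.induct)
    case (const c)
    from const.prems show ?case
    proof (induction c arbitrary: u)
      case 0
      show ?case by (intro exI[of _ 0]) (simp add: weyl_const_0)
    next
      case (pCons a c)
      obtain u1 where u1: "keys u1 \<subseteq> mon0 n" "weyl_const c * wev n u = wev n u1"
        using pCons by blast
      obtain u2 where u2: "keys u2 \<subseteq> mon0 n" "wop n 1 (wev n u1) = wev n u2"
        using lop[OF u1(1), of 1] by auto
      have "pCons a c = [:a:] + [:0, 1:] * c" by simp
      then have "weyl_const (pCons a c) = weyl_const [:a:] + weyl_const [:0, 1:] * weyl_const c"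
        by (metis weyl_const_add weyl_const_mult)
      then have "weyl_const (pCons a c) * wev n u = weyl_const [:a:] * wev n u + weyl_const [:0, 1:] * (weyl_const c * wev n u)"
        by (simp add: distrib_right mult.assoc)
      also have "\<dots> = wev n (scl a u + u2)"
        using u1 u2 by (simp add: W.ev_add W.ev_scl wop_def)
      finally show ?case using add[of "scl a u" u2] keys_scl[of a u] u2 pCons.prems by blast
    qed
  next
    case (X i)
    then have "wop n (i + 2) (wev n u) = weyl_letter (LX i) * wev n u" by (simp add: wop_def[of n "Suc (Suc i)"])
    with X show ?case using lop[of u "i + 2"] by auto
  next
    case (D i)
    have "wop n (n + 2 + i) (wev n u) = weyl_letter (LD i) * wev n u" by (simp add: wop_def[of n "Suc (Suc (n + i))"])
    with D show ?case using lop[of u "n + 2 + i"] by auto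
  next
    case (add P Q)
    then obtain u1 u2 where "keys u1 \<subseteq> mon0 n" "P * wev n u = wev n u1" "keys u2 \<subseteq> mon0 n" "Q * wev n u = wev n u2"
      by meson
    then show ?case by (intro exI[of _ "u1 + u2"]) (simp add: W.ev_add distrib_right \<open>\<And>p q. _ \<Longrightarrow> _ \<Longrightarrow> keys (p + q) \<subseteq> mon0 n\<close>)
  next
    case (mult P Q)
    then show ?case by (metis mult.assoc)
  qed
  moreover obtain u1 :: "'k vec" where "keys u1 \<subseteq> mon0 n" "wev n u1 = 1"
  proof
    let ?z = "replicate (2 * n + 2) 0 :: nat list"
    show "keys (Poly_Mapping.single ?z (1 :: 'k)) \<subseteq> mon0 n" by (simp add: mon0_def mon_def)
    have "word ?z = []" by (simp add: word_def del: replicate_Suc upt_Suc cong: map_cong)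
    then show "wev n (Poly_Mapping.single ?z (1 :: 'k)) = 1" by (simp add: W.ev_single weyl_const_1 flip: one_pCons)
  qed
  ultimately show ?thesis by (metis mult_1_right)
qed

section \<open>The action on \<open>f^s\<close>\<close>

lemma fs_act_word:
  fixes f :: "(nat, 'k::field_char_0) mpoly"
  assumes f: "f \<noteq> 0" and w: "set w \<subseteq> indices n - {0}"
  shows "fs_act f (foldr (wop n) w 1) 1 = phi f (foldr (nop f n) w 1)"
  using w
proof (induction w)
  case Nil
  have "phi f 1 = 1" using phi_monom[of f 1 0] by (simp add: One_fract_def flip: one_pCons)
  then show ?case by (simp add: fs_act_1)
next
  case (Cons i w)
  let ?P = "foldr (wop n) w 1" and ?h = "foldr (nop f n) w 1"
  consider "i = 1" | "2 \<le> i" "i < n + 2" | "n + 2 \<le> i" "i < 2 * n + 2" "i \<noteq> 1" using Cons.prems by force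
  then show ?case
  proof cases
    case 1
    have "map_poly Const [:0, 1 :: 'k:] = ([:0, 1:] :: (nat, 'k) mpoly poly)" by (simp add: map_poly_pCons)
    then show ?thesis using 1 Cons
      by (simp add: wop_def[of n 1] fs_act_mult fs_act_const fs_scale_def phi_nop_s[OF f] flip: One_nat_def)
  next
    case 2
    then show ?thesis using Cons
      by (simp add: wop_def[of n i] nop_def[of f n i] fs_act_mult fs_act_letter fs_letter_def phi_const_mult
          del: mult_pCons_left)
  next
    case 3
    then have "i = n + 2 + (i - n - 2)" by simp
    then show ?thesis using Cons 3 phi_nop_D[OF f, of n "i - n - 2" ?h]
      by (simp add: wop_def[of n i] fs_act_mult fs_act_letter)
  qed
qed

lemma fs_act_wev:
  fixes f :: "(nat, 'k::field_char_0) mpoly"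
  assumes f: "f \<noteq> 0" and u: "keys u \<subseteq> mon0 n"
  shows "fs_act f (wev n u) 1 = phi f (nev n f u)"
  using u
proof (rule vec_single_induct)
  interpret W: letter_rep n "wop n" "\<lambda>a :: 'k. weyl_const [:a:]" by (rule letter_rep_wop)
  interpret N: letter_rep n "nop f n" "\<lambda>a. [:Const a:]" by (rule letter_rep_nop)
  show "fs_act f (wev n 0) 1 = phi f (nev n f 0)" by (simp add: fs_act_0)
  fix m and a :: 'k assume m: "m \<in> mon0 n"
  have "set (word m) \<subseteq> indices n - {0}"
    using set_word[of m] m by (auto simp: mon0_def mon_def word_def)
  then show "fs_act f (wev n (Poly_Mapping.single m a)) 1 = phi f (nev n f (Poly_Mapping.single m a))"
    using fs_act_word[OF f]
    by (simp add: W.ev_single N.ev_single fs_act_mult fs_act_const fs_scale_def phi_const_mult map_poly_pCons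
        del: mult_pCons_left)
next
  interpret W: letter_rep n "wop n" "\<lambda>a :: 'k. weyl_const [:a:]" by (rule letter_rep_wop)
  interpret N: letter_rep n "nop f n" "\<lambda>a. [:Const a:]" by (rule letter_rep_nop)
  fix p q assume "fs_act f (wev n p) 1 = phi f (nev n f p)" "fs_act f (wev n q) 1 = phi f (nev n f q)"
  then show "fs_act f (wev n (p + q)) 1 = phi f (nev n f (p + q))"
    by (simp add: W.ev_add N.ev_add fs_act_add phi_add)
qed

lemma Ann_fs_wev:
  fixes f :: "(nat, 'k::field_char_0) mpoly"
  assumes "f \<noteq> 0" "keys f \<subseteq> exponents n d" "keys u \<subseteq> mon0 n"
  shows "wev n u \<in> Ann_fs n f \<longleftrightarrow> u \<in> ann_span n d f"
  using ann_span_iff_kernel[OF assms(2) mon0_mon[OF assms(3)]] fs_act_wev[OF assms(1,3)]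
    phi_eq_0[OF assms(1)] wev_over[OF mon0_mon[OF assms(3)]]
  by (auto simp: Ann_fs_def)

lemma left_ideal_add: "P \<in> left_ideal W G \<Longrightarrow> Q \<in> left_ideal W G \<Longrightarrow> P + Q \<in> left_ideal W G"
  by (induction rule: left_ideal.induct) (auto simp: add.assoc intro: left_ideal.step)

lemma left_ideal_base: "r \<in> W \<Longrightarrow> g \<in> G \<Longrightarrow> r * g \<in> left_ideal W G"
  using left_ideal.step[OF left_ideal.zero, of r W g G] by simp

lemma left_ideal_mult:
  assumes "P \<in> left_ideal (weyl_over n K) G" "r \<in> weyl_over n K"
  shows "r * P \<in> left_ideal (weyl_over n K) G"
  using assms(1)
proof (induction rule: left_ideal.induct)
  case zero
  show ?case by (simp add: left_ideal.zero)
next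
  case (step P q g)
  then show ?case
    using weyl_over.mult[OF assms(2) step.hyps(2)]
    by (simp add: distrib_left mult.assoc[symmetric] left_ideal.step)
qed

lemma wop_word_mult: "foldr (wop n) w h = foldr (wop n) w 1 * h"
proof (induction w)
  case (Cons i w)
  then show ?case by (simp add: wop_def mult.assoc)
qed simp

text \<open>A normal form of an operator in \<open>Ann(f^s)\<close> lies in the left ideal of the generators, and since it is free
  of \<open>t\<close>, it is a combination of multiples of the basis elements free of \<open>t\<close>, where the
  cofactors are free of \<open>t\<close> as well.\<close>

theorem Ann_fs_generated:
  fixes f :: "(nat, 'k::field_char_0) mpoly"
  assumes f: "f \<noteq> 0" "keys f \<subseteq> exponents n d"
    and S: "(E, U, G, T) \<in> set (run n d)" "satisfies (\<lambda>c. cval (at_point (lookup f)) c = 0) (E, U, G, T)"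
  shows "Ann_fs n f = left_ideal (weyl_over n UNIV)
    ((\<lambda>g. wev n (fval (at_point (lookup f)) g)) ` {g \<in> set G. entry (flm g) 0 = 0})"
proof -
  interpret W: letter_rep n "wop n" "\<lambda>a :: 'k. weyl_const [:a:]" by (rule letter_rep_wop)
  let ?e = "at_point (lookup f)"
  let ?G = "{g \<in> set G. entry (flm g) 0 = 0}"
  let ?X = "(\<lambda>g. wev n (fval ?e g)) ` ?G"
  have ok: "g \<noteq> [] \<and> (\<exists>k. graded n d k g)" if "g \<in> set G" for g
    using run_state_ok[OF S(1)] that by (auto simp: state_ok_def polys_ok_def)
  have mon0: "keys (fval ?e g) \<subseteq> mon0 n" if g: "g \<in> ?G" for g
  proof
    fix m assume m: "m \<in> keys (fval ?e g)"
    obtain k where k: "graded n d k g" "g \<noteq> []" using ok g by blast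
    have bnd: "bounded n (fval ?e g) (flm g)" using bounded_fval[OF k] .
    then have "m \<le> flm g" "m \<in> mon n" "flm g \<in> mon n" using m by (auto simp: bounded_def)
    moreover from this have "m ! 0 \<le> flm g ! 0" by (intro monomial_le_nth_0) (auto simp: mon_def)
    ultimately show "m \<in> mon0 n" using g by (auto simp: mon0_def mon_def)
  qed
  show ?thesis
  proof (intro equalityI subsetI)
    fix P assume P: "P \<in> Ann_fs n f"
    then obtain u where u: "keys u \<subseteq> mon0 n" "P = wev n u"
      using wev_surj[of P n] by (auto simp: Ann_fs_def)
    then have "u \<in> ann_span n d f" using Ann_fs_wev[OF f u(1)] P by simp
    then have "u \<in> vec.span {lw n w (fval ?e g) | w g. g \<in> set G \<and> entry (flm g) 0 = 0 \<and> set w \<subseteq> indices n - {0}}"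
      using u(1) unfolding ann_span_def by (intro run_basis[OF S]) (auto simp: mon0_def)
    then have "wev n u \<in> left_ideal (weyl_over n UNIV) ?X"
    proof (induction rule: vec.span_induct_alt)
      case base
      show ?case by (simp add: left_ideal.zero)
    next
      case (step c x y)
      then obtain w g where w: "x = lw n w (fval ?e g)" "g \<in> ?G" "set w \<subseteq> indices n - {0}" by blast
      then have "wev n x = foldr (wop n) w 1 * wev n (fval ?e g)"
        using W.ev_lw[OF mon0_mon[OF mon0[OF w(2)]], of w] wop_word_mult[of n w "wev n (fval ?e g)"] by auto
      moreover have "foldr (wop n) w 1 \<in> weyl_over n UNIV"
        using w(3) by (intro wop_word_over one_over) auto
      ultimately have "wev n x \<in> left_ideal (weyl_over n UNIV) ?X"
        using w(2) by (simp only:) (intro left_ideal_base imageI)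
      then have "weyl_const [:c:] * wev n x \<in> left_ideal (weyl_over n UNIV) ?X"
        by (rule left_ideal_mult) (rule weyl_const_over)
      then show ?case using step by (simp add: W.ev_add W.ev_scl left_ideal_add)
    qed
    with u(2) show "P \<in> left_ideal (weyl_over n UNIV) ?X" by simp
  next
    fix P assume "P \<in> left_ideal (weyl_over n UNIV) ?X"
    then show "P \<in> Ann_fs n f"
    proof (induction rule: left_ideal.induct)
      case zero
      show ?case using weyl_const_over[of 0] by (simp add: Ann_fs_def fs_act_0 weyl_const_0)
    next
      case (step P r h)
      then obtain g where g: "g \<in> ?G" "h = wev n (fval ?e g)" by blast
      have "fval ?e g \<in> ann_span n d f"
        using run_correct[OF S] g(1) unfolding ann_span_def correct_at_def
        by (auto intro: gen_span_base)
      then have "h \<in> Ann_fs n f" using Ann_fs_wev[OF f mon0[OF g(1)]] g(2) by simp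
      moreover have "fs_act f r 0 = 0"
        unfolding fs_act_def by (rule weyl_representation.rho_0_right[OF weyl_representation_fs])
      ultimately show ?case using step
        by (auto simp: Ann_fs_def fs_act_add fs_act_mult intro: weyl_over.add weyl_over.mult)
    qed
  qed
qed

section \<open>Reading the output\<close>

lemma map_enc_nat [simp]: "map enc (v :: nat list) = v"
  by (induction v) auto

lemma dec_list_enc: "dec_list g (enc xs) = map (\<lambda>x. g (enc x)) xs"
  by (simp add: dec_list_def o_def)

lemma dec_pair_enc: "dec_pair g h (enc p) = (g (enc (fst p)), h (enc (snd p)))"
  by (simp add: dec_pair_def)

lemma dec_rat_enc: "dec_rat (enc (2 :: nat, 0 :: nat)) = 1" "dec_rat (enc (1 :: nat, 0 :: nat)) = - 1"
  by (simp_all add: dec_rat_def int_decode_def sum_decode_def)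

lemma dec_exponent_enc: "dec_exponent (enc v) = Poly_Mapping.nth v"
  by (simp add: dec_exponent_def)

definition coeff_of :: "fcoeff \<Rightarrow> (nat \<Rightarrow>\<^sub>0 nat, 'k::comm_ring_1) mpoly" where
  "coeff_of = cval (\<lambda>v. Var (Poly_Mapping.nth v))"

lemma dec_mpoly_out_coeff: "dec_mpoly (enc (out_coeff c)) = (coeff_of c :: (nat \<Rightarrow>\<^sub>0 nat, 'k::field_char_0) mpoly)"
proof -
  have *: "Const (dec_rat (enc (if b then 2 else 1 :: nat, 0 :: nat))) =
      (if b then 1 else - 1 :: (nat \<Rightarrow>\<^sub>0 nat, 'k) mpoly)" for b
    by (simp only: dec_rat_enc split: if_split) (simp add: single_uminus)
  show ?thesis
    unfolding dec_mpoly_def dec_list_enc coeff_of_def cval_def out_coeff_def map_map o_def dec_pair_enc fst_conv snd_conv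
      prod.case * dec_exponent_enc ..
qed

lemma dec_mpoly_Nil: "dec_mpoly (enc ([] :: out_coeff)) = 0"
  by (simp add: dec_mpoly_def dec_list_enc del: enc_list_def)

lemma Poly_monom: "Poly (replicate j 0 @ [a]) = monom a j"
  by (induction j) (simp_all add: monom_Suc monom_0)

lemma dec_coeff_enc: "dec_coeff (enc (replicate j [] @ [out_coeff c])) = monom (coeff_of c :: (nat \<Rightarrow>\<^sub>0 nat, 'k::field_char_0) mpoly) j"
  unfolding dec_coeff_def dec_list_enc
  by (simp add: dec_mpoly_Nil dec_mpoly_out_coeff Poly_monom del: enc_list_def)

lemma dec_letter_enc: "dec_letter (enc (i + i)) = LX i" "dec_letter (enc (Suc (i + i))) = LD i"
  by (simp_all add: dec_letter_def sum_decode_def flip: mult_2)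

definition letters_of :: "nat \<Rightarrow> nat list \<Rightarrow> weyl_letter list" where
  "letters_of n m = concat (map (\<lambda>i. replicate (entry m (2 + i)) (LX i)) [0..<n]) @
     concat (map (\<lambda>i. replicate (entry m (n + 2 + i)) (LD i)) [0..<n])"

lemma dec_out_word: "map (\<lambda>x. dec_letter (enc x)) (out_word n m) = letters_of n m"
  unfolding out_word_def letters_of_def map_append map_concat map_map o_def map_replicate dec_letter_enc ..

definition oper_of :: "nat \<Rightarrow> fpoly \<Rightarrow> (nat \<Rightarrow>\<^sub>0 nat, 'k::comm_ring_1) mpoly poly weyl" where
  "oper_of n p = (\<Sum>t\<leftarrow>p. weyl_const (monom (coeff_of (fst t)) (entry (snd t) 1)) *
     prod_list (map weyl_letter (letters_of n (snd t))))"

lemma dec_weyl_out_op: "dec_weyl (enc (out_op n p)) = (oper_of n p :: (nat \<Rightarrow>\<^sub>0 nat, 'k::field_char_0) mpoly poly weyl)"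
  unfolding dec_weyl_def dec_list_enc oper_of_def out_op_def map_map o_def dec_pair_enc fst_conv snd_conv
    dec_coeff_enc prod.case
  by (simp only: dec_out_word[symmetric] map_map o_def)

definition presentation_of :: "nat \<Rightarrow> state \<Rightarrow> 'k::field_char_0 presentation" where
  "presentation_of n S = (case S of (E, U, G, T) \<Rightarrow>
     (map (oper_of n) (filter (\<lambda>g. entry (flm g) 0 = 0) G), map coeff_of E, [coeff_of (foldr cmul U [(True, [])])]))"

lemma dec_output_algorithm: "dec_output (enc (algorithm n d)) = map (presentation_of n) (run n d)"
proof -
  have "(dec_list dec_weyl (enc (fst (out_state n S))), dec_list dec_mpoly (enc (fst (snd (out_state n S)))),
      dec_list dec_mpoly (enc (snd (snd (out_state n S))))) = (presentation_of n S :: 'k::field_char_0 presentation)" for S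
    unfolding dec_list_enc by (cases S) (simp add: out_state_def presentation_of_def o_def dec_weyl_out_op dec_mpoly_out_coeff
        del: enc_list_def)
  then show ?thesis
    unfolding dec_output_def dec_list_enc dec_pair_enc algorithm_def map_map o_def by (intro map_cong) auto
qed

subsection \<open>Specialization\<close>

lemma cval_hom:
  assumes "coeff_hom h"
  shows "h (cval e c) = cval (\<lambda>v. h (e v)) c"
proof -
  interpret coeff_hom h by (rule assms)
  have neg: "h (- x) = - h x" for x using h_add[of "- x" x] by (simp add: eq_neg_iff_add_eq_0)
  have prod: "h (prod_list xs) = prod_list (map h xs)" for xs by (induction xs) (simp_all add: h_mult)
  show ?thesis unfolding cval_def by (induction c) (simp_all add: h_add h_mult neg prod o_def)
qed

lemma mpoly_eval_Var: "mpoly_eval c (Var v) = c v"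
  by (simp add: mpoly_eval_def Var_def monom_eval_def)

lemma mpoly_eval_coeff_of: "mpoly_eval c (coeff_of k) = cval (at_point c) k"
  unfolding coeff_of_def cval_hom[OF coeff_hom_mpoly_eval] mpoly_eval_Var at_point_def ..

lemma specialize_abs: "specialize c (abs_weyl p) = abs_weyl (free_weyl_map (map_poly (mpoly_eval c)) p)"
  by (rule specialize.abs_eq)

lemma coeff_hom_specialize: "coeff_hom (map_poly (mpoly_eval c))" for c :: "'v \<Rightarrow> 'k::comm_ring_1"
  by (intro map_poly_hom_aux coeff_hom_mpoly_eval)

lemma specialize_add: "specialize c (P + Q) = specialize c P + specialize c Q"
  by (induction P rule: weyl.abs_induct; induction Q rule: weyl.abs_induct)
    (simp only: plus_weyl.abs_eq specialize_abs coeff_hom.map_add[OF coeff_hom_specialize])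

lemma specialize_mult: "specialize c (P * Q) = specialize c P * specialize c Q"
  by (induction P rule: weyl.abs_induct; induction Q rule: weyl.abs_induct)
    (simp only: times_weyl.abs_eq specialize_abs coeff_hom.map_mult[OF coeff_hom_specialize])

lemma specialize_const: "specialize c (weyl_const q) = weyl_const (map_poly (mpoly_eval c) q)"
  unfolding weyl_const_def specialize_abs coeff_hom.map_single[OF coeff_hom_specialize] ..

lemma specialize_letter: "specialize c (weyl_letter l) = weyl_letter l"
  unfolding weyl_letter_def specialize_abs coeff_hom.map_single[OF coeff_hom_specialize]
    coeff_hom.h_1[OF coeff_hom_specialize] ..

lemma specialize_0: "specialize c 0 = 0"
  using specialize_const[of c 0] by (simp add: weyl_const_0)

lemma specialize_1: "specialize c 1 = 1"
  using specialize_const[of c 1] by (simp only: weyl_const_1 coeff_hom.h_1[OF coeff_hom_specialize])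

lemma specialize_letters: "specialize c (prod_list (map weyl_letter w)) = prod_list (map weyl_letter w)"
  by (induction w) (simp_all add: specialize_1 specialize_mult specialize_letter)

lemma block_map: "map h (block k (b + k) m) = concat (map (\<lambda>i. replicate (m ! (i + k)) (h (i + k))) [0..<b])"
  by (simp add: block_def map_concat o_def map_replicate flip: map_add_upt)

lemma wop_word:
  assumes "length m = 2 * n + 2" "m ! 0 = 0"
  shows "foldr (wop n) (word m) 1 = weyl_const (monom 1 (m ! 1)) * prod_list (map weyl_letter (letters_of n m))"
proof -
  define lt where "lt i = (if i < n + 2 then LX (i - 2) else LD (i - n - 2))" for i
  have "word m = block 0 0 m @ replicate (m ! 0) 0 @ block 1 (2 * n + 2) m"
    unfolding word_block using assms block_split[of 0 0 "2 * n + 2" m] by simp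
  also have "block 1 (2 * n + 2) m = block 1 1 m @ replicate (m ! 1) 1 @ block 2 (2 * n + 2) m"
    using block_split[of 1 1 "2 * n + 2" m] by (simp add: numeral_2_eq_2)
  also have "block 2 (2 * n + 2) m = block 2 (n + 2) m @ block (n + 2) (n + (n + 2)) m"
  proof -
    have "2 * n + 2 = n + 2 + n" "n + (n + 2) = n + 2 + n" by simp_all
    moreover have "[2..<n + 2 + n] = [2..<n + 2] @ [n + 2..<n + 2 + n]"
      by (rule upt_add_eq_append) simp
    ultimately show ?thesis unfolding block_def by (simp only: map_append concat_append)
  qed
  finally have word: "word m = replicate (m ! 1) 1 @ block 2 (n + 2) m @ block (n + 2) (n + (n + 2)) m"
    using assms(2) by (simp add: block_def)
  have s: "foldr (wop n) (replicate k 1) h = weyl_const (monom 1 k) * h" for k and h :: "'k::comm_ring_1 poly weyl"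
  proof (induction k)
    case (Suc k)
    have "weyl_const (monom 1 (Suc k)) = weyl_const [:0, 1:] * weyl_const (monom (1 :: 'k) k)"
      by (simp add: monom_Suc flip: weyl_const_mult)
    then show ?case using Suc by (simp add: wop_def[of n 1] mult.assoc del: foldr_replicate flip: One_nat_def)
  qed (simp add: weyl_const_1)
  have lt: "foldr (wop n) w 1 = prod_list (map weyl_letter (map lt w))" if "\<forall>i\<in>set w. 2 \<le> i" for w
    using that by (induction w) (auto simp: wop_def lt_def)
  let ?w = "block 2 (n + 2) m @ block (n + 2) (n + (n + 2)) m"
  have letters: "map lt ?w = letters_of n m"
    unfolding letters_of_def map_append block_map using assms
    by (intro arg_cong2[of _ _ _ _ "(@)"] arg_cong[of _ _ concat] map_cong) (auto simp: lt_def add_ac)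
  have "\<forall>i\<in>set ?w. 2 \<le> i"
    using set_block[of 2 "n + 2" m] set_block[of "n + 2" "n + (n + 2)" m] by fastforce
  then have "foldr (wop n) ?w 1 = prod_list (map weyl_letter (letters_of n m))"
    unfolding letters[symmetric] by (rule lt)
  then show ?thesis unfolding word foldr_append o_apply s by (rule arg_cong)
qed

lemma specialize_oper_of:
  assumes "\<forall>t\<in>set p. snd t \<in> mon0 n"
  shows "specialize c (oper_of n p) = wev n (fval (at_point c) p)"
  using assms
proof (induction p)
  case Nil
  show ?case by (simp add: oper_of_def specialize_0 letter_rep.ev_0[OF letter_rep_wop])
next
  case (Cons t p)
  interpret W: letter_rep n "wop n" "\<lambda>a :: 'a. weyl_const [:a:]" by (rule letter_rep_wop)
  have t: "length (snd t) = 2 * n + 2" "snd t ! 0 = 0" using Cons.prems by (auto simp: mon0_def mon_def)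
  let ?a = "cval (at_point c) (fst t)"
  have "specialize c (weyl_const (monom (coeff_of (fst t)) (entry (snd t) 1)) *
      prod_list (map weyl_letter (letters_of n (snd t)))) =
      weyl_const (monom ?a (snd t ! 1)) * prod_list (map weyl_letter (letters_of n (snd t)))"
    using t by (simp add: specialize_mult specialize_const specialize_letters map_poly_monom mpoly_eval_coeff_of)
  also have "weyl_const (monom ?a (snd t ! 1)) = weyl_const [:?a:] * weyl_const (monom 1 (snd t ! 1))"
    by (simp add: smult_monom flip: weyl_const_mult)
  also have "\<dots> * prod_list (map weyl_letter (letters_of n (snd t))) = wev n (Poly_Mapping.single (snd t) ?a)"
    by (simp only: W.ev_single wop_word[OF t] mult.assoc)
  finally show ?case using Cons by (simp add: oper_of_def specialize_add W.ev_add)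
qed

text \<open>Constants are their own specializations. Hence cofactors lift, and the specialization of a left ideal is
  the left ideal of the specialized generators.\<close>

lemma specialize_weyl_over: "specialize c ` weyl_over n (param_ring n d) = weyl_over n (UNIV :: 'k::field poly set)"
proof (intro equalityI subsetI)
  fix P assume "P \<in> specialize c ` weyl_over n (param_ring n d)"
  then obtain Q where "P = specialize c Q" "Q \<in> weyl_over n (param_ring n d)" by blast
  from this(2) show "P \<in> weyl_over n UNIV"
    unfolding \<open>P = _\<close>
    by (induction rule: weyl_over.induct)
      (auto simp: specialize_const specialize_letter specialize_add specialize_mult intro: weyl_over.intros)
next
  fix P :: "'k poly weyl" assume "P \<in> weyl_over n UNIV"
  then show "P \<in> specialize c ` weyl_over n (param_ring n d)"
  proof (induction rule: weyl_over.induct)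
    case (const q)
    have "map_poly Const q \<in> param_ring n d"
      by (auto simp: param_ring_def coeff_map_poly mpoly_over_def)
    moreover have "map_poly (mpoly_eval c) (map_poly Const q) = q"
      by (rule poly_eqI) (simp add: coeff_map_poly mpoly_eval_def monom_eval_def)
    ultimately show ?case by (metis image_eqI specialize_const weyl_over.const)
  next
    case (X i)
    then show ?case by (metis image_eqI specialize_letter weyl_over.X)
  next
    case (D i)
    then show ?case by (metis image_eqI specialize_letter weyl_over.D)
  next
    case (add P Q)
    then show ?case by (auto simp flip: specialize_add intro!: imageI weyl_over.add)
  next
    case (mult P Q)
    then show ?case by (auto simp flip: specialize_mult intro!: imageI weyl_over.mult)
  qed
qed

lemma specialize_left_ideal:
  "specialize c ` left_ideal W G = left_ideal (specialize c ` W) (specialize c ` G)"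
proof (intro equalityI subsetI)
  fix P assume "P \<in> specialize c ` left_ideal W G"
  then obtain Q where "P = specialize c Q" "Q \<in> left_ideal W G" by blast
  from this(2) show "P \<in> left_ideal (specialize c ` W) (specialize c ` G)"
    unfolding \<open>P = _\<close>
    by (induction rule: left_ideal.induct)
      (auto simp: specialize_0 specialize_add specialize_mult intro: left_ideal.intros)
next
  fix P assume "P \<in> left_ideal (specialize c ` W) (specialize c ` G)"
  then show "P \<in> specialize c ` left_ideal W G"
  proof (induction rule: left_ideal.induct)
    case zero
    show ?case by (metis image_eqI left_ideal.zero specialize_0)
  next
    case (step P r g)
    then obtain P' r' g' where *: "P = specialize c P'" "P' \<in> left_ideal W G" "r = specialize c r'" "r' \<in> W"
      "g = specialize c g'" "g' \<in> G" by blast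
    then have "r * g + P = specialize c (r' * g' + P')" by (simp add: specialize_add specialize_mult)
    then show ?case using left_ideal.step[OF *(2,4,6)] by blast
  qed
qed

subsection \<open>Forms\<close>

definition hom_polys :: "'v set \<Rightarrow> nat \<Rightarrow> ('v, 'k::comm_ring_1) mpoly set" where
  "hom_polys A e = {p. \<forall>m\<in>keys p. keys m \<subseteq> A \<and> mdeg m = e}"

lemma hom_polys_add: "p \<in> hom_polys A e \<Longrightarrow> q \<in> hom_polys A e \<Longrightarrow> p + q \<in> hom_polys A e"
  using Poly_Mapping.keys_add[of p q] by (auto simp: hom_polys_def)

lemma hom_polys_mult: "p \<in> hom_polys A e \<Longrightarrow> q \<in> hom_polys A e' \<Longrightarrow> p * q \<in> hom_polys A (e + e')"
  unfolding hom_polys_def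
proof (intro CollectI ballI)
  fix m assume *: "p \<in> {p. \<forall>m\<in>keys p. keys m \<subseteq> A \<and> mdeg m = e}"
    "q \<in> {p. \<forall>m\<in>keys p. keys m \<subseteq> A \<and> mdeg m = e'}" "m \<in> keys (p * q)"
  then obtain a b where "m = a + b" "a \<in> keys p" "b \<in> keys q" using keys_mult[of p q] by blast
  moreover from this have "keys a \<subseteq> A" "mdeg a = e" "keys b \<subseteq> A" "mdeg b = e'" using * by auto
  ultimately show "keys m \<subseteq> A \<and> mdeg m = e + e'"
    using Poly_Mapping.keys_add[of a b] by (simp add: mdeg_add) blast
qed

lemma hom_polys_one: "1 \<in> hom_polys A 0"
  by (auto simp: hom_polys_def mdeg_def simp flip: single_one)

lemma hom_polys_Var: "v \<in> A \<Longrightarrow> Var v \<in> hom_polys A 1"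
  by (auto simp: hom_polys_def Var_def mdeg_def split: if_splits)

lemma hom_polys_prod: "\<forall>p\<in>set ps. p \<in> hom_polys A 1 \<Longrightarrow> prod_list ps \<in> hom_polys A (length ps)"
  using hom_polys_mult[of _ A 1] by (induction ps) (auto simp: hom_polys_one)

lemma coeff_of_hom:
  assumes "form_of n d e c"
  shows "(coeff_of c :: (nat \<Rightarrow>\<^sub>0 nat, 'k::comm_ring_1) mpoly) \<in> hom_polys (exponents n d) (nat e)"
  using assms
proof (induction c)
  case Nil
  show ?case by (simp add: coeff_of_def hom_polys_def)
next
  case (Cons t c)
  let ?m = "prod_list (map (\<lambda>v. Var (Poly_Mapping.nth v)) (snd t)) :: (nat \<Rightarrow>\<^sub>0 nat, 'k) mpoly"
  have "\<forall>p\<in>set (map (\<lambda>v. Var (Poly_Mapping.nth v)) (snd t)). p \<in> hom_polys (exponents n d) 1"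
    using Cons.prems by (auto simp: form_of_def simp del: One_nat_def intro!: hom_polys_Var nth_exponents)
  moreover have "length (snd t) = nat e" using Cons.prems by (auto simp: form_of_def)
  ultimately have m: "?m \<in> hom_polys (exponents n d) (nat e)"
    using hom_polys_prod[of "map (\<lambda>v. Var (Poly_Mapping.nth v)) (snd t)" "exponents n d"] by simp
  then have "- ?m \<in> hom_polys (exponents n d) (nat e)" by (simp add: hom_polys_def)
  with m Cons show ?case by (simp add: coeff_of_def cval_def form_of_def hom_polys_add)
qed

lemma hom_polys_forms: "p \<in> hom_polys (exponents n d) e \<Longrightarrow> p \<in> forms n d"
  by (auto simp: hom_polys_def forms_def mpoly_over_def homogeneous_def)

lemma coeff_of_forms: "form_of n d e c \<Longrightarrow> coeff_of c \<in> forms n d"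
  using coeff_of_hom hom_polys_forms by blast

lemma hom_component_hom_polys:
  assumes "p \<in> hom_polys A k"
  shows "hom_component e p = (if e = k then p else 0)"
proof (rule poly_mapping_eqI)
  fix m show "lookup (hom_component e p) m = lookup (if e = k then p else 0) m"
    using assms by (cases "m \<in> keys p") (auto simp: lookup_hom_component hom_polys_def in_keys_iff)
qed

text \<open>A rational point is defined through all homogeneous components, so only for forms is membership the
  vanishing of the value.\<close>

lemma rational_point_form:
  assumes "p \<in> hom_polys (exponents n d) k"
  shows "p \<in> rational_point n d c \<longleftrightarrow> mpoly_eval c p = 0"
proof -
  have "p \<in> mpoly_over (exponents n d)" using assms by (auto simp: hom_polys_def mpoly_over_def)
  then show ?thesis by (auto simp: rational_point_def hom_component_hom_polys[OF assms])
qed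

lemma form_of_product: "\<forall>c\<in>set U. \<exists>e. form_of n d e c \<Longrightarrow> \<exists>e. form_of n d e (foldr cmul U [(True, [])])"
proof (induction U)
  case Nil
  show ?case by (intro exI[of _ 0]) (simp add: form_of_def)
next
  case (Cons c U)
  then show ?case using form_of_cmul by fastforce
qed

lemma coeff_of_product: "coeff_of (foldr cmul U [(True, [])]) = prod_list (map coeff_of U)"
  by (induction U) (simp_all add: coeff_of_def cval_cmul, simp add: cval_def)

lemma presented_set_Proj_space: "presented_set n d D \<subseteq> Proj_space n d"
  by (cases D) (auto simp: presented_set_def Proj_closed_def)

text \<open>Since points are prime ideals, the product of the coefficients assumed nonzero lies outside of a point
  exactly when each of them does.\<close>

lemma presented_set_satisfies:
  fixes \<pp> :: "(nat \<Rightarrow>\<^sub>0 nat, 'k::field_char_0) mpoly set"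
  assumes \<pp>: "\<pp> \<in> Proj_space n d" and ok: "state_ok n d S"
  shows "\<pp> \<in> presented_set n d (presentation_of n S) \<longleftrightarrow> satisfies (\<lambda>c. coeff_of c \<in> \<pp>) S"
proof -
  obtain E U G T where S: "S = (E, U, G, T)" by (cases S)
  let ?R = "mpoly_ring (exponents n d) :: (nat \<Rightarrow>\<^sub>0 nat, 'k) mpoly ring"
  interpret primeideal \<pp> ?R using \<pp> by (simp add: Proj_space_def)
  have over: "(coeff_of c :: (nat \<Rightarrow>\<^sub>0 nat, 'k) mpoly) \<in> mpoly_over (exponents n d)" if "form_of n d e c" for e c
  proof -
    have "(coeff_of c :: (nat \<Rightarrow>\<^sub>0 nat, 'k) mpoly) \<in> forms n d" using that by (rule coeff_of_forms)
    then show ?thesis by (simp add: forms_def)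
  qed
  have one: "(1 :: (nat \<Rightarrow>\<^sub>0 nat, 'k) mpoly) \<notin> \<pp>"
    using one_imp_carrier I_notcarr by (auto simp: mpoly_ring_def)
  have mult: "p * q \<in> \<pp> \<longleftrightarrow> p \<in> \<pp> \<or> q \<in> \<pp>"
    if "p \<in> mpoly_over (exponents n d)" "q \<in> mpoly_over (exponents n d)" for p q
    using that I_prime[of p q] I_l_closed[of q p] I_r_closed[of p q] by (auto simp: mpoly_ring_def)
  have "prod_list (map coeff_of V) \<in> \<pp> \<longleftrightarrow> (\<exists>c\<in>set V. coeff_of c \<in> \<pp>)" if "\<forall>c\<in>set V. \<exists>e. form_of n d e c" for V
    using that
  proof (induction V)
    case (Cons c V)
    obtain e e' where "form_of n d e c" "form_of n d e' (foldr cmul V [(True, [])])"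
      using Cons.prems form_of_product[of V n d] by auto
    then have "(coeff_of c :: (nat \<Rightarrow>\<^sub>0 nat, 'k) mpoly) \<in> mpoly_over (exponents n d)"
      "(prod_list (map coeff_of V) :: (nat \<Rightarrow>\<^sub>0 nat, 'k) mpoly) \<in> mpoly_over (exponents n d)"
      using over[of e c] over[of e' "foldr cmul V [(True, [])]"] by (simp_all add: coeff_of_product)
    from mult[OF this] Cons show ?case by simp
  qed (simp add: one)
  then have U: "coeff_of (foldr cmul U [(True, [])]) \<in> \<pp> \<longleftrightarrow> (\<exists>c\<in>set U. coeff_of c \<in> \<pp>)"
    using ok unfolding coeff_of_product by (simp add: S state_ok_def)
  have "\<pp> \<in> presented_set n d (presentation_of n S) \<longleftrightarrow>
      (\<forall>c\<in>set E. coeff_of c \<in> \<pp>) \<and> coeff_of (foldr cmul U [(True, [])]) \<notin> \<pp>"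
    using \<pp> by (auto simp: S presented_set_def presentation_of_def Proj_closed_def)
  then show ?thesis unfolding U by (simp add: S satisfies_def)
qed

lemma oper_of_over:
  assumes "graded n d e p"
  shows "(oper_of n p :: (nat \<Rightarrow>\<^sub>0 nat, 'k::field_char_0) mpoly poly weyl) \<in> weyl_over n (param_ring n d)"
proof -
  let ?K = "param_ring n d :: (nat \<Rightarrow>\<^sub>0 nat, 'k) mpoly poly set"
  have "0 \<in> ?K" "1 \<in> ?K"
    by (auto simp: param_ring_def mpoly_over_def coeff_1 simp flip: single_one)
  then have "weyl_const 0 \<in> weyl_over n ?K" "weyl_const 1 \<in> weyl_over n ?K"
    by (auto intro: weyl_over.const)
  then have zero: "0 \<in> weyl_over n ?K" and one: "1 \<in> weyl_over n ?K"
    by (simp_all add: weyl_const_0 weyl_const_1)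
  have letters: "prod_list (map weyl_letter w) \<in> weyl_over n ?K" if "set w \<subseteq> LX ` {..<n} \<union> LD ` {..<n}" for w
    using that one by (induction w) (auto intro: weyl_over.mult weyl_over.X weyl_over.D)
  have "set (letters_of n m) \<subseteq> LX ` {..<n} \<union> LD ` {..<n}" for m by (auto simp: letters_of_def)
  note word = letters[OF this]
  have const: "weyl_const (monom (coeff_of c) k) \<in> weyl_over n ?K" if "form_of n d e c" for e c k
  proof (rule weyl_over.const)
    have "(coeff_of c :: (nat \<Rightarrow>\<^sub>0 nat, 'k) mpoly) \<in> forms n d" using that by (rule coeff_of_forms)
    then have "(coeff_of c :: (nat \<Rightarrow>\<^sub>0 nat, 'k) mpoly) \<in> mpoly_over (exponents n d)" by (simp add: forms_def)
    then show "monom (coeff_of c) k \<in> ?K" by (simp add: param_ring_def mpoly_over_def)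
  qed
  show ?thesis
    using assms
  proof (induction p)
    case (Cons t p)
    then have "oper_of n p \<in> weyl_over n ?K" by (simp add: graded_def)
    moreover have "form_of n d (e + int (snd t ! 0)) (fst t)" using Cons.prems by (simp add: graded_def)
    from weyl_over.add[OF weyl_over.mult[OF const[OF this] word] calculation]
    show ?case by (simp add: oper_of_def)
  qed (simp add: oper_of_def zero)
qed

lemma presentation_presentation_of:
  assumes "state_ok n d S"
  shows "presentation n d (presentation_of n S)"
proof -
  obtain E U G T where S: "S = (E, U, G, T)" by (cases S)
  have "\<exists>e. form_of n d e (foldr cmul U [(True, [])])"
    using assms S by (intro form_of_product) (auto simp: state_ok_def)
  then show ?thesis
    using assms oper_of_over coeff_of_forms
    by (fastforce simp: S presentation_def presentation_of_def state_ok_def polys_ok_def)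
qed

lemma Ann_fs_run:
  fixes f :: "(nat, 'k::field_char_0) mpoly"
  assumes S: "S \<in> set (run n d)"
    and f: "f \<in> mpoly_over {..<n}" "f \<noteq> 0" "\<forall>\<alpha>\<in>keys f. mdeg \<alpha> \<le> d"
    and pt: "rational_point n d (lookup f) \<in> presented_set n d (presentation_of n S)"
  shows "Ann_fs n f = specialize (lookup f) ` presented_ideal n d (presentation_of n S)"
proof -
  obtain E U G T where EUGT: "S = (E, U, G, T)" by (cases S)
  let ?e = "at_point (lookup f)"
  let ?\<pp> = "rational_point n d (lookup f)"
  note ok = run_state_ok[OF S]
  have keys_f: "keys f \<subseteq> exponents n d" using f by (auto simp: exponents_def mpoly_over_def)
  have "?\<pp> \<in> Proj_space n d" using pt presented_set_Proj_space by blast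
  then have sat: "satisfies (\<lambda>c. coeff_of c \<in> ?\<pp>) S" using presented_set_satisfies[OF _ ok] pt by blast
  have "coeff_of c \<in> ?\<pp> \<longleftrightarrow> cval ?e c = 0" if c: "c \<in> set E \<union> set U" for c
  proof -
    have "\<exists>k. form_of n d k c" using ok c EUGT by (auto simp: state_ok_def)
    then obtain k where "form_of n d k c" by blast
    from rational_point_form[OF coeff_of_hom[OF this]] show ?thesis by (simp add: mpoly_eval_coeff_of)
  qed
  with sat have sat': "satisfies (\<lambda>c. cval ?e c = 0) (E, U, G, T)" by (auto simp: EUGT satisfies_def)
  let ?G = "{g \<in> set G. entry (flm g) 0 = 0}"
  have "specialize (lookup f) (oper_of n g) = wev n (fval ?e g)" if g: "g \<in> ?G" for g
  proof (rule specialize_oper_of, rule ballI)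
    fix t assume t: "t \<in> set g"
    have "g \<noteq> []" "\<exists>k. graded n d k g" using ok g EUGT unfolding state_ok_def polys_ok_def by auto
    then obtain k where k: "graded n d k g" "g \<noteq> []" by blast
    have "snd t \<in> mon n" using k(1) t by (auto simp: graded_def)
    moreover have "flm g \<in> mon n" using graded_flm[OF k] .
    ultimately have "snd t ! 0 \<le> flm g ! 0" using flm_ge[OF t] by (intro monomial_le_nth_0) (auto simp: mon_def)
    with \<open>snd t \<in> mon n\<close> \<open>flm g \<in> mon n\<close> g show "snd t \<in> mon0 n" by (auto simp: mon0_def mon_def)
  qed
  then have "specialize (lookup f) ` oper_of n ` ?G = (\<lambda>g. wev n (fval ?e g)) ` ?G"
    unfolding image_image by (rule image_cong[OF refl])
  then have "specialize (lookup f) ` presented_ideal n d (presentation_of n S) =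
      left_ideal (weyl_over n UNIV) ((\<lambda>g. wev n (fval ?e g)) ` ?G)"
    by (simp add: presented_ideal_def presentation_of_def EUGT specialize_left_ideal specialize_weyl_over)
  moreover have "(E, U, G, T) \<in> set (run n d)" using S EUGT by simp
  ultimately show ?thesis using Ann_fs_generated[OF f(2) keys_f _ sat'] by (simp only:)
qed

theorem mainTheorem4:
  "\<exists>F. \<forall>n>0. \<forall>d>0. \<exists>code. computes F [n, d] code \<and>
     (let out = set (dec_output code :: 'k::field_char_0 presentation list) in
       (\<forall>D\<in>out. presentation n d D) \<and>
       (\<Union>D\<in>out. presented_set n d D) = Proj_space n d \<and>
       (\<forall>D\<in>out. \<forall>f :: (nat, 'k) mpoly.
          f \<in> mpoly_over {..<n} \<longrightarrow> f \<noteq> 0 \<longrightarrow> (\<forall>\<alpha>\<in>keys f. mdeg \<alpha> \<le> d) \<longrightarrow>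
          rational_point n d (lookup f) \<in> presented_set n d D \<longrightarrow>
          Ann_fs n f = specialize (lookup f) ` presented_ideal n d D))"
proof -
  from algorithm_computable obtain F where F: "\<forall>n d. computes F [n, d] (enc (algorithm n d))" ..
  have out: "set (dec_output (enc (algorithm n d)) :: 'k presentation list) = presentation_of n ` set (run n d)" for n d
    unfolding dec_output_algorithm set_map ..
  have cover: "(\<Union>S\<in>set (run n d). presented_set n d (presentation_of n S :: 'k presentation)) = Proj_space n d" for n d
  proof (rule equalityI)
    show "(\<Union>S\<in>set (run n d). presented_set n d (presentation_of n S :: 'k presentation)) \<subseteq> Proj_space n d"
      by (intro UN_least presented_set_Proj_space)
    show "Proj_space n d \<subseteq> (\<Union>S\<in>set (run n d). presented_set n d (presentation_of n S :: 'k presentation))"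
    proof
    fix \<pp> :: "(nat \<Rightarrow>\<^sub>0 nat, 'k) mpoly set" assume \<pp>: "\<pp> \<in> Proj_space n d"
    obtain S where "S \<in> set (run n d)" "satisfies (\<lambda>c. coeff_of c \<in> \<pp>) S" using run_satisfies by blast
    then show "\<pp> \<in> (\<Union>S\<in>set (run n d). presented_set n d (presentation_of n S))"
      using presented_set_satisfies[OF \<pp> run_state_ok] by blast
    qed
  qed
  have pres: "presentation n d (presentation_of n S :: 'k presentation)" if "S \<in> set (run n d)" for n d S
    using presentation_presentation_of[OF run_state_ok[OF that]] .
  show ?thesis
    unfolding Let_def
  proof (intro exI[of _ F] allI impI)
    fix n d :: nat
    show "\<exists>code. computes F [n, d] code \<and>
       ((\<forall>D\<in>set (dec_output code :: 'k presentation list). presentation n d D) \<and>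
       (\<Union>D\<in>set (dec_output code :: 'k presentation list). presented_set n d D) = Proj_space n d \<and>
       (\<forall>D\<in>set (dec_output code :: 'k presentation list). \<forall>f :: (nat, 'k) mpoly.
          f \<in> mpoly_over {..<n} \<longrightarrow> f \<noteq> 0 \<longrightarrow> (\<forall>\<alpha>\<in>keys f. mdeg \<alpha> \<le> d) \<longrightarrow>
          rational_point n d (lookup f) \<in> presented_set n d D \<longrightarrow>
          Ann_fs n f = specialize (lookup f) ` presented_ideal n d D))"
    proof (intro exI[of _ "enc (algorithm n d)"] conjI, unfold out)
      show "computes F [n, d] (enc (algorithm n d))" by (rule F[rule_format])
      show "\<forall>D\<in>presentation_of n ` set (run n d). presentation n d (D :: 'k presentation)"
        using pres by blast
      show "(\<Union>D\<in>presentation_of n ` set (run n d). presented_set n d (D :: 'k presentation)) = Proj_space n d"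
        using cover by simp
    qed (use Ann_fs_run in blast)
  qed
qed


end
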